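(* Let $M$ be a hyperbolic once-punctured torus bundle with fundamental group $\Gamma$ and holonomy $\rho:\Gamma\to\mathrm{PSO}(3,1)\subset\mathrm{PGL}(4,\mathbb{R})$. Let $\mathfrak{g}$ denote the $\Gamma$-module $\mathfrak{sl}(4,\mathbb{R})$ associated to the composition $\mathrm{Ad}\,\rho:\Gamma\to\mathrm{Aut}(\mathfrak{g})$. If the twisted Alexander polynomial of $\mathrm{Ad}\,\rho$ has $1$ as a root of multiplicity $5$, then $M$ is infinitesimally projectively rigid rel cusp.
   Context: A hyperbolic once-punctured torus bundle $M$ is a fiber bundle over $S^1$ with fiber a once-punctured torus $F$ and monodromy $\phi\in \mathrm{SL}(2,\mathbb{Z})$, $|\mathrm{tr}\,\phi|>2$; it carries a unique complete hyperbolic structure. With $F_2=\langle a,b\rangle=\pi_1(F)$ free of rank 2, and $\phi$ also denoting the automorphism of $F_2$ representing the monodromy, $\Gamma=\pi_1(M)=\langle a,b,x\mid xax^{-1}=\phi(a),\ xbx^{-1}=\phi(b)\rangle$, where $x$ is a meridian of the boundary torus. $\mathrm{PSO}(3,1)$ is the projectivization of the identity component $\mathrm{SO}^0(3,1)$ of the isometry group of the form $x_1y_1+x_2y_2+x_3y_3-x_4y_4$ on $\mathbb{R}^4$. The holonomy $\rho$ is the discrete faithful representation $\Gamma\to\mathrm{PSO}(3,1)$ of the complete hyperbolic structure. $\Gamma$ acts on $\mathfrak{g}=\mathfrak{sl}(4,\mathbb{R})$ by $gX=\mathrm{Ad}\rho(g)X=\rho(g)X\rho(g)^{-1}$. Infinitesimally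 projectively rigid rel cusp: viewing $M$ as a compact manifold with torus boundary $\partial M$, the map $i^*:H^1(M;\mathfrak{sl}(4,\mathbb{R})_{\mathrm{Ad}\rho})\to H^1(\partial M;\mathfrak{sl}(4,\mathbb{R})_{\mathrm{Ad}\rho})$ induced by the inclusion $\partial M\subset M$ (twisted cohomology) is injective. Twisted Alexander polynomial: let $\Gamma=\langle a_1,\dots,a_n\mid r_1,\dots,r_{n-1}\rangle$ be a deficiency-one presentation, $\sigma:\Gamma\to\mathrm{GL}(l,K)$ a representation over a field $K$, and $\alpha:\Gamma\to\langle t\rangle\cong\mathbb{Z}$ a surjective homomorphism. Let $\Phi:\mathbb{Z}F_n\to \mathrm{M}(l,K[t,t^{-1}])$ be the ring homomorphism obtained from $\mathbb{Z}F_n\to\mathbb{Z}\Gamma$ followed by $\sigma\otimes\alpha$ (so $g\mapsto \alpha(g)\sigma(g)$). The twisted Alexander matrix is the $(n-1)\times n$ block matrix with $(i,j)$ block $\Phi(\partial r_i/\partial a_j)$, where $\partial/\partial a_j:F_n\to\mathbb{Z}F_n$ is the Fox derivative, determined by $\partial(uv)/\partial a_j=\partial u/\partial a_j+u\,\partial v/\partial a_j$ and $\partial a_i/\partial a_j=\delta_{ij}$. Choosing $k$ with $\det\Phi(1-a_k)\neq0$ and letting $\mathcal{A}_{\sigma,\alpha,k}$ be this matrix with its $k$-th block column removed, viewed as an $l(n-1)\times l(n-1)$ matrix, the twisted Alexander polynomial is $\Delta_{\sigma,\alpha}(t)=\det\mathcal{A}_{\sigma,\alpha,k}/\det\Phi(1-a_k)$.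 It does not depend on $k$ and is well defined up to multiplication by nonzero elements of $K$ and by powers $t^{ls}$, $s\in\mathbb{Z}$. Here it is taken for the presentation of $\Gamma$ above, $\sigma=\mathrm{Ad}\,\rho$ on $\mathfrak{g}\cong\mathbb{R}^{15}$, and $\alpha:\Gamma\to\Gamma/F_2\cong\langle t\rangle$ with $\alpha(F_2)=1$, $\alpha(x)=t$. *)

theory Defs
  imports
    "HOL-Analysis.Analysis"
    "HOL-Algebra.Generated_Groups"
    "HOL-Algebra.Elementary_Groups"
    "HOL-Library.Poly_Mapping"
    "Jordan_Normal_Form.Determinant"
begin

no_notation Matrix.vec_index (infixl "$" 100)
hide_const (open) Determinants.det Finite_Cartesian_Product.mat

section \<open>Free groups and presented groups\<close>

text \<open>The letter \<open>(i, True)\<close> stands for the generator number \<open>i\<close>, and \<open>(i, False)\<close> for its inverse.\<close>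

type_synonym letter = "nat \<times> bool"
type_synonym word = "letter list"

abbreviation gen :: "nat \<Rightarrow> word" where
  "gen i \<equiv> [(i, True)]"

abbreviation gen_inv :: "nat \<Rightarrow> word" where
  "gen_inv i \<equiv> [(i, False)]"

abbreviation cancels :: "letter \<Rightarrow> letter \<Rightarrow> bool" where
  "cancels l m \<equiv> fst l = fst m \<and> snd l \<noteq> snd m"

definition reduced :: "word \<Rightarrow> bool" where
  "reduced = successively (\<lambda>l m. \<not> cancels l m)"

fun push :: "letter \<Rightarrow> word \<Rightarrow> word" where
  "push l [] = [l]"
| "push l (m # w) = (if cancels l m then w else l # m # w)"

definition reduce :: "word \<Rightarrow> word" where
  "reduce w = foldr push w []"

definition inv_word :: "word \<Rightarrow> word" where
  "inv_word w = rev (map (\<lambda>(i, s). (i, \<not> s)) w)"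

definition free_group :: "nat \<Rightarrow> word monoid" where
  "free_group n =
    \<lparr> carrier = {w. reduced w \<and> fst ` set w \<subseteq> {..<n}},
      monoid.mult = (\<lambda>u v. reduce (u @ v)),
      one = [] \<rparr>"

definition normal_closure :: "('a, 'b) monoid_scheme \<Rightarrow> 'a set \<Rightarrow> 'a set" where
  "normal_closure G R =
    generate G {g \<otimes>\<^bsub>G\<^esub> r \<otimes>\<^bsub>G\<^esub> inv\<^bsub>G\<^esub> g | g r. g \<in> carrier G \<and> r \<in> R}"

text \<open>The group with generators \<open>0, \<dots>, n - 1\<close> and list of relators \<open>rs\<close>, and the class of a word in it.\<close>

definition presented_group :: "nat \<Rightarrow> word list \<Rightarrow> word set monoid" where
  "presented_group n rs = free_group n Mod normal_closure (free_group n) (set rs)"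

definition word_class :: "nat \<Rightarrow> word list \<Rightarrow> word \<Rightarrow> word set" where
  "word_class n rs w = normal_closure (free_group n) (set rs) #>\<^bsub>free_group n\<^esub> w"

lemma reduced_Nil [simp]: "reduced []"
  by (simp add: reduced_def)

lemma reduced_Cons: "reduced (l # w) \<longleftrightarrow> (w = [] \<or> \<not> cancels l (hd w)) \<and> reduced w"
  by (auto simp: reduced_def successively_Cons)

lemma reduced_push: "reduced w \<Longrightarrow> reduced (push l w)"
  by (cases w) (auto simp: reduced_Cons)

lemma reduce_Nil [simp]: "reduce [] = []"
  by (simp add: reduce_def)

lemma reduce_Cons [simp]: "reduce (l # w) = push l (reduce w)"
  by (simp add: reduce_def)

lemma reduced_reduce [simp]: "reduced (reduce w)"
  by (induction w) (auto intro: reduced_push)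

lemma reduce_id: "reduced w \<Longrightarrow> reduce w = w"
proof (induction w)
  case (Cons l w)
  then show ?case by (cases w) (auto simp: reduced_Cons)
qed simp

lemma push_push: "reduced w \<Longrightarrow> push (i, \<not> s) (push (i, s) w) = w"
  by (cases w; cases "tl w") (auto simp: reduced_Cons)

lemma reduce_append_right: "reduce (u @ reduce v) = reduce (u @ v)"
  by (induction u) (auto simp: reduce_id)

lemma reduce_push_append: "reduce (push l u @ v) = push l (reduce (u @ v))"
proof (cases u)
  case (Cons m w)
  obtain i s where l: "l = (i, s)" by force
  show ?thesis
  proof (cases "cancels l m")
    case True
    then have m: "m = (i, \<not> s)" using l by (cases m) auto
    have "push (i, \<not> \<not> s) (push (i, \<not> s) (reduce (w @ v))) = reduce (w @ v)"
      by (rule push_push) simp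
    then show ?thesis using Cons True l m by simp
  qed (use Cons in auto)
qed simp

lemma reduce_append_left: "reduce (reduce u @ v) = reduce (u @ v)"
  by (induction u) (auto simp: reduce_push_append)

lemma set_push: "set (push l w) \<subseteq> insert l (set w)"
  by (cases w) auto

lemma set_reduce: "set (reduce w) \<subseteq> set w"
proof (induction w)
  case (Cons l w)
  then show ?case using set_push[of l "reduce w"] by auto
qed simp

lemma reduce_inv_word: "reduce (inv_word w @ w) = []"
proof (induction w)
  case (Cons l w)
  obtain i s where l: "l = (i, s)" by force
  have "reduce (inv_word (l # w) @ l # w)
      = reduce (inv_word w @ reduce ((i, \<not> s) # (i, s) # w))"
    unfolding reduce_append_right by (simp add: inv_word_def l)
  also have "reduce ((i, \<not> s) # (i, s) # w) = reduce w"
    by (simp add: push_push)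
  finally show ?case using Cons by (simp add: reduce_append_right)
qed (simp add: inv_word_def)

lemma group_free_group: "group (free_group n)"
proof (rule groupI)
  fix u assume u: "u \<in> carrier (free_group n)"
  have "fst ` set (reduce (inv_word u)) \<subseteq> fst ` set (inv_word u)"
    using set_reduce by blast
  also have "fst ` set (inv_word u) = fst ` set u"
    by (force simp: inv_word_def image_iff)
  finally have "reduce (inv_word u) \<in> carrier (free_group n)"
    using u unfolding free_group_def by (simp, blast)
  moreover have "reduce (inv_word u) \<otimes>\<^bsub>free_group n\<^esub> u = \<one>\<^bsub>free_group n\<^esub>"
    by (simp add: free_group_def reduce_append_left reduce_inv_word)
  ultimately show "\<exists>v\<in>carrier (free_group n). v \<otimes>\<^bsub>free_group n\<^esub> u = \<one>\<^bsub>free_group n\<^esub>"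
    by blast
next
  fix u v assume "u \<in> carrier (free_group n)" "v \<in> carrier (free_group n)"
  then show "u \<otimes>\<^bsub>free_group n\<^esub> v \<in> carrier (free_group n)"
    using set_reduce[of "u @ v"] by (fastforce simp: free_group_def)
qed (auto simp: free_group_def reduce_id reduce_append_left reduce_append_right)

section \<open>Fox calculus\<close>

text \<open>
  An element of the group ring of the free group is a finitely supported function from reduced
  words to the integers; \<open>left_mult u\<close> is multiplication by the group element \<open>u\<close> on the left.
\<close>

type_synonym free_group_ring = "word \<Rightarrow>\<^sub>0 int"

definition left_mult :: "word \<Rightarrow> free_group_ring \<Rightarrow> free_group_ring" where
  "left_mult u f =
    (\<Sum>v\<in>Poly_Mapping.keys f. Poly_Mapping.single (reduce (u @ v)) (Poly_Mapping.lookup f v))"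

fun fox_letter :: "nat \<Rightarrow> letter \<Rightarrow> free_group_ring" where
  "fox_letter j (i, s) =
    (if i \<noteq> j then 0
     else if s then Poly_Mapping.single [] 1
     else - Poly_Mapping.single (gen_inv i) 1)"

fun fox :: "nat \<Rightarrow> word \<Rightarrow> free_group_ring" where
  "fox j [] = 0"
| "fox j (l # w) = fox_letter j l + left_mult [l] (fox j w)"

lemma left_mult_superset:
  assumes "finite A" "Poly_Mapping.keys f \<subseteq> A"
  shows "left_mult u f =
    (\<Sum>v\<in>A. Poly_Mapping.single (reduce (u @ v)) (Poly_Mapping.lookup f v))"
  unfolding left_mult_def
  by (rule sum.mono_neutral_left) (use assms in \<open>auto simp: in_keys_iff\<close>)

lemma left_mult_single: "left_mult u (Poly_Mapping.single v c) = Poly_Mapping.single (reduce (u @ v)) c"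
  by (subst left_mult_superset[where A = "{v}"]) auto

lemma left_mult_add: "left_mult u (f + g) = left_mult u f + left_mult u g"
proof -
  let ?A = "Poly_Mapping.keys f \<union> Poly_Mapping.keys g"
  have "Poly_Mapping.keys (f + g) \<subseteq> ?A"
    by (rule Poly_Mapping.keys_add)
  then show ?thesis
    by (simp add: left_mult_superset[where A = ?A] lookup_add single_add sum.distrib)
qed

lemma left_mult_zero [simp]: "left_mult u 0 = 0"
  by (simp add: left_mult_def)

lemma left_mult_uminus: "left_mult u (- f) = - left_mult u f"
  using left_mult_add[of u f "- f"] by (simp add: eq_neg_iff_add_eq_0 add.commute)

lemma left_mult_sum: "left_mult u (\<Sum>i\<in>I. f i) = (\<Sum>i\<in>I. left_mult u (f i))"
  by (induction I rule: infinite_finite_induct) (simp_all add: left_mult_add)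

lemma left_mult_left_mult: "left_mult u (left_mult v f) = left_mult (reduce (u @ v)) f"
  by (simp add: left_mult_def[of v] left_mult_def[of "reduce (u @ v)"] left_mult_sum
      left_mult_single reduce_append_left reduce_append_right)

lemma left_mult_reduce: "left_mult (reduce u) f = left_mult u f"
  by (simp add: left_mult_def reduce_append_left)

text \<open>
  The derivative does not change under free reduction, and it satisfies the product rule: it is
  the Fox derivative on the free group.
\<close>

definition reduced_support :: "free_group_ring \<Rightarrow> bool" where
  "reduced_support f \<longleftrightarrow> (\<forall>v\<in>Poly_Mapping.keys f. reduced v)"

lemma left_mult_Nil: "reduced_support f \<Longrightarrow> left_mult [] f = f"
  by (rule poly_mapping_eqI)
    (simp add: left_mult_def reduced_support_def reduce_id lookup_sum lookup_single when_def in_keys_iff)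

lemma reduced_support_left_mult: "reduced_support (left_mult u f)"
proof -
  have "Poly_Mapping.keys (left_mult u f) \<subseteq> (\<lambda>v. reduce (u @ v)) ` Poly_Mapping.keys f"
    unfolding left_mult_def by (rule order_trans[OF keys_sum]) auto
  then show ?thesis by (auto simp: reduced_support_def)
qed

lemma reduced_support_fox: "reduced_support (fox j w)"
proof (cases w)
  case (Cons l u)
  have "reduced_support (fox_letter j l)"
    by (cases l) (auto simp: reduced_support_def reduced_Cons)
  with reduced_support_left_mult[of "[l]" "fox j u"] show ?thesis
    using Poly_Mapping.keys_add[of "fox_letter j l" "left_mult [l] (fox j u)"] Cons
    by (auto simp: reduced_support_def)
qed (simp add: reduced_support_def)

lemma fox_append: "fox j (u @ v) = fox j u + left_mult u (fox j v)"
proof (induction u)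
  case Nil
  then show ?case by (simp add: left_mult_Nil reduced_support_fox)
next
  case (Cons l u)
  have "left_mult [l] (left_mult u (fox j v)) = left_mult (l # u) (fox j v)"
    using left_mult_reduce[of "l # u"] by (simp add: left_mult_left_mult)
  then show ?case by (simp add: Cons left_mult_add add.assoc)
qed

lemma fox_push: "fox j (push l w) = fox j (l # w)"
proof (cases w)
  case (Cons m u)
  show ?thesis
  proof (cases "cancels l m")
    case True
    obtain i s where l: "l = (i, s)" by force
    with True have m: "m = (i, \<not> s)" by (cases m) auto
    have lm: "reduce [l, m] = []" by (simp add: l m)
    have "left_mult [l] (left_mult [m] (fox j u)) = fox j u"
      using lm by (simp add: left_mult_left_mult left_mult_Nil reduced_support_fox)
    moreover have "fox_letter j l + left_mult [l] (fox_letter j m) = 0"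
      by (cases s) (auto simp: l m left_mult_single left_mult_uminus)
    ultimately show ?thesis
      using Cons True by (simp add: left_mult_add add.assoc[symmetric])
  qed (use Cons in \<open>auto simp del: fox.simps\<close>)
qed simp

lemma fox_reduce: "fox j (reduce w) = fox j w"
  by (induction w) (simp_all add: fox_push)

lemma fox_mult: "fox j (u \<otimes>\<^bsub>free_group n\<^esub> v) = fox j u + left_mult u (fox j v)"
  by (simp add: free_group_def fox_reduce fox_append)

section \<open>Twisted Alexander polynomials\<close>

text \<open>The polynomial lives in the field of fractions \<open>K(t)\<close> of \<open>K[t]\<close>.\<close>

definition const_fract :: "'k::field \<Rightarrow> 'k poly fract" where
  "const_fract c = to_fract [:c:]"

definition t_fract :: "'k::field poly fract" where
  "t_fract = to_fract [:0, 1:]"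

text \<open>
  The ring homomorphism \<open>\<Phi>\<close> with \<open>\<Phi>(w) = t\<^sup>\<alpha>\<^sup>(\<^sup>w\<^sup>) \<sigma>(w)\<close>, for \<open>\<alpha>\<close> written additively. The argument
  \<open>\<pi>\<close> is the projection of the free group to the presented group.
\<close>

definition twisted_eval ::
  "nat \<Rightarrow> (word \<Rightarrow> 'g) \<Rightarrow> ('g \<Rightarrow> 'k::field mat) \<Rightarrow> ('g \<Rightarrow> int) \<Rightarrow> free_group_ring \<Rightarrow> 'k poly fract mat"
where
  "twisted_eval l \<pi> \<sigma> \<alpha> f =
    Matrix.mat l l (\<lambda>(p, q). \<Sum>w\<in>Poly_Mapping.keys f.
      of_int (Poly_Mapping.lookup f w) *
      (t_fract powi \<alpha> (\<pi> w) * const_fract (\<sigma> (\<pi> w) $$ (p, q))))"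

definition twisted_alexander_matrix ::
  "nat \<Rightarrow> word list \<Rightarrow> nat \<Rightarrow> (word set \<Rightarrow> 'k::field mat) \<Rightarrow> (word set \<Rightarrow> int) \<Rightarrow> 'k poly fract mat"
where
  "twisted_alexander_matrix n rs l \<sigma> \<alpha> =
    Matrix.mat (l * length rs) (l * n) (\<lambda>(p, q).
      twisted_eval l (word_class n rs) \<sigma> \<alpha> (fox (q div l) (rs ! (p div l))) $$ (p mod l, q mod l))"

definition delete_block_column :: "nat \<Rightarrow> nat \<Rightarrow> 'a mat \<Rightarrow> 'a mat" where
  "delete_block_column l k A =
    Matrix.mat (dim_row A) (dim_col A - l) (\<lambda>(p, q). A $$ (p, if q < l * k then q else q + l))"

text \<open>
  The polynomial is only defined up to \<open>c t\<^sup>l\<^sup>s\<close> with \<open>c \<noteq> 0\<close>, so we define when \<open>\<Delta>\<close> is a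
  representative of it.
\<close>

definition is_twisted_alexander_polynomial ::
  "nat \<Rightarrow> word list \<Rightarrow> nat \<Rightarrow> (word set \<Rightarrow> 'k::field mat) \<Rightarrow> (word set \<Rightarrow> int) \<Rightarrow> 'k poly fract \<Rightarrow> bool"
where
  "is_twisted_alexander_polynomial n rs l \<sigma> \<alpha> \<Delta> \<longleftrightarrow>
    length rs + 1 = n \<and>
    (\<exists>k<n. \<exists>c s.
      let d = det (twisted_eval l (word_class n rs) \<sigma> \<alpha>
                (Poly_Mapping.single [] 1 - Poly_Mapping.single (gen k) 1))
      in d \<noteq> 0 \<and> c \<noteq> 0 \<and>
         \<Delta> = const_fract c * t_fract powi (int l * s) *
             (det (delete_block_column l k (twisted_alexander_matrix n rs l \<sigma> \<alpha>)) / d))"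

definition has_root_of_multiplicity :: "'k::field poly fract \<Rightarrow> 'k \<Rightarrow> nat \<Rightarrow> bool" where
  "has_root_of_multiplicity \<Delta> r m \<longleftrightarrow>
    (\<exists>p q. p \<noteq> 0 \<and> q \<noteq> 0 \<and> \<Delta> = to_fract p / to_fract q \<and> Polynomial.order r p = Polynomial.order r q + m)"

section \<open>The groups \<open>PGL(4,\<real>)\<close> and \<open>PSO(3,1)\<close>\<close>

definition GL4 :: "(real^4^4) monoid" where
  "GL4 = \<lparr> carrier = {A. invertible A}, monoid.mult = (**), one = Finite_Cartesian_Product.mat 1 \<rparr>"

definition scalars4 :: "(real^4^4) set" where
  "scalars4 = {c *\<^sub>R Finite_Cartesian_Product.mat 1 | c. c \<noteq> 0}"

definition PGL4 :: "(real^4^4) set monoid" where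
  "PGL4 = GL4 Mod scalars4"

text \<open>The quotient topology on \<open>PGL(4,\<real>)\<close>.\<close>

definition PGL4_topology :: "(real^4^4) set topology" where
  "PGL4_topology = topology (\<lambda>U. U \<subseteq> carrier PGL4 \<and> open (\<Union> U))"

definition lorentz_form :: "real^4 \<Rightarrow> real^4 \<Rightarrow> real" where
  "lorentz_form x y = x$1 * y$1 + x$2 * y$2 + x$3 * y$3 - x$4 * y$4"

definition O31 :: "(real^4^4) set" where
  "O31 = {A. \<forall>x y. lorentz_form (A *v x) (A *v y) = lorentz_form x y}"

definition SO31_0 :: "(real^4^4) set" where
  "SO31_0 = connected_component_set O31 (Finite_Cartesian_Product.mat 1)"

definition PSO31 :: "(real^4^4) set set" where
  "PSO31 = (\<lambda>A. scalars4 #>\<^bsub>GL4\<^esub> A) ` SO31_0"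

lemma group_GL4: "group GL4"
proof (rule groupI)
  fix A assume "A \<in> carrier GL4"
  then show "\<exists>B\<in>carrier GL4. B \<otimes>\<^bsub>GL4\<^esub> A = \<one>\<^bsub>GL4\<^esub>"
    by (auto simp: GL4_def invertible_def)
qed (auto simp: GL4_def invertible_mult matrix_mul_assoc invertible_def[of "Finite_Cartesian_Product.mat 1"])

lemma smult_one_mult: "(c *\<^sub>R Finite_Cartesian_Product.mat 1) ** A = c *\<^sub>R (A :: real^4^4)"
  by (metis matrix_mul_lid scalar_matrix_assoc)

lemma mult_smult_one: "A ** (c *\<^sub>R Finite_Cartesian_Product.mat 1) = c *\<^sub>R (A :: real^4^4)"
  by (metis matrix_mul_rid matrix_scalar_ac scalar_matrix_assoc)

lemma normal_scalars4: "scalars4 \<lhd> GL4"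
proof -
  interpret group GL4 by (rule group_GL4)
  let ?s = "\<lambda>c. c *\<^sub>R (Finite_Cartesian_Product.mat 1 :: real^4^4)"
  have mult: "?s c ** ?s d = ?s (c * d)" for c d
    by (simp add: smult_one_mult)
  have mem: "?s c \<in> carrier GL4" if "c \<noteq> 0" for c
    using that mult[of c "inverse c"] mult[of "inverse c" c]
    by (auto simp: GL4_def invertible_def simp del: scaleR_scaleR)
  have inv_s: "inv\<^bsub>GL4\<^esub> (?s c) = ?s (inverse c)" if "c \<noteq> 0" for c
    by (rule inv_equality) (use that mult[of "inverse c" c] mem[of c] mem[of "inverse c"] in \<open>auto simp: GL4_def\<close>)
  have sub: "subgroup scalars4 GL4"
  proof
    show "scalars4 \<subseteq> carrier GL4" using mem by (auto simp: scalars4_def)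
    show "\<one>\<^bsub>GL4\<^esub> \<in> scalars4" by (auto simp: scalars4_def GL4_def intro: exI[of _ 1])
  next
    fix A assume "A \<in> scalars4"
    then obtain c where "c \<noteq> 0" "A = ?s c" by (auto simp: scalars4_def)
    then have "inv\<^bsub>GL4\<^esub> A = ?s (inverse c)" "inverse c \<noteq> 0" using inv_s by auto
    then show "inv\<^bsub>GL4\<^esub> A \<in> scalars4" unfolding scalars4_def by blast
  next
    fix A B assume "A \<in> scalars4" "B \<in> scalars4"
    then obtain c d where "c \<noteq> 0" "d \<noteq> 0" "A = ?s c" "B = ?s d" by (auto simp: scalars4_def)
    then have "A \<otimes>\<^bsub>GL4\<^esub> B = ?s (c * d)" "c * d \<noteq> 0" using mult by (auto simp: GL4_def)
    then show "A \<otimes>\<^bsub>GL4\<^esub> B \<in> scalars4" unfolding scalars4_def by blast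
  qed
  show ?thesis
  proof (rule normalI[OF sub], intro ballI)
    fix A :: "real^4^4" assume "A \<in> carrier GL4"
    have "?s c \<otimes>\<^bsub>GL4\<^esub> A = A \<otimes>\<^bsub>GL4\<^esub> ?s c" for c
      by (simp add: GL4_def smult_one_mult mult_smult_one)
    then show "scalars4 #>\<^bsub>GL4\<^esub> A = A <#\<^bsub>GL4\<^esub> scalars4"
      unfolding r_coset_def l_coset_def scalars4_def by auto
  qed
qed

lemma istopology_PGL4: "istopology (\<lambda>U. U \<subseteq> carrier PGL4 \<and> open (\<Union> U))"
proof -
  interpret normal scalars4 GL4 by (rule normal_scalars4)
  have disj: "P = Q" if "P \<in> carrier PGL4" "Q \<in> carrier PGL4" "A \<in> P" "A \<in> Q" for P Q A
    using that rcos_disjoint[OF subgroup_axioms] unfolding PGL4_def FactGroup_def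
    by (auto simp: pairwise_def disjnt_iff)
  have "\<Union> (U \<inter> V) = \<Union> U \<inter> \<Union> V" if "U \<subseteq> carrier PGL4" "V \<subseteq> carrier PGL4" for U V
    using that disj by blast
  moreover have "open (\<Union> (\<Union> K))" if "\<forall>U\<in>K. open (\<Union> U)" for K :: "(real^4^4) set set set"
  proof -
    have "\<Union> (\<Union> K) = (\<Union>U\<in>K. \<Union> U)" by blast
    then show ?thesis using that by auto
  qed
  ultimately show ?thesis
    unfolding istopology_def by (simp add: open_Int Sup_le_iff le_infI1)
qed

section \<open>The adjoint action on \<open>\<ss>\<ll>(4,\<real>)\<close>\<close>

definition sl4 :: "(real^4^4) set" where
  "sl4 = {X. trace X = 0}"

text \<open>
  Conjugation by an element of \<open>PGL(4,\<real>)\<close>, which is a set of matrices that differ by scalars.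
\<close>

definition Ad :: "(real^4^4) set \<Rightarrow> real^4^4 \<Rightarrow> real^4^4" where
  "Ad P X = (let A = (SOME A. A \<in> P) in A ** X ** matrix_inv A)"

text \<open>
  We fix the basis of \<open>\<ss>\<ll>(4,\<real>)\<close> consisting, with row and column indices in \<open>0, \<dots>, 3\<close>, of the
  matrix units \<open>E\<^sub>i\<^sub>j\<close> for \<open>i \<noteq> j\<close> and of \<open>E\<^sub>i\<^sub>i - E\<^sub>3\<^sub>3\<close> for \<open>i < 3\<close>. The basis vector of number
  \<open>m < 15\<close> belongs to \<open>i = m div 4\<close>, \<open>j = m mod 4\<close>, and the corresponding coordinate is the
  matrix entry at \<open>(i, j)\<close>. In the index type \<open>4\<close> the number \<open>0\<close> is the same as \<open>4\<close>.
\<close>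

definition mat_unit :: "4 \<Rightarrow> 4 \<Rightarrow> real^4^4" where
  "mat_unit i j = (\<chi> p q. if p = i \<and> q = j then 1 else 0)"

definition sl4_basis :: "nat \<Rightarrow> real^4^4" where
  "sl4_basis m =
    (let i = of_nat (m div 4); j = of_nat (m mod 4)
     in if i = j then mat_unit i i - mat_unit 3 3 else mat_unit i j)"

definition sl4_coord :: "nat \<Rightarrow> real^4^4 \<Rightarrow> real" where
  "sl4_coord m X = X $ of_nat (m div 4) $ of_nat (m mod 4)"

definition Ad_mat :: "(real^4^4) set \<Rightarrow> real mat" where
  "Ad_mat P = Matrix.mat 15 15 (\<lambda>(m, m'). sl4_coord m (Ad P (sl4_basis m')))"

lemma sl4_expansion:
  assumes "X \<in> sl4"
  shows "X = (\<Sum>m<15. sl4_coord m X *\<^sub>R sl4_basis m)"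
proof -
  have univ: "(UNIV :: 4 set) = {0, 1, 2, 3}"
    unfolding UNIV_4 by auto
  have all4: "(\<forall>i::4. P i) \<longleftrightarrow> P 0 \<and> P 1 \<and> P 2 \<and> P 3" for P
    using univ by (metis UNIV_I insertE empty_iff)
  have "trace X = X $ 0 $ 0 + X $ 1 $ 1 + X $ 2 $ 2 + X $ 3 $ 3"
    unfolding trace_def univ by simp
  then have tr: "X $ 3 $ 3 = - X $ 0 $ 0 - X $ 1 $ 1 - X $ 2 $ 2"
    using assms by (simp add: sl4_def)
  have idx: "{..<15::nat} = {0,1,2,3,4,5,6,7,8,9,10,11,12,13,14}"
    by (simp add: lessThan_nat_numeral lessThan_Suc insert_commute)
  have "\<forall>i j. X $ i $ j = (\<Sum>m<15. sl4_coord m X *\<^sub>R sl4_basis m) $ i $ j"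
    unfolding all4 idx by (simp add: tr sl4_coord_def sl4_basis_def mat_unit_def)
  then show ?thesis
    by (simp add: Finite_Cartesian_Product.vec_eq_iff)
qed

lemma sl4_coord_basis:
  assumes "m < 15" "m' < 15"
  shows "sl4_coord m (sl4_basis m') = (if m = m' then 1 else 0)"
proof -
  have "\<forall>m\<in>{0,1,2,3,4,5,6,7,8,9,10,11,12,13,14}. \<forall>m'\<in>{0,1,2,3,4,5,6,7,8,9,10,11,12,13,14}.
      sl4_coord m (sl4_basis m') = (if m = m' then 1 else 0)"
    by (simp add: sl4_coord_def sl4_basis_def mat_unit_def)
  moreover have "m \<in> {0,1,2,3,4,5,6,7,8,9,10,11,12,13,14}" "m' \<in> {0,1,2,3,4,5,6,7,8,9,10,11,12,13,14}"
    using assms by (simp_all, presburger+)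
  ultimately show ?thesis by blast
qed

section \<open>First cohomology with twisted coefficients\<close>

text \<open>
  The first cohomology of a group with coefficients in a module \<open>V\<close>: crossed homomorphisms modulo
  principal ones. For a connected space it is the twisted cohomology in degree one, with the
  fundamental group for \<open>G\<close>. Cochains are extended by zero outside of the group.
\<close>

definition cocycles1 ::
  "('g, 'x) monoid_scheme \<Rightarrow> ('g \<Rightarrow> 'v \<Rightarrow> 'v) \<Rightarrow> 'v::real_vector set \<Rightarrow> ('g \<Rightarrow> 'v) set"
where
  "cocycles1 G act V =
    {d. (\<forall>g\<in>carrier G. d g \<in> V) \<and> (\<forall>g. g \<notin> carrier G \<longrightarrow> d g = 0) \<and>
        (\<forall>g\<in>carrier G. \<forall>h\<in>carrier G. d (g \<otimes>\<^bsub>G\<^esub> h) = d g + act g (d h))}"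

definition coboundaries1 ::
  "('g, 'x) monoid_scheme \<Rightarrow> ('g \<Rightarrow> 'v \<Rightarrow> 'v) \<Rightarrow> 'v::real_vector set \<Rightarrow> ('g \<Rightarrow> 'v) set"
where
  "coboundaries1 G act V = {(\<lambda>g. if g \<in> carrier G then act g v - v else 0) | v. v \<in> V}"

definition cohomologous1 ::
  "('g, 'x) monoid_scheme \<Rightarrow> ('g \<Rightarrow> 'v \<Rightarrow> 'v) \<Rightarrow> 'v::real_vector set \<Rightarrow> (('g \<Rightarrow> 'v) \<times> ('g \<Rightarrow> 'v)) set"
where
  "cohomologous1 G act V =
    {(d, e). d \<in> cocycles1 G act V \<and> e \<in> cocycles1 G act V \<and>
             (\<lambda>g. d g - e g) \<in> coboundaries1 G act V}"

definition H1 ::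
  "('g, 'x) monoid_scheme \<Rightarrow> ('g \<Rightarrow> 'v \<Rightarrow> 'v) \<Rightarrow> 'v::real_vector set \<Rightarrow> ('g \<Rightarrow> 'v) set set"
where
  "H1 G act V = cocycles1 G act V // cohomologous1 G act V"

text \<open>The map \<open>H\<^sup>1(G; V) \<rightarrow> H\<^sup>1(H; V)\<close> induced by the inclusion of a subgroup \<open>H\<close>.\<close>

definition H1_restriction ::
  "('g, 'x) monoid_scheme \<Rightarrow> ('g \<Rightarrow> 'v \<Rightarrow> 'v) \<Rightarrow> 'v::real_vector set \<Rightarrow> 'g set
    \<Rightarrow> ('g \<Rightarrow> 'v) set \<Rightarrow> ('g \<Rightarrow> 'v) set"
where
  "H1_restriction G act V H c =
    cohomologous1 (G\<lparr>carrier := H\<rparr>) act V `` ((\<lambda>d g. if g \<in> H then d g else 0) ` c)"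

section \<open>Hyperbolic once-punctured torus bundles\<close>

text \<open>
  The generators \<open>a\<close>, \<open>b\<close>, \<open>x\<close> have the numbers \<open>0\<close>, \<open>1\<close>, \<open>2\<close>. The monodromy is given by the
  automorphism \<open>\<phi>\<close> of \<open>F\<^sub>2\<close> that it induces when the base point is on the boundary of the fiber
  and is fixed by the monodromy. The boundary curve of the fiber is \<open>[a, b]\<close>; since \<open>x\<close> is a
  meridian on the boundary torus it commutes with it, that is, \<open>\<phi>\<close> fixes \<open>[a, b]\<close>.
\<close>

definition boundary_word :: word where
  "boundary_word = gen 0 @ gen 1 @ gen_inv 0 @ gen_inv 1"

definition exponent_sum :: "nat \<Rightarrow> word \<Rightarrow> int" where
  "exponent_sum i w = (\<Sum>(j, s)\<leftarrow>w. if j = i then (if s then 1 else -1) else 0)"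

text \<open>The matrix of the automorphism of \<open>\<int>\<^sup>2\<close> induced by \<open>\<phi>\<close>, with entries \<open>M i j\<close> for \<open>i, j < 2\<close>.\<close>

definition monodromy_entry :: "(word \<Rightarrow> word) \<Rightarrow> nat \<Rightarrow> nat \<Rightarrow> int" where
  "monodromy_entry \<phi> i j = exponent_sum i (\<phi> (gen j))"

definition hyperbolic_monodromy :: "(word \<Rightarrow> word) \<Rightarrow> bool" where
  "hyperbolic_monodromy \<phi> \<longleftrightarrow>
    \<phi> \<in> iso (free_group 2) (free_group 2) \<and>
    \<phi> boundary_word = boundary_word \<and>
    (let M = monodromy_entry \<phi>
     in M 0 0 * M 1 1 - M 0 1 * M 1 0 = 1 \<and> \<bar>M 0 0 + M 1 1\<bar> > 2)"

definition bundle_relators :: "(word \<Rightarrow> word) \<Rightarrow> word list" where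
  "bundle_relators \<phi> =
    map (\<lambda>i. reduce (gen 2 @ gen i @ gen_inv 2 @ inv_word (\<phi> (gen i)))) [0, 1]"

definition bundle_group :: "(word \<Rightarrow> word) \<Rightarrow> word set monoid" where
  "bundle_group \<phi> = presented_group 3 (bundle_relators \<phi>)"

definition peripheral_subgroup :: "(word \<Rightarrow> word) \<Rightarrow> word set set" where
  "peripheral_subgroup \<phi> =
    generate (bundle_group \<phi>)
      {word_class 3 (bundle_relators \<phi>) (gen 2), word_class 3 (bundle_relators \<phi>) boundary_word}"

text \<open>
  The projection \<open>\<Gamma> \<rightarrow> \<Gamma>/F\<^sub>2 \<cong> \<int>\<close>.
\<close>

definition is_fibration_hom :: "(word \<Rightarrow> word) \<Rightarrow> (word set \<Rightarrow> int) \<Rightarrow> bool" where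
  "is_fibration_hom \<phi> \<alpha> \<longleftrightarrow>
    \<alpha> \<in> hom (bundle_group \<phi>) integer_group \<and>
    (\<forall>w\<in>carrier (free_group 2). \<alpha> (word_class 3 (bundle_relators \<phi>) w) = 0) \<and>
    \<alpha> (word_class 3 (bundle_relators \<phi>) (gen 2)) = 1"

text \<open>
  The holonomy of the complete hyperbolic structure is the discrete and faithful representation
  in \<open>PSO(3,1)\<close>, which is unique up to conjugation by isometries.
\<close>

definition is_holonomy :: "(word \<Rightarrow> word) \<Rightarrow> (word set \<Rightarrow> (real^4^4) set) \<Rightarrow> bool" where
  "is_holonomy \<phi> \<rho> \<longleftrightarrow>
    \<rho> \<in> hom (bundle_group \<phi>) PGL4 \<and>
    \<rho> ` carrier (bundle_group \<phi>) \<subseteq> PSO31 \<and>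
    inj_on \<rho> (carrier (bundle_group \<phi>)) \<and>
    subtopology PGL4_topology (\<rho> ` carrier (bundle_group \<phi>))
      = discrete_topology (\<rho> ` carrier (bundle_group \<phi>))"

definition infinitesimally_projectively_rigid_rel_cusp ::
  "(word \<Rightarrow> word) \<Rightarrow> (word set \<Rightarrow> (real^4^4) set) \<Rightarrow> bool"
where
  "infinitesimally_projectively_rigid_rel_cusp \<phi> \<rho> \<longleftrightarrow>
    inj_on
      (H1_restriction (bundle_group \<phi>) (\<lambda>g. Ad (\<rho> g)) sl4 (peripheral_subgroup \<phi>))
      (H1 (bundle_group \<phi>) (\<lambda>g. Ad (\<rho> g)) sl4)"

end

theory Submission
  imports Defs "Jordan_Normal_Form.Char_Poly"
begin

text \<open>
  The meridian \<open>x\<close> acts on the \<open>30\<close>-dimensional space \<open>V\<close> of cocycles of the fiber group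
  \<open>F\<^sub>2\<close> by an operator \<open>1 + N\<close>. By Fox calculus the numerator of the twisted Alexander polynomial
  is, up to a nonzero constant, the characteristic polynomial of \<open>N\<close> at \<open>t - 1\<close>. Its denominator
  \<open>det (1 - t Ad x)\<close> vanishes at \<open>1\<close> to order at most \<open>15\<close>, so that multiplicity \<open>5\<close> of the root
  \<open>1\<close> bounds the dimension of the generalized kernel of \<open>N\<close> by \<open>20\<close>.

  The boundary curve \<open>c = [a, b]\<close> and \<open>x\<close> generate a discrete group of rank two in \<open>PSO(3,1)\<close>. It
  consists of parabolic isometries with a common fixed point, hence \<open>(Ad x - 1)\<^sup>5 = 0\<close> and \<open>c\<close> has
  an at least \<open>5\<close>-dimensional space of invariants in \<open>sl(4)\<close>. The cocycles whose value at \<open>c\<close> is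
  orthogonal to these invariants for the trace form make up a subspace \<open>W\<close> of \<open>V\<close> of dimension at
  most \<open>25\<close>. It contains the \<open>15\<close>-dimensional space of coboundaries and all cocycles that are
  coboundaries on the boundary torus, and \<open>N\<^sup>8\<close> maps \<open>V\<close> into \<open>W\<close>. A cocycle of \<open>\<Gamma>\<close> that is a
  coboundary on the boundary torus but not on the fiber would give a \<open>16\<close>-dimensional subspace of
  \<open>W\<close> that is killed by \<open>N\<^sup>8\<close>. Then \<open>N\<^sup>1\<^sup>6\<close> would have rank at most \<open>25 - 16 = 9\<close> on \<open>V\<close> and a kernel of
  dimension at least \<open>21\<close>.
\<close>

text \<open>Only orders of vanishing of determinants are available, so the argument works with
  generalized kernels on the space of all cocycles of the fiber, not with cohomology. Three facts
  make the count close. Conjugation by x is trivial on classes that come from \<Gamma>, hence N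
  sends the restriction of a cocycle of \<Gamma> to a coboundary. On coboundaries N acts through the
  inverse of x minus 1 on sl(4), which is nilpotent. The monodromy fixes c, so evaluation at c
  carries N to that same nilpotent operator. The bound on the dimension of W is a duality statement:
  the conditions indexed by the invariants of c are independent because no nonzero vector of sl(4)
  is invariant under the fiber group, and this in turn comes from discreteness. Kernel dimensions
  are compared with orders of vanishing by squaring N repeatedly, which asks for an exponent that is
  a power of two. Hence 16, and its half 8, which leaves room for one step into the coboundaries and
  five more that kill them.\<close>

no_notation Matrix.vec_index (infixl "$" 100)

section \<open>Kernel dimensions and the order of vanishing of characteristic polynomials\<close>

text \<open>Each term of the Leibniz expansion contains exactly one entry from each of the first
  \<open>r\<close> columns, and each of these contributes a factor \<open>x\<close>.\<close>

lemma power_dvd_det: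
  fixes A :: "'a::comm_ring_1 mat"
  assumes A: "A \<in> carrier_mat n n" and "r \<le> n"
    and dvd: "\<And>i j. i < n \<Longrightarrow> j < r \<Longrightarrow> x dvd A $$ (i, j)"
  shows "x ^ r dvd det A"
proof -
  have "x ^ r dvd (\<Prod>j<n. A $$ (p j, j))" if p: "p permutes {0..<n}" for p
  proof -
    have "(\<Prod>j = 0..<r. x) dvd (\<Prod>j = 0..<r. A $$ (p j, j))"
      by (rule prod_dvd_prod) (use dvd p \<open>r \<le> n\<close> permutes_in_image[OF p] in force)
    moreover have "(\<Prod>j = 0..<n. A $$ (p j, j)) = (\<Prod>j = 0..<r. A $$ (p j, j)) * (\<Prod>j = r..<n. A $$ (p j, j))"
      using \<open>r \<le> n\<close> by (simp add: prod.atLeastLessThan_concat)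
    ultimately show ?thesis by (simp add: atLeast0LessThan)
  qed
  then show ?thesis
    unfolding det_col[OF A] by (intro dvd_sum dvd_mult) auto
qed

lemma comm_ring_hom_pcompose: "comm_ring_hom (\<lambda>p. p \<circ>\<^sub>p (q :: 'a::comm_ring_1 poly))"
  by unfold_locales (auto simp: pcompose_add pcompose_mult)

lemma det_map_pcompose:
  fixes q :: "'a::comm_ring_1 poly"
  shows "det (map_mat (\<lambda>p. p \<circ>\<^sub>p q) A) = det A \<circ>\<^sub>p q"
  by (rule comm_ring_hom.hom_det[OF comm_ring_hom_pcompose])

lemma pcompose_power: "(p ^ k) \<circ>\<^sub>p (q :: 'a::comm_ring_1 poly) = (p \<circ>\<^sub>p q) ^ k"
  by (induction k) (simp_all add: pcompose_mult)

lemma dvd_pcompose: "p dvd q \<Longrightarrow> p \<circ>\<^sub>p r dvd q \<circ>\<^sub>p (r :: 'a::comm_ring_1 poly)"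
  by (elim dvdE) (simp add: pcompose_mult)

lemma power_dvd_pcompose_linear:
  fixes p :: "'a::field poly"
  assumes "[:-c, 1:] ^ r dvd p"
  shows "[:d - c, 1:] ^ r dvd p \<circ>\<^sub>p [:d, 1:]"
  using dvd_pcompose[OF assms, of "[:d, 1:]"] by (simp add: pcompose_power pcompose_pCons)

lemma comm_ring_hom_const_poly: "comm_ring_hom (\<lambda>a :: 'a::comm_ring_1. [:a:])"
  by unfold_locales auto

lemma map_const_poly_mult:
  fixes A :: "'a::comm_ring_1 mat"
  assumes "A \<in> carrier_mat n m" "B \<in> carrier_mat m k"
  shows "map_mat (\<lambda>a. [:a:]) (A * B) = map_mat (\<lambda>a. [:a:]) A * map_mat (\<lambda>a. [:a:]) B"
  using assms semiring_hom.mat_hom_mult[of "\<lambda>a :: 'a. [:a:]"] comm_ring_hom_const_poly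
  by (metis comm_ring_hom.axioms(1) comm_semiring_hom.axioms(1) ring_hom.axioms(1) comm_ring_hom_def)

lemma char_poly_matrix_eq:
  "A \<in> carrier_mat n n \<Longrightarrow> char_poly_matrix A = [:0, 1:] \<cdot>\<^sub>m 1\<^sub>m n - map_mat (\<lambda>a. [:a:]) A"
  by (intro eq_matI) (auto simp: char_poly_matrix_def)

text \<open>Order doubling: \<open>det (s\<^sup>2 - N\<^sup>2) = det (s - N) det (s + N)\<close>, and both factors vanish at \<open>0\<close>
  to the same order.\<close>

lemma power_dvd_char_poly_square:
  fixes N :: "'a::field_char_0 mat"
  assumes N: "N \<in> carrier_mat n n" and dvd: "[:0, 1:] ^ r dvd char_poly (N * N)"
  shows "[:0, 1:] ^ r dvd char_poly N"
proof -
  let ?C = "\<lambda>A. char_poly_matrix (A :: 'a mat)"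
  let ?sq = "map_mat (\<lambda>p. p \<circ>\<^sub>p [:0, 0, 1 :: 'a:])" and ?ng = "map_mat (\<lambda>p. p \<circ>\<^sub>p [:0, - 1 :: 'a:])"
  let ?c = "map_mat (\<lambda>a. [:a:])" and ?s = "[:0, 1:] \<cdot>\<^sub>m 1\<^sub>m n :: 'a poly mat"
  have c: "?c N \<in> carrier_mat n n" and s: "?s \<in> carrier_mat n n" using N by auto
  have 1: "?sq (?C (N * N)) = [:0, 0, 1:] \<cdot>\<^sub>m 1\<^sub>m n - ?c N * ?c N"
  proof -
    have "?sq (?C (N * N)) = [:0, 0, 1:] \<cdot>\<^sub>m 1\<^sub>m n - ?c (N * N)"
      using N by (intro eq_matI) (auto simp: char_poly_matrix_def pcompose_pCons)
    then show ?thesis by (simp only: map_const_poly_mult[OF N N])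
  qed
  have 2: "?C N = ?s - ?c N" by (rule char_poly_matrix_eq[OF N])
  \<comment> \<open>Substituting -s for s turns s - N into -(s + N), so the second factor of the
    product is, up to sign, the characteristic polynomial of \<open>N\<close> at -s.\<close>
  have 3: "?ng (?C N) = (- 1) \<cdot>\<^sub>m (?s + ?c N)"
    using N by (intro eq_matI) (auto simp: char_poly_matrix_def pcompose_pCons)
  have 4: "(?s - ?c N) * (?s + ?c N) = ?s * ?s - ?c N * ?c N"
  proof -
    have "(?s - ?c N) * (?s + ?c N) = ?s * (?s + ?c N) - ?c N * (?s + ?c N)"
      by (rule minus_mult_distrib_mat) (use c s in auto)
    also have "?s * (?s + ?c N) = ?s * ?s + ?s * ?c N"
      by (rule mult_add_distrib_mat) (use c s in auto)
    also have "?c N * (?s + ?c N) = ?c N * ?s + ?c N * ?c N"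
      by (rule mult_add_distrib_mat) (use c s in auto)
    also have "?c N * ?s = [:0, 1:] \<cdot>\<^sub>m (?c N * 1\<^sub>m n)"
      by (rule mult_smult_distrib) (use c in auto)
    also have "?c N * 1\<^sub>m n = ?c N" using c by (rule right_mult_one_mat)
    also have "?s * ?c N = [:0, 1:] \<cdot>\<^sub>m (1\<^sub>m n * ?c N)"
      by (rule mult_smult_assoc_mat) (use c in auto)
    also have "1\<^sub>m n * ?c N = ?c N" using c by (rule left_mult_one_mat)
    also have "(?s * ?s + [:0, 1:] \<cdot>\<^sub>m ?c N) - ([:0, 1:] \<cdot>\<^sub>m ?c N + ?c N * ?c N) = ?s * ?s - ?c N * ?c N"
      using c by (intro eq_matI) (auto simp: algebra_simps simp del: index_mult_mat(1))
    finally show ?thesis .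
  qed
  have "?s * ?s = [:0, 1:] \<cdot>\<^sub>m (1\<^sub>m n * ?s)"
    by (rule mult_smult_assoc_mat) auto
  also have "\<dots> = [:0, 0, 1:] \<cdot>\<^sub>m 1\<^sub>m n" by (intro eq_matI) auto
  finally have "?sq (?C (N * N)) = (?s - ?c N) * (?s + ?c N)" using 1 4 by simp
  moreover have "det ((?s - ?c N) * (?s + ?c N)) = det (?s - ?c N) * det (?s + ?c N)"
    by (rule det_mult[of _ n]) (use minus_carrier_mat[OF c, of ?s] add_carrier_mat[OF c, of ?s] s in auto)
  ultimately have "det (?sq (?C (N * N))) = det (?C N) * det (?s + ?c N)"
    using 2 by simp
  moreover have "det (?ng (?C N)) = (- 1) ^ n * det (?s + ?c N)"
    unfolding 3 using c s by (simp add: det_smult)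
  ultimately have e: "char_poly (N * N) \<circ>\<^sub>p [:0, 0, 1:] = (- 1) ^ n * (char_poly N * (char_poly N \<circ>\<^sub>p [:0, - 1:]))"
    unfolding char_poly_def det_map_pcompose by (simp flip: power_mult_distrib mult.assoc)
  define k where "k = Polynomial.order 0 (char_poly N)"
  have nz: "char_poly N \<noteq> 0"
    using degree_monic_char_poly[OF N] by auto
  obtain g where g: "char_poly N = [:0, 1:] ^ k * g" "poly g 0 \<noteq> 0"
    using order_decomp[OF nz, of 0] unfolding k_def by (auto simp: poly_eq_0_iff_dvd)
  \<comment> \<open>The part of the product that does not vanish at 0: the power of s splits off
    with exponent exactly \<open>2 * k\<close>, while the hypothesis supplies
    \<open>2 * r\<close>.\<close>
  define h where "h = (- 1) ^ n * (g * ((- 1) ^ k * (g \<circ>\<^sub>p [:0, - 1:])))"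
  have h0: "poly h 0 \<noteq> 0"
    using g(2) by (simp add: h_def poly_pcompose)
  have x: "[:0, 1:] \<circ>\<^sub>p [:0, - 1 :: 'a:] = - 1 * [:0, 1:]" "[:0, 1:] \<circ>\<^sub>p [:0, 0, 1 :: 'a:] = [:0, 1:] ^ 2"
    by (simp_all add: pcompose_pCons power2_eq_square)
  have "char_poly (N * N) \<circ>\<^sub>p [:0, 0, 1:] = [:0, 1:] ^ (2 * k) * h"
    unfolding e g(1) h_def pcompose_mult pcompose_power x power_mult_distrib mult_2 power_add
    by (simp only: mult_ac)
  moreover have "[:0, 1:] ^ (2 * r) dvd char_poly (N * N) \<circ>\<^sub>p [:0, 0, 1:]"
    using dvd_pcompose[OF dvd, of "[:0, 0, 1:]"] unfolding pcompose_power x power_mult .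
  ultimately have d: "[:0, 1:] ^ (2 * r) dvd [:0, 1 :: 'a:] ^ (2 * k) * h" by simp
  have "r \<le> k"
  proof (rule ccontr)
    assume "\<not> r \<le> k"
    then have "2 * k + 1 \<le> 2 * r" by simp
    then have "[:0, 1 :: 'a:] ^ (2 * k + 1) dvd [:0, 1:] ^ (2 * k) * h"
      using d le_imp_power_dvd dvd_trans by blast
    then have "[:0, 1 :: 'a:] ^ (2 * k) * [:0, 1:] dvd [:0, 1:] ^ (2 * k) * h"
      by (simp only: power_add power_one_right)
    then have "[:- 0, 1:] dvd h"
      by (subst (asm) dvd_mult_cancel_left) simp
    with h0 show False using poly_eq_0_iff_dvd by blast
  qed
  then show ?thesis unfolding g(1) by (intro dvd_mult2 le_imp_power_dvd)
qed

text \<open>For k = 0 the first \<open>r\<close> columns of \<open>S\<close> lie in the kernel of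
  \<open>N\<close>, so the same columns of (s - N) S are s times those of \<open>S\<close>, and
  \<open>power_dvd_det\<close> applies; \<open>det S\<close> is a nonzero constant. Each further
  squaring costs nothing by \<open>power_dvd_char_poly_square\<close>.\<close>

lemma power_dvd_char_poly_iterate:
  fixes N :: "'a::field_char_0 mat"
  assumes N: "N \<in> carrier_mat n n" and S: "S \<in> carrier_mat n n" "det S \<noteq> 0" and "r \<le> n"
    and z: "\<And>i j. i < n \<Longrightarrow> j < r \<Longrightarrow> (((\<lambda>A. A * A) ^^ k) N * S) $$ (i, j) = 0"
  shows "[:0, 1:] ^ r dvd char_poly N"
  using N z
proof (induction k arbitrary: N)
  case (0 N)
  let ?c = "map_mat (\<lambda>a. [:a:])"
  have N: "N \<in> carrier_mat n n" by fact
  have cN: "?c N \<in> carrier_mat n n" and cS: "?c S \<in> carrier_mat n n" using N S by auto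
  have "char_poly_matrix N * ?c S = ([:0, 1:] \<cdot>\<^sub>m 1\<^sub>m n) * ?c S - ?c N * ?c S"
    unfolding char_poly_matrix_eq[OF N] by (rule minus_mult_distrib_mat) (use cN cS in auto)
  also have "([:0, 1:] \<cdot>\<^sub>m 1\<^sub>m n) * ?c S = [:0, 1:] \<cdot>\<^sub>m (1\<^sub>m n * ?c S)"
    by (rule mult_smult_assoc_mat) (use cS in auto)
  also have "1\<^sub>m n * ?c S = ?c S" using cS by (rule left_mult_one_mat)
  also have "?c N * ?c S = ?c (N * S)" using map_const_poly_mult[OF N S(1)] by simp
  finally have C: "char_poly_matrix N * ?c S = [:0, 1:] \<cdot>\<^sub>m ?c S - ?c (N * S)" .
  have "[:0, 1:] ^ r dvd det (char_poly_matrix N * ?c S)"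
  proof (rule power_dvd_det)
    show "char_poly_matrix N * ?c S \<in> carrier_mat n n"
      using char_poly_matrix_closed[OF N] cS by (rule mult_carrier_mat)
  next
    fix i j assume ij: "i < n" "j < r"
    have "(N * S) $$ (i, j) = 0" using 0(2)[OF ij] by simp
    then have "(char_poly_matrix N * ?c S) $$ (i, j) = [:0, 1:] * [:S $$ (i, j):]"
      unfolding C using ij \<open>r \<le> n\<close> N S by (simp del: index_mult_mat(1))
    then show "[:0, 1:] dvd (char_poly_matrix N * ?c S) $$ (i, j)" by (simp only: dvd_triv_left)
  qed fact
  also have "det (char_poly_matrix N * ?c S) = char_poly N * [:det S:]"
    using N cS by (simp add: det_mult[of _ n] char_poly_def comm_ring_hom.hom_det[OF comm_ring_hom_const_poly])
  also have "\<dots> = Polynomial.smult (det S) (char_poly N)" by simp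
  finally show ?case using S(2) by (rule Polynomial.dvd_smult_cancel)
next
  case (Suc k N)
  have "[:0, 1:] ^ r dvd char_poly (N * N)"
    by (rule Suc.IH) (use Suc.prems in \<open>auto simp: funpow_Suc_right simp del: index_mult_mat(1) funpow.simps(2)\<close>)
  then show ?case by (rule power_dvd_char_poly_square[OF Suc.prems(1)])
qed


text \<open>The kernel condition is stated for a power of two because of the order doubling argument.\<close>

lemma power_dvd_char_poly_dim_kernel:
  fixes f :: "'a::euclidean_space \<Rightarrow> 'a" and b :: "nat \<Rightarrow> 'a" and co :: "nat \<Rightarrow> 'a \<Rightarrow> real"
  assumes V: "subspace V" "dim V = n"
    and f: "linear f" "f ` V \<subseteq> V"
    and b: "\<And>j. j < n \<Longrightarrow> b j \<in> V"
    and co: "\<And>i. linear (co i)"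
    and exp: "\<And>y. y \<in> V \<Longrightarrow> y = (\<Sum>i<n. co i y *\<^sub>R b i)"
    and r: "r \<le> dim {y \<in> V. (f ^^ (2 ^ k)) y = 0}"
  shows "[:0, 1:] ^ r dvd char_poly (Matrix.mat n n (\<lambda>(i, j). co i (f (b j))))"
proof -
  define Mt where "Mt g = Matrix.mat n n (\<lambda>(i, j). co i (g (b j)))" for g
  have Mt: "Mt g \<in> carrier_mat n n" for g by (simp add: Mt_def)
  \<comment> \<open>Multiplying the matrix of \<open>g\<close> by the coordinates of
    \<open>y\<close> gives the coordinates of \<open>g y\<close>; both the product formula and the
    vanishing of columns below are instances.\<close>
  have app: "(\<Sum>j<n. co i (g (b j)) * co j y) = co i (g y)" if "linear g" "y \<in> V" for g i y
  proof -
    have "co i (g y) = co i (g (\<Sum>j<n. co j y *\<^sub>R b j))" using exp[OF that(2)] by simp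
    also have "\<dots> = (\<Sum>j<n. co j y * co i (g (b j)))"
      using that(1) co[of i] by (simp add: linear_sum linear_scale)
    finally show ?thesis by (simp add: mult.commute)
  qed
  have sq: "Mt g * Mt g = Mt (g \<circ> g)" if "linear g" "g ` V \<subseteq> V" for g
  proof (rule eq_matI)
    fix i j assume "i < dim_row (Mt (g \<circ> g))" "j < dim_col (Mt (g \<circ> g))"
    then have ij: "i < n" "j < n" by (auto simp: Mt_def)
    have "(Mt g * Mt g) $$ (i, j) = (\<Sum>l<n. co i (g (b l)) * co l (g (b j)))"
      using ij by (simp add: Mt_def scalar_prod_def atLeast0LessThan)
    also have "\<dots> = co i (g (g (b j)))"
      by (rule app) (use that b[OF ij(2)] in auto)
    finally show "(Mt g * Mt g) $$ (i, j) = Mt (g \<circ> g) $$ (i, j)"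
      using ij by (simp add: Mt_def)
  qed (auto simp: Mt_def)
  have lin_pow: "linear (f ^^ m) \<and> (f ^^ m) ` V \<subseteq> V" for m
    using f by (induction m) (auto intro: linear_compose simp: linear_id[unfolded id_def] id_def)
  have iter: "((\<lambda>A. A * A) ^^ m) (Mt f) = Mt (f ^^ (2 ^ m))" for m
    by (induction m) (use lin_pow in \<open>auto simp: sq funpow_add[symmetric] mult_2\<close>)
  define K where "K = {y \<in> V. (f ^^ (2 ^ k)) y = 0}"
  obtain U0 where U0: "U0 \<subseteq> K" "independent U0" "card U0 = dim K"
    using basis_exists[of K] by metis
  \<comment> \<open>Exactly \<open>r\<close> independent kernel vectors are kept and completed to a
    basis of \<open>V\<close>. Numbered with the kernel vectors in front, the basis supplies the
    columns of \<open>S\<close>.\<close>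
  obtain U1 where U1: "U1 \<subseteq> U0" "card U1 = r" "finite U1"
    using r U0(3) obtain_subset_with_card_n[of r U0] unfolding K_def by metis
  have "U1 \<subseteq> V" "independent U1"
    using U0 U1 independent_mono by (auto simp: K_def)
  then obtain U where U: "U1 \<subseteq> U" "U \<subseteq> V" "independent U" "V \<subseteq> span U"
    using maximal_independent_subset_extend by metis
  have fU: "finite U" and cU: "card U = n"
    using U V(2) independent_imp_finite by (auto simp: basis_card_eq_dim)
  have "r \<le> n" using U1 U fU cU card_mono by metis
  obtain h1 where h1: "bij_betw h1 {0..<r} U1"
    using ex_bij_betw_nat_finite[OF U1(3)] U1(2) by auto
  obtain h2 where h2: "bij_betw h2 {0..<n - r} (U - U1)"
    using ex_bij_betw_nat_finite[of "U - U1"] fU cU U1 U(1) by (auto simp: card_Diff_subset)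
  define u where "u j = (if j < r then h1 j else h2 (j - r))" for j
  have u1: "bij_betw u {0..<r} U1"
    by (rule iffD1[OF bij_betw_cong h1]) (simp add: u_def)
  have "bij_betw (\<lambda>j. j - r) {r..<n} {0..<n - r}"
    by (rule bij_betwI[of _ _ _ "\<lambda>j. j + r"]) auto
  then have "bij_betw (h2 \<circ> (\<lambda>j. j - r)) {r..<n} (U - U1)"
    using h2 by (rule bij_betw_trans)
  then have "bij_betw u {r..<n} (U - U1)"
    by (rule iffD1[OF bij_betw_cong, rotated]) (auto simp: u_def)
  then have "bij_betw u ({0..<r} \<union> {r..<n}) (U1 \<union> (U - U1))"
    by (rule bij_betw_combine[OF u1]) auto
  moreover have "{0..<r} \<union> {r..<n} = {..<n}" "U1 \<union> (U - U1) = U"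
    using \<open>r \<le> n\<close> U(1) by auto
  ultimately have u: "bij_betw u {..<n} U" by simp
  have uV: "u j \<in> V" if "j < n" for j
    using u U(2) that by (auto simp: bij_betw_def)
  define S where "S = Matrix.mat n n (\<lambda>(i, j). co i (u j))"
  have S: "S \<in> carrier_mat n n" by (simp add: S_def)
  have "det S \<noteq> 0"
  proof
    assume "det S = 0"
    then obtain z where z: "z \<in> carrier_vec n" "z \<noteq> 0\<^sub>v n" "S *\<^sub>v z = 0\<^sub>v n"
      using det_0_iff_vec_prod_zero[OF S] by auto
    \<comment> \<open>A kernel vector of \<open>S\<close> is a linear relation between the basis
      vectors \<open>u j\<close>, because a vector of \<open>V\<close> with zero coordinates
      vanishes.\<close>
    define y where "y = (\<Sum>j<n. vec_index z j *\<^sub>R u j)"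
    have yV: "y \<in> V" unfolding y_def
      using uV V(1) by (auto intro!: subspace_sum subspace_scale)
    have "co i y = 0" if "i < n" for i
    proof -
      have "co i y = (\<Sum>j<n. vec_index z j * co i (u j))"
        unfolding y_def using co[of i] by (simp add: linear_sum linear_scale)
      also have "\<dots> = vec_index (S *\<^sub>v z) i"
        using that z(1) by (simp add: S_def scalar_prod_def mult.commute atLeast0LessThan)
      finally show ?thesis using z that by simp
    qed
    then have y0: "y = 0" using exp[OF yV] by simp
    have "(\<Sum>x\<in>U. vec_index z (inv_into {..<n} u x) *\<^sub>R x) = y"
      unfolding y_def using u by (intro sum.reindex_bij_betw[OF u, symmetric, THEN trans] sum.cong)
        (auto simp: bij_betw_def inv_into_f_f)
    then have "\<forall>x\<in>U. vec_index z (inv_into {..<n} u x) = 0"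
      using y0 U(3) fU independent_explicit by metis
    then have "vec_index z j = 0" if "j < n" for j
      using u that by (auto simp: bij_betw_def inv_into_f_f)
    then show False using z(1,2) by (auto simp: vec_eq_iff)
  qed
  moreover have "(((\<lambda>A. A * A) ^^ k) (Mt f) * S) $$ (i, j) = 0" if "i < n" "j < r" for i j
  proof -
    let ?g = "f ^^ (2 ^ k)"
    have "(Mt ?g * S) $$ (i, j) = (\<Sum>l<n. co i (?g (b l)) * co l (u j))"
      using that \<open>r \<le> n\<close> by (simp add: Mt_def S_def scalar_prod_def atLeast0LessThan)
    also have "\<dots> = co i (?g (u j))"
      using lin_pow uV that \<open>r \<le> n\<close> by (intro app) auto
    also have "u j \<in> U1" using bij_betwE[OF u1] that by auto
    then have "?g (u j) = 0" using U1 U0 by (auto simp: K_def)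
    finally show ?thesis using co[of i] by (simp add: iter linear_0)
  qed
  ultimately have "[:0, 1:] ^ r dvd char_poly (Mt f)"
    using power_dvd_char_poly_iterate[OF Mt S _ \<open>r \<le> n\<close>] by blast
  then show ?thesis by (simp add: Mt_def)
qed

section \<open>The Lorentz form and its isometries\<close>

lemma lorentz_form_add [simp]:
  "lorentz_form (x + y) z = lorentz_form x z + lorentz_form y z"
  "lorentz_form x (y + z) = lorentz_form x y + lorentz_form x z"
  by (simp_all add: lorentz_form_def algebra_simps)

lemma lorentz_form_diff [simp]:
  "lorentz_form (x - y) z = lorentz_form x z - lorentz_form y z"
  "lorentz_form x (y - z) = lorentz_form x y - lorentz_form x z"
  by (simp_all add: lorentz_form_def algebra_simps)

lemma lorentz_form_scale [simp]:
  "lorentz_form (c *\<^sub>R x) y = c * lorentz_form x y"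
  "lorentz_form x (c *\<^sub>R y) = c * lorentz_form x y"
  by (simp_all add: lorentz_form_def algebra_simps)

lemma lorentz_form_zero [simp]: "lorentz_form 0 x = 0" "lorentz_form x 0 = 0"
  by (simp_all add: lorentz_form_def)

lemma lorentz_form_commute: "lorentz_form x y = lorentz_form y x"
  by (simp add: lorentz_form_def mult.commute)

abbreviation id4 :: "real^4^4" where "id4 \<equiv> Finite_Cartesian_Product.mat 1"

definition minkowski :: "real^4^4" where
  "minkowski = (\<chi> i j. if i = j then if i = 4 then - 1 else 1 else 0)"

lemma lorentz_form_eq_inner: "lorentz_form x y = inner x (minkowski *v y)"
  by (simp add: lorentz_form_def minkowski_def inner_vec_def sum_4 matrix_vector_mult_def)

lemma minkowski_mult_minkowski: "minkowski ** minkowski = id4"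
  by (simp add: minkowski_def matrix_matrix_mult_def Finite_Cartesian_Product.vec_eq_iff
      Finite_Cartesian_Product.mat_def forall_4 sum_4)

lemma O31_iff: "A \<in> O31 \<longleftrightarrow> Finite_Cartesian_Product.transpose A ** minkowski ** A = minkowski"
proof -
  have "lorentz_form (A *v x) (A *v y)
      = inner x ((Finite_Cartesian_Product.transpose A ** minkowski ** A) *v y)" for x y
  proof -
    have "inner (A *v x) z = inner x (Finite_Cartesian_Product.transpose A *v z)" for z
      using dot_lmul_matrix[of z A x] by (simp add: inner_commute)
    then show ?thesis
      by (simp only: lorentz_form_eq_inner matrix_vector_mul_assoc matrix_mul_assoc)
  qed
  then have "A \<in> O31 \<longleftrightarrow> (\<forall>x y. inner x ((Finite_Cartesian_Product.transpose A ** minkowski ** A) *v y)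
      = inner x (minkowski *v y))"
    by (simp add: O31_def lorentz_form_eq_inner)
  also have "\<dots> \<longleftrightarrow> Finite_Cartesian_Product.transpose A ** minkowski ** A = minkowski"
    by (metis matrix_eq vector_eq_rdot inner_commute)
  finally show ?thesis .
qed

text \<open>The defining relation makes \<open>minkowski ** ?T ** minkowski\<close> a left inverse
  of \<open>A\<close>. In finite dimension it is a right inverse too, and that is the defining
  relation of the transpose.\<close>

lemma O31_transpose:
  assumes "A \<in> O31" shows "Finite_Cartesian_Product.transpose A \<in> O31"
proof -
  let ?T = "Finite_Cartesian_Product.transpose A"
  have "(minkowski ** ?T ** minkowski) ** A = minkowski ** (?T ** minkowski ** A)"
    by (simp only: matrix_mul_assoc)
  also have "\<dots> = id4"
    using assms by (simp only: O31_iff minkowski_mult_minkowski)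
  finally have "A ** (minkowski ** ?T ** minkowski) = id4"
    using matrix_left_right_inverse by blast
  then have "A ** minkowski ** ?T ** minkowski ** minkowski = minkowski"
    by (simp only: matrix_mul_assoc matrix_mul_lid)
  then have "A ** minkowski ** ?T ** (minkowski ** minkowski) = minkowski"
    by (simp only: matrix_mul_assoc)
  then show ?thesis
    unfolding O31_iff minkowski_mult_minkowski by (simp add: matrix_mul_assoc)
qed

lemma O31_D: "A \<in> O31 \<Longrightarrow> lorentz_form (A *v x) (A *v y) = lorentz_form x y"
  by (simp add: O31_def)

lemma O31_id [simp]: "id4 \<in> O31"
  by (simp add: O31_def)

lemma O31_mult: "A \<in> O31 \<Longrightarrow> B \<in> O31 \<Longrightarrow> A ** B \<in> O31"
  by (simp add: O31_def flip: matrix_vector_mul_assoc)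

lemma O31_invertible: "A \<in> O31 \<Longrightarrow> invertible A"
  unfolding O31_iff invertible_left_inverse
  by (rule exI[of _ "minkowski ** Finite_Cartesian_Product.transpose A ** minkowski"])
    (simp add: minkowski_mult_minkowski flip: matrix_mul_assoc)

lemma O31_det_sq:
  assumes "A \<in> O31" shows "Determinants.det A * Determinants.det A = 1"
proof -
  have "Determinants.det (minkowski ** minkowski) = 1"
    by (simp add: minkowski_mult_minkowski)
  then have m: "Determinants.det minkowski \<noteq> 0"
    by (auto simp: det_mul)
  have "Determinants.det (Finite_Cartesian_Product.transpose A ** minkowski ** A) = Determinants.det minkowski"
    using assms by (simp only: O31_iff)
  then show ?thesis using m by (simp add: det_mul)
qed

lemma O31_rows:
  assumes "A \<in> O31"
  shows "lorentz_form (A $ i) (A $ j) = minkowski $ i $ j"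
proof -
  let ?T = "Finite_Cartesian_Product.transpose A"
  have "A $ i = ?T *v axis i 1" for i
    by (simp add: matrix_vector_mul_component Finite_Cartesian_Product.vec_eq_iff
        matrix_vector_mult_basis Finite_Cartesian_Product.column_def Finite_Cartesian_Product.transpose_def)
  then have "lorentz_form (A $ i) (A $ j) = lorentz_form (axis i 1) (axis j 1)"
    using O31_D[OF O31_transpose[OF assms]] by simp
  also have "\<dots> = minkowski $ i $ j"
    by (simp add: lorentz_form_eq_inner matrix_vector_mult_basis Finite_Cartesian_Product.column_def
        inner_axis')
  finally show ?thesis .
qed

section \<open>The identity component and an explicit group containing it\<close>

text \<open>Explicit conditions, orientation and time orientation, stand in for connectedness. All
  estimates are made here; the identity component enters through the inclusion
  \<open>SO31_0_subset\<close>.\<close>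

definition SO31_plus :: "(real^4^4) set" where
  "SO31_plus = {A \<in> O31. Determinants.det A = 1 \<and> A $ 4 $ 4 > 0}"

lemma matrix_add_rdistrib': "(A + B) ** C = A ** C + B ** (C :: real^4^4)"
  by (simp add: matrix_matrix_mult_def Finite_Cartesian_Product.vec_eq_iff sum.distrib distrib_right)

lemma bounded_bilinear_matrix_mult: "bounded_bilinear ((**) :: real^4^4 \<Rightarrow> real^4^4 \<Rightarrow> real^4^4)"
  unfolding bilinear_conv_bounded_bilinear[symmetric] bilinear_def
  by (auto intro!: linearI simp: matrix_add_ldistrib matrix_add_rdistrib' matrix_scalar_ac scalar_matrix_assoc)

interpretation matmult: bounded_bilinear "(**) :: real^4^4 \<Rightarrow> real^4^4 \<Rightarrow> real^4^4"
  by (rule bounded_bilinear_matrix_mult)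

text \<open>The translate of the component by \<open>A\<close> is connected, lies in
  \<open>O31\<close> and contains \<open>A\<close> itself, so it cannot leave the component of
  \<open>A\<close>. Closure under products is what makes lifting from \<open>PSO31\<close> to
  matrices multiplicative.\<close>

lemma SO31_0_mult:
  assumes "A \<in> SO31_0" "B \<in> SO31_0" shows "A ** B \<in> SO31_0"
proof -
  let ?S = "(**) A ` SO31_0"
  have sub: "SO31_0 \<subseteq> O31" by (simp add: SO31_0_def connected_component_subset)
  have "connected SO31_0" unfolding SO31_0_def by (rule connected_connected_component)
  then have "connected ?S"
    by (intro connected_continuous_image bounded_bilinear.continuous_on[OF bounded_bilinear_matrix_mult]
        continuous_intros)
  moreover have one: "id4 \<in> SO31_0"
    by (simp add: SO31_0_def connected_component_refl_eq)
  moreover have "A \<in> ?S" using one by force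
  moreover have "?S \<subseteq> O31" using sub assms(1) by (auto intro: O31_mult)
  ultimately have "?S \<subseteq> connected_component_set O31 A"
    by (intro connected_component_maximal) auto
  also have "connected_component_set O31 A = SO31_0"
    using assms(1) connected_component_eq[of A O31 id4] by (simp add: SO31_0_def)
  finally show ?thesis using assms(2) by auto
qed

lemma id4_in_SO31_0: "id4 \<in> SO31_0"
  by (simp add: SO31_0_def connected_component_refl_eq)

lemma connected_real_pos:
  assumes "connected S" "x \<in> S" "f x > (0::real)" "continuous_on S f" "\<And>y. y \<in> S \<Longrightarrow> f y \<noteq> 0" "y \<in> S"
  shows "f y > 0"
proof (rule ccontr)
  assume "\<not> f y > 0"
  moreover have "connected (f ` S)" using assms(1,4) by (intro connected_continuous_image)
  ultimately have "0 \<in> f ` S"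
    using assms(2,3,6) connectedD_interval[of "f ` S" "f y" "f x" 0] by simp
  then obtain z where "z \<in> S" "f z = 0" by auto
  then show False using assms(5) by blast
qed

text \<open>On \<open>O31\<close> neither the determinant nor the entry at (4, 4) vanishes, the
  latter because the fourth row has Lorentz square -1. Both therefore keep on the component the sign
  that they have at the identity.\<close>

lemma SO31_0_subset: "SO31_0 \<subseteq> SO31_plus"
proof
  fix A assume A: "A \<in> SO31_0"
  have sub: "SO31_0 \<subseteq> O31" by (simp add: SO31_0_def connected_component_subset)
  have con: "connected SO31_0" unfolding SO31_0_def by (rule connected_connected_component)
  have "0 < Determinants.det A"
  proof (rule connected_real_pos[OF con id4_in_SO31_0, of Determinants.det])
    show "continuous_on SO31_0 Determinants.det"
      unfolding Determinants.det_def by (intro continuous_intros)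
    show "Determinants.det B \<noteq> 0" if "B \<in> SO31_0" for B
      using O31_det_sq[of B] that sub by auto
  qed (use A in auto)
  moreover have "Determinants.det A * Determinants.det A = 1" using O31_det_sq A sub by blast
  ultimately have "Determinants.det A = 1"
    by (auto simp: square_eq_1_iff)
  moreover have "0 < A $ 4 $ 4"
  proof (rule connected_real_pos[OF con id4_in_SO31_0, of "\<lambda>A. A $ 4 $ 4"])
    show "continuous_on SO31_0 (\<lambda>A. A $ 4 $ 4)" by (intro continuous_intros)
    show "B $ 4 $ 4 \<noteq> 0" if "B \<in> SO31_0" for B
    proof
      assume "B $ 4 $ 4 = 0"
      moreover have "lorentz_form (B $ 4) (B $ 4) = - 1"
        using O31_rows[of B 4 4] that sub by (auto simp: minkowski_def)
      ultimately show False
        using zero_le_square[of "B $ 4 $ 1"] zero_le_square[of "B $ 4 $ 2"] zero_le_square[of "B $ 4 $ 3"]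
        by (simp add: lorentz_form_def)
    qed
  qed (use A in \<open>auto simp: Finite_Cartesian_Product.mat_def\<close>)
  ultimately show "A \<in> SO31_plus" using A sub by (auto simp: SO31_plus_def)
qed

section \<open>The Leibniz expansion in dimension four\<close>

lemma sign_transpose_comp:
  "permutation q \<Longrightarrow> sign (Transposition.transpose a b \<circ> q) = (if a = b then 1 else - 1) * sign q"
  by (simp add: sign_compose permutation_swap_id sign_swap_id)
lemma perm_transpose_comp: "permutation q \<Longrightarrow> permutation (Transposition.transpose a b \<circ> q)"
  by (simp add: permutation_compose permutation_swap_id)
lemma sum_permutations_4:
  fixes g :: "(4 \<Rightarrow> 4) \<Rightarrow> real"
  shows "sum g {p. p permutes UNIV} =
   (\<Sum>a\<in>{1,2,3,4}. \<Sum>b\<in>{2,3,4}. \<Sum>c\<in>{3,4}. g (Transposition.transpose 1 a \<circ> (Transposition.transpose 2 b \<circ> (Transposition.transpose 3 c \<circ> id))))"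
proof -
  have f: "finite {2::4, 3, 4}" "1 \<notin> {2::4, 3, 4}" "finite {3::4, 4}" "2 \<notin> {3::4, 4}" "finite {4::4}" "3 \<notin> {4::4}"
    by auto
  have I: "sum h {p. p permutes {4::4}} = h id" for h :: "(4 \<Rightarrow> 4) \<Rightarrow> real" by (simp add: permutes_sing)
  show ?thesis
    by (subst UNIV_4, subst sum_over_permutations_insert[OF f(1,2)],
        subst sum_over_permutations_insert[OF f(3,4)], subst sum_over_permutations_insert[OF f(5,6)],
        subst I) (rule refl)
qed
text \<open>Written out in the order in which \<open>sum_permutations_4\<close> lists the 24
  permutations. It serves to read off the determinant of the rotation block of a matrix that fixes a
  null vector.\<close>

lemma det_4:
  "Determinants.det (A :: real^4^4) =
    A$1$1 * A$2$2 * A$3$3 * A$4$4 - A$1$1 * A$2$2 * A$3$4 * A$4$3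
    + (A$1$1 * A$2$3 * A$3$4 * A$4$2 - A$1$1 * A$2$3 * A$3$2 * A$4$4
      + (A$1$1 * A$2$4 * A$3$2 * A$4$3 - A$1$1 * A$2$4 * A$3$3 * A$4$2))
    + (A$1$2 * A$2$1 * A$3$4 * A$4$3 - A$1$2 * A$2$1 * A$3$3 * A$4$4
      + (A$1$2 * A$2$3 * A$3$1 * A$4$4 - A$1$2 * A$2$3 * A$3$4 * A$4$1
        + (A$1$2 * A$2$4 * A$3$3 * A$4$1 - A$1$2 * A$2$4 * A$3$1 * A$4$3))
      + (A$1$3 * A$2$2 * A$3$4 * A$4$1 - A$1$3 * A$2$2 * A$3$1 * A$4$4
        + (A$1$3 * A$2$1 * A$3$2 * A$4$4 - A$1$3 * A$2$1 * A$3$4 * A$4$2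
          + (A$1$3 * A$2$4 * A$3$1 * A$4$2 - A$1$3 * A$2$4 * A$3$2 * A$4$1))
        + (A$1$4 * A$2$2 * A$3$1 * A$4$3 - A$1$4 * A$2$2 * A$3$3 * A$4$1
          + (A$1$4 * A$2$3 * A$3$2 * A$4$1 - A$1$4 * A$2$3 * A$3$1 * A$4$2
            + (A$1$4 * A$2$1 * A$3$3 * A$4$2 - A$1$4 * A$2$1 * A$3$2 * A$4$3)))))"
proof -
  have P: "(\<Prod>i\<in>UNIV. A $ i $ p i) = A$1$p 1 * A$2$p 2 * A$3$p 3 * A$4$p 4" for p
    unfolding UNIV_4 by (simp add: mult.assoc)
  show ?thesis
    unfolding Determinants.det_def P sum_permutations_4
    by (simp add: sign_transpose_comp perm_transpose_comp sign_id sign_swap_id permutation_swap_id)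
qed


section \<open>Causal vectors, fixed points and properness of the action\<close>

lemma SO31_plus_D:
  assumes "A \<in> SO31_plus"
  shows "A \<in> O31" "Determinants.det A = 1" "A $ 4 $ 4 > 0"
  using assms by (simp_all add: SO31_plus_def)

lemma Cauchy_Schwarz_3:
  fixes a b c x y z :: real
  shows "(a * x + b * y + c * z)\<^sup>2 \<le> (a\<^sup>2 + b\<^sup>2 + c\<^sup>2) * (x\<^sup>2 + y\<^sup>2 + z\<^sup>2)"
proof -
  have "(a\<^sup>2 + b\<^sup>2 + c\<^sup>2) * (x\<^sup>2 + y\<^sup>2 + z\<^sup>2) - (a * x + b * y + c * z)\<^sup>2
      = (a * y - b * x)\<^sup>2 + (a * z - c * x)\<^sup>2 + (b * z - c * y)\<^sup>2"
    by (simp add: power2_eq_square algebra_simps)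
  moreover have "0 \<le> (a * y - b * x)\<^sup>2 + (a * z - c * x)\<^sup>2 + (b * z - c * y)\<^sup>2"
    by (intro add_nonneg_nonneg zero_le_power2)
  ultimately show ?thesis by linarith
qed

lemma lorentz_form_spacelike:
  assumes "z $ 4 = 0" "z \<noteq> 0" shows "lorentz_form z z > 0"
proof -
  have "z $ 1 \<noteq> 0 \<or> z $ 2 \<noteq> 0 \<or> z $ 3 \<noteq> 0"
    using assms by (auto simp: Finite_Cartesian_Product.vec_eq_iff forall_4)
  then have "0 < z $ 1 * z $ 1 \<or> 0 < z $ 2 * z $ 2 \<or> 0 < z $ 3 * z $ 3"
    by (simp add: zero_less_mult_iff) linarith
  moreover have "0 \<le> z $ 1 * z $ 1" "0 \<le> z $ 2 * z $ 2" "0 \<le> z $ 3 * z $ 3" by simp_all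
  ultimately show ?thesis unfolding lorentz_form_def assms(1) by linarith
qed

text \<open>The difference of two vectors of the same height is spacelike; expanding its square
  leaves the cross term no choice of sign.\<close>

lemma lorentz_form_causal_neg:
  assumes "x $ 4 = 1" "y $ 4 = 1" "lorentz_form x x \<le> 0" "lorentz_form y y \<le> 0" "x \<noteq> y"
  shows "lorentz_form x y < 0"
proof -
  have "lorentz_form (x - y) (x - y) > 0"
    by (rule lorentz_form_spacelike) (use assms in auto)
  then show ?thesis using assms(3,4) lorentz_form_commute[of x y] by simp
qed

lemma lorentz_form_le: "lorentz_form y y \<le> 0 \<Longrightarrow> (y $ 1)\<^sup>2 + (y $ 2)\<^sup>2 + (y $ 3)\<^sup>2 \<le> (y $ 4)\<^sup>2"
  by (simp add: lorentz_form_def power2_eq_square)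

lemma mult_vec_4: "((A :: real^4^4) *v y) $ i = A $ i $ 1 * y $ 1 + A $ i $ 2 * y $ 2 + A $ i $ 3 * y $ 3 + A $ i $ 4 * y $ 4"
  by (simp add: matrix_vector_mult_def sum_4)

text \<open>If the last coordinate of the image were not positive, Cauchy-Schwarz between the
  spatial parts of the fourth row and of \<open>y\<close> would give
  \<open>(A $ 4 $ 4)\<^sup>2 \<le> (A $ 4 $ 4)\<^sup>2 - 1\<close>, as the fourth row has Lorentz
  square -1.\<close>

lemma SO31_plus_future:
  assumes A: "A \<in> SO31_plus" and y: "lorentz_form y y \<le> 0" "y $ 4 > 0"
  shows "(A *v y) $ 4 > 0"
proof (rule ccontr)
  let ?s = "A $ 4 $ 1 * y $ 1 + A $ 4 $ 2 * y $ 2 + A $ 4 $ 3 * y $ 3"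
  let ?a = "(A $ 4 $ 1)\<^sup>2 + (A $ 4 $ 2)\<^sup>2 + (A $ 4 $ 3)\<^sup>2"
  assume "\<not> (A *v y) $ 4 > 0"
  then have "A $ 4 $ 4 * y $ 4 \<le> - ?s" by (simp add: mult_vec_4)
  moreover have "0 < A $ 4 $ 4 * y $ 4" using SO31_plus_D(3)[OF A] y by simp
  ultimately have "(A $ 4 $ 4 * y $ 4)\<^sup>2 \<le> (- ?s)\<^sup>2" by (intro power_mono) auto
  also have "\<dots> \<le> ?a * ((y $ 1)\<^sup>2 + (y $ 2)\<^sup>2 + (y $ 3)\<^sup>2)"
    unfolding power2_minus by (rule Cauchy_Schwarz_3)
  also have "\<dots> \<le> ?a * (y $ 4)\<^sup>2"
    using lorentz_form_le[OF y(1)] by (intro mult_left_mono) auto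
  also have "?a = (A $ 4 $ 4)\<^sup>2 - 1"
    using O31_rows[OF SO31_plus_D(1)[OF A], of 4 4]
    by (simp add: lorentz_form_def minkowski_def power2_eq_square)
  finally have "(y $ 4)\<^sup>2 \<le> 0" by (simp add: power_mult_distrib algebra_simps)
  then show False using y(2) by simp
qed

text \<open>The slice of the causal cone at height 1 is a compact convex ball, the closed projective
  model of hyperbolic space. Applying \<open>A\<close> and rescaling to height 1 maps it to itself,
  and a Brouwer fixed point is an eigenvector.\<close>

lemma SO31_plus_causal_eigenvector:
  assumes A: "A \<in> SO31_plus"
  obtains y \<mu> where "y $ 4 = 1" "lorentz_form y y \<le> 0" "\<mu> > 0" "A *v y = \<mu> *\<^sub>R y"
proof -
  define S where "S = {y :: real^4. y $ 4 = 1 \<and> lorentz_form y y \<le> 0}"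
  define f where "f y = (1 / (A *v y) $ 4) *\<^sub>R (A *v y)" for y
  have pos: "(A *v y) $ 4 > 0" if "y \<in> S" for y
    using SO31_plus_future[OF A, of y] that by (simp add: S_def)
  have cont: "continuous_on T (\<lambda>y. lorentz_form y y)" for T :: "(real^4) set"
    unfolding lorentz_form_def by (intro continuous_intros)
  have "closed S"
    unfolding S_def by (intro closed_Collect_conj closed_Collect_eq closed_Collect_le cont continuous_intros)
  moreover have "bounded S"
  proof (rule boundedI)
    fix y assume y: "y \<in> S"
    have "(norm y)\<^sup>2 = (y $ 1)\<^sup>2 + (y $ 2)\<^sup>2 + (y $ 3)\<^sup>2 + (y $ 4)\<^sup>2"
      unfolding power2_norm_eq_inner inner_vec_def by (simp add: sum_4 power2_eq_square)
    also have "\<dots> \<le> 2\<^sup>2" using lorentz_form_le[of y] y by (simp add: S_def)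
    finally show "norm y \<le> 2" by (rule power2_le_imp_le) simp
  qed
  ultimately have "compact S" by (simp add: compact_eq_bounded_closed)
  moreover have "convex S"
  proof (rule convexI)
    fix y z and u v :: real
    assume yz: "y \<in> S" "z \<in> S" and uv: "0 \<le> u" "0 \<le> v" "u + v = 1"
    have "lorentz_form y z \<le> 0"
      using lorentz_form_causal_neg[of y z] yz by (cases "y = z") (auto simp: S_def)
    then have "u * (u * lorentz_form y y) + 2 * (u * (v * lorentz_form y z)) + v * (v * lorentz_form z z) \<le> 0"
      using yz uv by (intro add_nonpos_nonpos) (auto simp: S_def mult_nonneg_nonpos)
    then show "u *\<^sub>R y + v *\<^sub>R z \<in> S"
      using yz uv lorentz_form_commute[of y z] by (simp add: S_def algebra_simps)
  qed
  moreover have "S \<noteq> {}"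
  proof -
    have "axis 4 1 \<in> S" by (simp add: S_def lorentz_form_def axis_def)
    then show ?thesis by blast
  qed
  moreover have "continuous_on S f"
    unfolding f_def
  proof (intro continuous_intros)
    show "\<forall>y\<in>S. (A *v y) $ 4 \<noteq> 0" using pos by force
  qed
  moreover have "f \<in> S \<rightarrow> S"
  proof
    fix y assume y: "y \<in> S"
    then have "lorentz_form (f y) (f y) = (1 / (A *v y) $ 4) * ((1 / (A *v y) $ 4) * lorentz_form y y)"
      by (simp add: f_def O31_D[OF SO31_plus_D(1)[OF A]])
    also have "\<dots> \<le> 0"
      using y pos[OF y] by (intro mult_nonneg_nonpos) (auto simp: S_def)
    finally show "f y \<in> S" using pos[OF y] by (simp add: S_def f_def)
  qed
  ultimately obtain y where y: "y \<in> S" "f y = y" by (rule brouwer)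
  have "A *v y = (A *v y) $ 4 *\<^sub>R f y"
    using pos[OF y(1)] by (simp add: f_def)
  then show ?thesis
    using that[of y "(A *v y) $ 4"] y pos[OF y(1)] by (simp add: S_def)
qed

text \<open>The relation for the last column bounds the entries \<open>A $ i $ 4\<close> by
  \<open>A $ 4 $ 4\<close>, and the relations for the rows then bound all others by
  \<open>1 + A $ 4 $ 4\<close>. The factor 16 counts the entries.\<close>

lemma SO31_plus_norm_le:
  assumes A: "A \<in> SO31_plus"
  shows "norm A \<le> 16 * (1 + A $ 4 $ 4)"
proof -
  have O: "A \<in> O31" "Finite_Cartesian_Product.transpose A \<in> O31" and p: "A $ 4 $ 4 > 0"
    using SO31_plus_D[OF A] O31_transpose by auto
  have r: "(A $ i $ 1)\<^sup>2 + (A $ i $ 2)\<^sup>2 + (A $ i $ 3)\<^sup>2 = (A $ i $ 4)\<^sup>2 + minkowski $ i $ i" for i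
    using O31_rows[OF O(1), of i i] by (simp add: lorentz_form_def power2_eq_square)
  have c: "(A $ 1 $ 4)\<^sup>2 + (A $ 2 $ 4)\<^sup>2 + (A $ 3 $ 4)\<^sup>2 = (A $ 4 $ 4)\<^sup>2 - 1"
    using O31_rows[OF O(2), of 4 4]
    by (simp add: lorentz_form_def power2_eq_square Finite_Cartesian_Product.transpose_def minkowski_def)
  have n: "0 \<le> (A $ i $ j)\<^sup>2" for i j by simp
  have m: "minkowski $ i $ i \<le> 1" for i by (simp add: minkowski_def)
  have 4: "(A $ i $ 4)\<^sup>2 \<le> (A $ 4 $ 4)\<^sup>2" for i
  proof -
    have "\<forall>i. (A $ i $ 4)\<^sup>2 \<le> (A $ 4 $ 4)\<^sup>2"
      unfolding forall_4 using c n[of 1 4] n[of 2 4] n[of 3 4] by linarith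
    then show ?thesis by blast
  qed
  have "(A $ i $ j)\<^sup>2 \<le> (A $ 4 $ 4)\<^sup>2 + 1" for i j
  proof -
    have "\<forall>j. (A $ i $ j)\<^sup>2 \<le> (A $ 4 $ 4)\<^sup>2 + 1"
      unfolding forall_4 using r[of i] 4[of i] m[of i] n[of i 1] n[of i 2] n[of i 3] n[of i 4] by linarith
    then show ?thesis by blast
  qed
  moreover have "(A $ 4 $ 4)\<^sup>2 + 1 \<le> (1 + A $ 4 $ 4)\<^sup>2"
    using p by (simp add: power2_eq_square algebra_simps)
  ultimately have "(A $ i $ j)\<^sup>2 \<le> (1 + A $ 4 $ 4)\<^sup>2" for i j
    using order_trans by blast
  then have e: "\<bar>A $ i $ j\<bar> \<le> 1 + A $ 4 $ 4" for i j
    using p abs_le_square_iff[of "A $ i $ j" "1 + A $ 4 $ 4"] by simp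
  have n4: "norm (A $ i) \<le> 4 * (1 + A $ 4 $ 4)" for i
    using norm_le_l1_cart[of "A $ i"] e[of i 1] e[of i 2] e[of i 3] e[of i 4] by (simp add: sum_4)
  have "norm A \<le> (\<Sum>i\<in>UNIV. norm (A $ i))"
    unfolding norm_vec_def by (rule L2_set_le_sum) simp
  then have "norm A \<le> norm (A $ 1) + norm (A $ 2) + norm (A $ 3) + norm (A $ 4)"
    by (simp add: sum_4)
  then show ?thesis
    using n4[of 1] n4[of 2] n4[of 3] n4[of 4] by linarith
qed

text \<open>Properness of the action on timelike vectors. The images of \<open>y\<close> and of the
  fourth unit vector keep their pairing. If the image of \<open>y\<close> stays bounded, it stays
  away from the light cone, and then the pairing controls the height of the other image, which is
  \<open>A $ 4 $ 4\<close>.\<close>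

lemma SO31_plus_bounded:
  assumes y: "lorentz_form y y < 0" "y $ 4 > 0"
  shows "bounded {A \<in> SO31_plus. norm (A *v y) \<le> C}"
proof (rule boundedI)
  define K where "K = y $ 4 * (2 * C) / (- lorentz_form y y)"
  fix A assume "A \<in> {A \<in> SO31_plus. norm (A *v y) \<le> C}"
  then have A: "A \<in> SO31_plus" and C: "norm (A *v y) \<le> C" by auto
  define z where "z = A *v y"
  define u where "u = A *v axis 4 1"
  \<comment> \<open>The length of the spatial part of \<open>z\<close>; the difference
    \<open>z $ 4 - \<zeta>\<close> measures the distance from the light cone.\<close>
  define \<zeta> where "\<zeta> = sqrt ((z $ 1)\<^sup>2 + (z $ 2)\<^sup>2 + (z $ 3)\<^sup>2)"
  have O: "A \<in> O31" using SO31_plus_D[OF A] by simp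
  have z4: "z $ 4 > 0" unfolding z_def using SO31_plus_future[OF A] y by simp
  have u4: "u $ 4 = A $ 4 $ 4" by (simp add: u_def mult_vec_4 axis_def)
  have u4p: "u $ 4 > 0" using SO31_plus_D(3)[OF A] u4 by simp
  have zz: "lorentz_form z z = lorentz_form y y" unfolding z_def by (rule O31_D[OF O])
  have uu: "lorentz_form u u = - 1" unfolding u_def O31_D[OF O] by (simp add: lorentz_form_def axis_def)
  have uz: "lorentz_form u z = - y $ 4" unfolding u_def z_def O31_D[OF O] by (simp add: lorentz_form_def axis_def)
  have \<zeta>0: "\<zeta> \<ge> 0" and \<zeta>2: "\<zeta>\<^sup>2 = (z $ 1)\<^sup>2 + (z $ 2)\<^sup>2 + (z $ 3)\<^sup>2"
    by (simp_all add: \<zeta>_def)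
  have zC: "z $ 4 \<le> C"
    using component_le_norm_cart[of z 4] C z4 by (simp add: z_def)
  have d: "(z $ 4 - \<zeta>) * (z $ 4 + \<zeta>) = - lorentz_form y y"
    unfolding zz[symmetric] using \<zeta>2 by (simp add: lorentz_form_def power2_eq_square algebra_simps)
  then have "(z $ 4 - \<zeta>) * (z $ 4 + \<zeta>) > 0" using y by simp
  moreover have "z $ 4 + \<zeta> > 0" using z4 \<zeta>0 by linarith
  ultimately have "z $ 4 - \<zeta> > 0" by (rule zero_less_mult_pos2)
  then have \<zeta>z: "\<zeta> < z $ 4" by simp
  have le: "- lorentz_form y y \<le> (z $ 4 - \<zeta>) * (2 * C)"
    unfolding d[symmetric] by (rule mult_left_mono) (use \<zeta>z zC in linarith)+
  let ?s = "u $ 1 * z $ 1 + u $ 2 * z $ 2 + u $ 3 * z $ 3"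
  have "?s\<^sup>2 \<le> ((u $ 1)\<^sup>2 + (u $ 2)\<^sup>2 + (u $ 3)\<^sup>2) * \<zeta>\<^sup>2"
    unfolding \<zeta>2 by (rule Cauchy_Schwarz_3)
  also have "\<dots> \<le> (u $ 4)\<^sup>2 * \<zeta>\<^sup>2"
    using lorentz_form_le[of u] uu by (intro mult_right_mono) auto
  finally have "?s\<^sup>2 \<le> (u $ 4 * \<zeta>)\<^sup>2" by (simp add: power_mult_distrib)
  then have "?s \<le> u $ 4 * \<zeta>"
    by (rule power2_le_imp_le) (use u4p \<zeta>0 in simp)
  then have "u $ 4 * (z $ 4 - \<zeta>) \<le> y $ 4"
    using uz by (simp add: lorentz_form_def algebra_simps)
  then have le2: "u $ 4 * (z $ 4 - \<zeta>) * (2 * C) \<le> y $ 4 * (2 * C)"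
    by (rule mult_right_mono) (use zC z4 in linarith)
  have "u $ 4 * (- lorentz_form y y) \<le> u $ 4 * ((z $ 4 - \<zeta>) * (2 * C))"
    using le by (rule mult_left_mono) (use u4p in linarith)
  also have "\<dots> = u $ 4 * (z $ 4 - \<zeta>) * (2 * C)" by (simp only: mult.assoc)
  also note le2
  finally have "A $ 4 $ 4 * (- lorentz_form y y) \<le> y $ 4 * (2 * C)"
    unfolding u4 .
  then have "A $ 4 $ 4 \<le> K"
    unfolding K_def by (rule mult_imp_le_div_pos[rotated]) (use y(1) in simp)
  then have "16 * (1 + A $ 4 $ 4) \<le> 16 * (1 + K)" by simp
  with SO31_plus_norm_le[OF A] show "norm A \<le> 16 * (1 + K)"
    by (rule order_trans)
qed


section \<open>Parabolic translations\<close>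

text \<open>The parabolic isometry that fixes the null vector \<open>v\<close> and has translation vector \<open>p\<close>, where
  \<open>p\<close> is orthogonal to \<open>v\<close> and matters modulo \<open>v\<close> only.\<close>

definition parabolic :: "real^4 \<Rightarrow> real^4 \<Rightarrow> real^4 \<Rightarrow> real^4" where
  "parabolic v p y = y + lorentz_form y v *\<^sub>R p - lorentz_form y p *\<^sub>R v
     - (lorentz_form p p * lorentz_form y v / 2) *\<^sub>R v"

definition null0 :: "real^4" where
  "null0 = axis 3 1 + axis 4 1"

lemma null0_nth: "null0 $ 1 = 0" "null0 $ 2 = 0" "null0 $ 3 = 1" "null0 $ 4 = 1"
  by (simp_all add: null0_def axis_def)

lemma lorentz_form_null0: "lorentz_form null0 y = y $ 3 - y $ 4" "lorentz_form y null0 = y $ 3 - y $ 4"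
  by (simp_all add: lorentz_form_def null0_nth)

lemma O31_columns:
  assumes "A \<in> O31"
  shows "A $ 1 $ i * A $ 1 $ j + A $ 2 $ i * A $ 2 $ j + A $ 3 $ i * A $ 3 $ j - A $ 4 $ i * A $ 4 $ j = minkowski $ i $ j"
  using O31_rows[OF O31_transpose[OF assms], of i j]
  by (simp add: lorentz_form_def Finite_Cartesian_Product.transpose_def)

text \<open>Fixing \<open>null0\<close> leaves a rotation of a Euclidean plane, with entries
  \<open>a\<close> and \<open>c\<close>, and a translation by \<open>p1\<close>, \<open>p2\<close>.
  A nontrivial rotation composed with a translation has a fixed point in the plane, which yields a
  fixed timelike vector against the hypothesis. So the rotation is trivial, and orthogonality of the
  columns determines the rest.\<close>

lemma parabolic_null0:
  assumes A: "A \<in> O31" "Determinants.det A = 1" "A *v null0 = null0"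
    and nt: "\<And>y. A *v y = y \<Longrightarrow> lorentz_form y y \<ge> 0"
  shows "\<exists>p. lorentz_form p null0 = 0 \<and> (\<forall>y. A *v y = parabolic null0 p y)"
proof -
  define p1 p2 r1 r2 k where "p1 = A $ 1 $ 3" and "p2 = A $ 2 $ 3" and "r1 = A $ 3 $ 1" and "r2 = A $ 3 $ 2"
    and "k = A $ 3 $ 3"
  define a b c d where "a = A $ 1 $ 1" and "b = A $ 1 $ 2" and "c = A $ 2 $ 1" and "d = A $ 2 $ 2"
  have Av: "A $ i $ 3 + A $ i $ 4 = null0 $ i" for i
    using arg_cong[OF A(3), of "\<lambda>y. y $ i"] by (simp add: mult_vec_4 null0_nth)
  have Aw: "(A *v y) $ 3 - (A *v y) $ 4 = y $ 3 - y $ 4" for y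
    using O31_D[OF A(1), of y null0] by (simp add: A(3) lorentz_form_null0)
  have Aw': "A $ 3 $ j - A $ 4 $ j = axis j 1 $ 3 - axis j (1 :: real) $ 4" for j
    using Aw[of "axis j 1"] by (simp add: matrix_vector_mult_basis Finite_Cartesian_Product.column_def)
  have e: "A $ 1 $ 1 = a" "A $ 1 $ 2 = b" "A $ 1 $ 3 = p1" "A $ 1 $ 4 = - p1"
    "A $ 2 $ 1 = c" "A $ 2 $ 2 = d" "A $ 2 $ 3 = p2" "A $ 2 $ 4 = - p2"
    "A $ 3 $ 1 = r1" "A $ 3 $ 2 = r2" "A $ 3 $ 3 = k" "A $ 3 $ 4 = 1 - k"
    "A $ 4 $ 1 = r1" "A $ 4 $ 2 = r2" "A $ 4 $ 3 = k - 1" "A $ 4 $ 4 = 2 - k"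
    using Av[of 1] Av[of 2] Av[of 3] Av[of 4] Aw'[of 1] Aw'[of 2] Aw'[of 3] Aw'[of 4]
    by (simp_all add: p1_def p2_def r1_def r2_def k_def a_def b_def c_def d_def null0_nth axis_def algebra_simps)
  note C = O31_columns[OF A(1)]
  have c11: "a * a + c * c = 1" using C[of 1 1] by (simp add: e minkowski_def)
  have c22: "b * b + d * d = 1" using C[of 2 2] by (simp add: e minkowski_def)
  have "a * d - b * c = 1"
    using A(2) unfolding det_4 e by (simp add: algebra_simps)
  then have "(a - d)\<^sup>2 + (b + c)\<^sup>2 = 0"
    using c11 c22 by (simp add: power2_eq_square algebra_simps)
  then have "a - d = 0" "b + c = 0" unfolding sum_power2_eq_zero_iff by auto
  then have bd: "d = a" "b = - c" by auto
  have row: "(A *v y) $ 1 = a * y $ 1 - c * y $ 2 + p1 * (y $ 3 - y $ 4)"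
    "(A *v y) $ 2 = c * y $ 1 + a * y $ 2 + p2 * (y $ 3 - y $ 4)"
    "(A *v y) $ 3 = r1 * y $ 1 + r2 * y $ 2 + k * y $ 3 + (1 - k) * y $ 4"
    "(A *v y) $ 4 = r1 * y $ 1 + r2 * y $ 2 + (k - 1) * y $ 3 + (2 - k) * y $ 4" for y
    by (simp_all add: mult_vec_4 e bd algebra_simps)
  have "a = 1"
  proof (rule ccontr)
    assume "a \<noteq> 1"
    \<comment> \<open>The determinant of the rotation minus the identity. The values
      \<open>y1\<close> and \<open>y2\<close> are the fixed point of the planar motion by Cramer's
      rule.\<close>
    define D where "D = (a - 1)\<^sup>2 + c\<^sup>2"
    have D: "D \<noteq> 0" using \<open>a \<noteq> 1\<close> by (simp add: D_def sum_power2_eq_zero_iff)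
    define y1 y2 where "y1 = (- p1 * (a - 1) - p2 * c) / D" and "y2 = (c * p1 - p2 * (a - 1)) / D"
    have D1: "D * y1 = - p1 * (a - 1) - p2 * c" and D2: "D * y2 = c * p1 - p2 * (a - 1)"
      using D by (simp_all add: y1_def y2_def)
    define y :: "real^4" where "y = y1 *\<^sub>R axis 1 1 + y2 *\<^sub>R axis 2 1 + axis 3 1"
    have y: "y $ 1 = y1" "y $ 2 = y2" "y $ 3 = 1" "y $ 4 = 0"
      by (simp_all add: y_def axis_def)
    have "D * ((a - 1) * y1 - c * y2 + p1) = (a - 1) * (D * y1) - c * (D * y2) + D * p1"
      by (simp add: algebra_simps)
    also have "\<dots> = (a - 1) * (- p1 * (a - 1) - p2 * c) - c * (c * p1 - p2 * (a - 1)) + D * p1"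
      by (simp only: D1 D2)
    also have "\<dots> = 0" by (simp add: D_def power2_eq_square algebra_simps)
    finally have "(a - 1) * y1 - c * y2 + p1 = 0" using D mult_eq_0_iff by blast
    then have 1: "a * y1 - c * y2 + p1 = y1" by (simp add: algebra_simps)
    have "D * (c * y1 + (a - 1) * y2 + p2) = c * (D * y1) + (a - 1) * (D * y2) + D * p2"
      by (simp add: algebra_simps)
    also have "\<dots> = c * (- p1 * (a - 1) - p2 * c) + (a - 1) * (c * p1 - p2 * (a - 1)) + D * p2"
      by (simp only: D1 D2)
    also have "\<dots> = 0" by (simp add: D_def power2_eq_square algebra_simps)
    finally have "c * y1 + (a - 1) * y2 + p2 = 0" using D mult_eq_0_iff by blast
    then have 2: "c * y1 + a * y2 + p2 = y2" by (simp add: algebra_simps)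
    \<comment> \<open>The planar coordinates of \<open>y\<close> are fixed, so the image can differ
      from \<open>y\<close> only along \<open>null0\<close>. Since \<open>y\<close> pairs to 1 with
      \<open>null0\<close>, invariance of the form removes that difference.\<close>
    define \<sigma> where "\<sigma> = (A *v y) $ 3 - 1"
    have Ay: "A *v y = y + \<sigma> *\<^sub>R null0"
      using row(1,2)[of y] Aw[of y] 1 2
      by (simp add: Finite_Cartesian_Product.vec_eq_iff forall_4 null0_nth y \<sigma>_def)
    have "lorentz_form (A *v y) (A *v y) = lorentz_form y y" by (rule O31_D[OF A(1)])
    then have "\<sigma> = 0" unfolding Ay by (simp add: lorentz_form_null0 null0_nth y)
    \<comment> \<open>Chosen such that the shifted vector has Lorentz square -1.\<close>
    define \<tau> where "\<tau> = (lorentz_form y y + 1) / 2"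
    have "A *v (y - \<tau> *\<^sub>R null0) = y - \<tau> *\<^sub>R null0"
      using Ay \<open>\<sigma> = 0\<close> A(3) by (simp add: matrix_vector_mult_diff_distrib matrix_vector_mult_scaleR)
    then have "lorentz_form (y - \<tau> *\<^sub>R null0) (y - \<tau> *\<^sub>R null0) \<ge> 0" by (rule nt)
    then show False by (simp add: lorentz_form_null0 null0_nth y \<tau>_def)
  qed
  with c11 have "c = 0" by simp
  have "r1 = - p1" using C[of 1 3] \<open>a = 1\<close> \<open>c = 0\<close> by (simp add: e minkowski_def algebra_simps)
  have "r2 = - p2" using C[of 2 3] \<open>a = 1\<close> \<open>c = 0\<close> bd by (simp add: e minkowski_def algebra_simps)
  have "p1 * p1 + (p2 * p2 + k * 2) = 2"
    using C[of 3 3] by (simp add: e minkowski_def algebra_simps)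
  then have k: "k = 1 - (p1 * p1 + p2 * p2) / 2" by argo
  define p :: "real^4" where "p = p1 *\<^sub>R axis 1 1 + p2 *\<^sub>R axis 2 1"
  have p: "p $ 1 = p1" "p $ 2 = p2" "p $ 3 = 0" "p $ 4 = 0"
    by (simp_all add: p_def axis_def)
  have "A *v y = parabolic null0 p y" for y
    unfolding parabolic_def Finite_Cartesian_Product.vec_eq_iff forall_4 row
    by (simp add: lorentz_form_null0 null0_nth p lorentz_form_def[of _ p] \<open>a = 1\<close> \<open>c = 0\<close> \<open>r1 = - p1\<close> \<open>r2 = - p2\<close> k
        field_simps)
  moreover have "lorentz_form p null0 = 0" by (simp add: lorentz_form_null0 p)
  ultimately show ?thesis by blast
qed

text \<open>The Lorentz reflection in the hyperplane orthogonal to \<open>v - null0\<close>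
  exchanges the two null vectors. It exists because this difference is not null when they are
  distinct.\<close>

lemma O31_involution_null0:
  assumes v: "v $ 4 = 1" "lorentz_form v v = 0"
  obtains P where "P \<in> O31" "P ** P = id4" "P *v null0 = v"
proof (cases "v = null0")
  case True
  then show ?thesis using that[of id4] by simp
next
  case False
  define u where "u = v - null0"
  have nn: "lorentz_form null0 null0 = 0" by (simp add: lorentz_form_null0 null0_nth)
  have vn: "lorentz_form v null0 < 0"
    by (rule lorentz_form_causal_neg) (use v nn False in \<open>auto simp: null0_nth\<close>)
  then have uu: "lorentz_form u u \<noteq> 0"
    using v nn lorentz_form_commute[of v null0] by (simp add: u_def)
  define f where "f y = y - (2 * lorentz_form y u / lorentz_form u u) *\<^sub>R u" for y
  have "linear f"
    unfolding f_def by (rule linearI) (simp_all add: algebra_simps add_divide_distrib diff_divide_distrib)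
  then have P: "matrix f *v y = f y" for y by (simp add: matrix_works)
  have fu: "lorentz_form (f y) u = - lorentz_form y u" for y
    using uu by (simp add: f_def)
  have ff: "f (f y) = y" for y
    by (simp add: f_def[of "f y"] fu) (simp add: f_def)
  have "lorentz_form (f x) (f y) = lorentz_form x y" for x y
  proof -
    define q where "q z = 2 * lorentz_form z u / lorentz_form u u" for z
    have q: "q z * lorentz_form u u = 2 * lorentz_form z u" for z using uu by (simp add: q_def)
    have "lorentz_form (f x) (f y) = lorentz_form x y - q y * lorentz_form x u - q x * lorentz_form y u
        + q x * (q y * lorentz_form u u)"
      unfolding f_def q_def[symmetric] by (simp add: lorentz_form_commute[of u y] algebra_simps)
    also have "q x * (q y * lorentz_form u u) = 2 * (q x * lorentz_form y u)" unfolding q by simp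
    also have "q y * lorentz_form x u = q x * lorentz_form y u"
      by (simp add: q_def)
    finally show ?thesis by simp
  qed
  then have "matrix f \<in> O31" by (simp add: O31_def P)
  moreover have "matrix f ** matrix f = id4"
    by (simp add: matrix_eq P ff flip: matrix_vector_mul_assoc)
  moreover have "2 * lorentz_form null0 u / lorentz_form u u = - 1"
    using vn v nn lorentz_form_commute[of v null0] by (simp add: u_def field_simps)
  then have "matrix f *v null0 = v" by (simp add: P f_def) (simp add: u_def)
  ultimately show ?thesis by (rule that)
qed

lemma parabolic_transport:
  assumes "P \<in> O31"
  shows "P *v parabolic v p y = parabolic (P *v v) (P *v p) (P *v y)"
  by (simp add: parabolic_def O31_D[OF assms] matrix_vector_right_distrib matrix_vector_mult_diff_distrib
      matrix_vector_mult_scaleR)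

text \<open>Conjugation by the reflection that exchanges \<open>v\<close> and \<open>null0\<close>
  reduces the claim to explicit coordinates; parabolic maps are given by the form alone and are
  transported by isometries.\<close>

lemma O31_parabolic:
  assumes A: "A \<in> O31" "Determinants.det A = 1" "A *v v = v" and v: "v $ 4 = 1" "lorentz_form v v = 0"
    and nt: "\<And>y. A *v y = y \<Longrightarrow> lorentz_form y y \<ge> 0"
  shows "\<exists>p. lorentz_form p v = 0 \<and> (\<forall>y. A *v y = parabolic v p y)"
proof -
  obtain P where P: "P \<in> O31" "P ** P = id4" "P *v null0 = v"
    using O31_involution_null0[OF v] .
  have PP: "P *v (P *v y) = y" for y by (simp add: matrix_vector_mul_assoc P(2))
  let ?A = "P ** A ** P"
  have "\<exists>p. lorentz_form p null0 = 0 \<and> (\<forall>y. ?A *v y = parabolic null0 p y)"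
  proof (rule parabolic_null0)
    show "?A \<in> O31" using A(1) P(1) by (intro O31_mult)
    have "Determinants.det P * Determinants.det P = 1" by (rule O31_det_sq[OF P(1)])
    then show "Determinants.det ?A = 1" by (simp add: det_mul A(2))
    show "?A *v null0 = null0"
      using PP[of null0] by (simp add: P(3) A(3) flip: matrix_vector_mul_assoc)
    fix y assume "?A *v y = y"
    then have "P *v (?A *v y) = P *v y" by simp
    then have "A *v (P *v y) = P *v y"
      by (simp add: PP flip: matrix_vector_mul_assoc)
    from nt[OF this] show "lorentz_form y y \<ge> 0" by (simp add: O31_D[OF P(1)])
  qed
  then obtain p where p: "lorentz_form p null0 = 0" "\<And>y. ?A *v y = parabolic null0 p y" by blast
  have "A *v y = parabolic v (P *v p) y" for y
  proof -
    have "A *v y = P *v (?A *v (P *v y))" by (simp add: PP flip: matrix_vector_mul_assoc)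
    then show ?thesis by (simp add: p(2) parabolic_transport[OF P(1)] P(3) PP)
  qed
  moreover have "lorentz_form (P *v p) v = 0"
    using O31_D[OF P(1), of p null0] p(1) P(3) by simp
  ultimately show ?thesis by blast
qed

text \<open>The vector \<open>minkowski *v v\<close> is an eigenvector of the transpose for the
  inverse eigenvalue, and a matrix and its transpose have the same eigenvalues.\<close>

lemma O31_inverse_eigenvalue:
  assumes A: "A \<in> O31" "A *v v = \<alpha> *\<^sub>R v" "v \<noteq> 0" "\<alpha> \<noteq> 0"
  obtains w where "w \<noteq> 0" "A *v w = (1 / \<alpha>) *\<^sub>R w"
proof -
  let ?T = "Finite_Cartesian_Product.transpose A" and ?J = "minkowski *v v"
  have "?T *v (minkowski *v (A *v v)) = ?J"
    using A(1) unfolding O31_iff by (simp only: matrix_vector_mul_assoc matrix_mul_assoc)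
  then have "\<alpha> *\<^sub>R (?T *v ?J) = ?J"
    by (simp only: A(2) matrix_vector_mult_scaleR)
  moreover have "?T *v ?J = (1 / \<alpha>) *\<^sub>R (\<alpha> *\<^sub>R (?T *v ?J))" using A(4) by simp
  ultimately have T: "?T *v ?J = (1 / \<alpha>) *\<^sub>R ?J" by simp
  have J0: "?J \<noteq> 0"
  proof
    assume "?J = 0"
    then have "minkowski *v ?J = 0" by simp
    then show False using A(3) by (simp add: matrix_vector_mul_assoc minkowski_mult_minkowski)
  qed
  let ?B = "A - (1 / \<alpha>) *\<^sub>R id4"
  have "Finite_Cartesian_Product.transpose ?B = ?T - (1 / \<alpha>) *\<^sub>R id4"
    by (simp add: Finite_Cartesian_Product.vec_eq_iff Finite_Cartesian_Product.transpose_def Finite_Cartesian_Product.mat_def)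
  then have "Finite_Cartesian_Product.transpose ?B *v ?J = 0"
    by (simp only: matrix_vector_mult_diff_rdistrib T scaleR_matrix_vector_assoc[symmetric]
        matrix_vector_mul_lid diff_self)
  then have "\<not> invertible (Finite_Cartesian_Product.transpose ?B)"
    using J0 matrix_left_invertible_ker invertible_left_inverse by blast
  then have "Determinants.det ?B = 0"
    by (simp add: invertible_det_nz)
  then have "\<not> invertible ?B" by (simp add: invertible_det_nz)
  then obtain w where "?B *v w = 0" "w \<noteq> 0"
    using matrix_left_invertible_ker invertible_left_inverse by blast
  then show ?thesis
    using that[of w] by (simp add: matrix_vector_mult_diff_rdistrib flip: scaleR_matrix_vector_assoc)
qed


lemma parabolic_add:
  assumes "lorentz_form v v = 0" "lorentz_form p v = 0" "lorentz_form q v = 0"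
  shows "parabolic v p (parabolic v q y) = parabolic v (p + q) y"
proof -
  have 1: "lorentz_form (parabolic v q y) v = lorentz_form y v"
    using assms by (simp add: parabolic_def)
  have 2: "lorentz_form (parabolic v q y) p = lorentz_form y p + lorentz_form y v * lorentz_form q p"
    using assms lorentz_form_commute[of v p] by (simp add: parabolic_def)
  have "(lorentz_form p p + 2 * lorentz_form q p + lorentz_form q q) = lorentz_form (p + q) (p + q)"
    using lorentz_form_commute[of p q] by simp
  then have 3: "lorentz_form (p + q) (p + q) * lorentz_form y v / 2
      = lorentz_form p p * lorentz_form y v / 2 + lorentz_form y v * lorentz_form q p + lorentz_form q q * lorentz_form y v / 2"
    by (simp add: field_simps)
  show ?thesis
    unfolding parabolic_def[of v p] 1 2 parabolic_def[of v "p + q"] 3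
    by (simp add: parabolic_def algebra_simps)
qed

section \<open>Discrete groups of rank two\<close>

lemma additive_int_pair:
  fixes f :: "int \<Rightarrow> int \<Rightarrow> real"
  assumes add: "\<And>m m' n n'. f (m + m') (n + n') = f m n + f m' n'"
  shows "f m n = m * f 1 0 + n * f 0 1"
proof -
  have z: "f 0 0 = 0" using add[of 0 0 0 0] by simp
  have 1: "f m 0 = m * f 1 0" for m
  proof (induction m rule: int_induct[of _ 0])
    case (step1 i)
    then show ?case using add[of i 1 0 0] by (simp add: algebra_simps)
  next
    case (step2 i)
    then show ?case using add[of "i - 1" 1 0 0] by (simp add: algebra_simps)
  qed (simp add: z)
  have 2: "f 0 n = n * f 0 1" for n
  proof (induction n rule: int_induct[of _ 0])
    case (step1 i)
    then show ?case using add[of 0 0 i 1] by (simp add: algebra_simps)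
  next
    case (step2 i)
    then show ?case using add[of 0 0 "i - 1" 1] by (simp add: algebra_simps)
  qed (simp add: z)
  show ?thesis using add[of m 0 0 n] 1[of m] 2[of n] by simp
qed

lemma additive_infinite_bounded:
  fixes f :: "int \<Rightarrow> int \<Rightarrow> real"
  assumes add: "\<And>m m' n n'. f (m + m') (n + n') = f m n + f m' n'"
  obtains K where "infinite {(m, n). \<bar>f m n\<bar> \<le> K}"
proof -
  define a b where "a = f 1 0" and "b = f 0 1"
  have f: "f m n = m * a + n * b" for m n
    unfolding a_def b_def by (rule additive_int_pair) (rule add)
  \<comment> \<open>For \<open>b \<noteq> 0\<close> the floor picks the multiple of \<open>b\<close>
    that brings \<open>m * a\<close> back to within \<open>\<bar>b\<bar>\<close> of 0; for
    \<open>b = 0\<close> the kernel already contains the second factor.\<close>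
  define g :: "int \<Rightarrow> int \<times> int" where "g m = (if b = 0 then (0, m) else (m, - \<lfloor>m * a / b\<rfloor>))" for m
  have "inj g" by (rule injI) (auto simp: g_def split: if_splits)
  then have "infinite (range g)" by (simp add: finite_image_iff)
  moreover have "range g \<subseteq> {(m, n). \<bar>f m n\<bar> \<le> \<bar>b\<bar>}"
  proof
    fix x assume "x \<in> range g"
    then obtain m where x: "x = g m" by blast
    show "x \<in> {(m, n). \<bar>f m n\<bar> \<le> \<bar>b\<bar>}"
    proof (cases "b = 0")
      case True
      then show ?thesis by (simp add: x g_def f)
    next
      case False
      have "m * a + - \<lfloor>m * a / b\<rfloor> * b = b * (m * a / b - \<lfloor>m * a / b\<rfloor>)"
        using False by (simp add: algebra_simps)
      moreover have "\<bar>m * a / b - \<lfloor>m * a / b\<rfloor>\<bar> \<le> 1"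
        using floor_correct[of "m * a / b"] by linarith
      ultimately have "\<bar>m * a + - \<lfloor>m * a / b\<rfloor> * b\<bar> \<le> \<bar>b\<bar>"
        by (simp add: abs_mult mult_left_le)
      then show ?thesis using False by (simp add: x g_def f)
    qed
  qed
  ultimately show ?thesis using that infinite_super by blast
qed

section \<open>Fixed points at infinity of a discrete group of rank two\<close>

locale discrete_rank_two =
  fixes M :: "int \<Rightarrow> int \<Rightarrow> real^4^4"
  assumes mult: "M (m + m') (n + n') = M m n ** M m' n'"
    and SO: "M m n \<in> SO31_plus"
    and discrete: "\<exists>\<epsilon>>0. \<forall>m n. norm (M m n - id4) < \<epsilon> \<longrightarrow> m = 0 \<and> n = 0"
begin

lemma O31: "M m n \<in> O31"
  using SO SO31_plus_D(1) by blast

lemma M_0: "M 0 0 = id4"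
proof -
  obtain B where B: "B ** M 0 0 = id4"
    using O31_invertible[OF O31] by (auto simp: invertible_def)
  moreover from this have "M 0 0 ** M 0 0 = M 0 0" using mult[of 0 0 0 0] by simp
  ultimately have "B ** (M 0 0 ** M 0 0) = id4" by simp
  with B show ?thesis by (simp add: matrix_mul_assoc)
qed

lemma M_uminus: "M m n ** M (- m) (- n) = id4" "M (- m) (- n) ** M m n = id4"
  using mult[of m "- m" n "- n"] mult[of "- m" m "- n" n] M_0 by simp_all

lemma M_commute: "M m n *v (M m' n' *v y) = M m' n' *v (M m n *v y)"
  by (simp add: matrix_vector_mul_assoc flip: mult) (simp add: add.commute)

lemma M_eq_id: "M m n = id4 \<Longrightarrow> m = 0 \<and> n = 0"
proof -
  assume "M m n = id4"
  moreover obtain \<epsilon> where "\<epsilon> > 0" "\<forall>m n. norm (M m n - id4) < \<epsilon> \<longrightarrow> m = 0 \<and> n = 0"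
    using discrete by blast
  ultimately show ?thesis by (metis diff_self norm_zero)
qed

text \<open>In a bounded family the inverses are bounded too, so two distinct members that are close
  have a quotient near the identity, which discreteness forbids. An infinite bounded set has a limit
  point and hence such members.\<close>

lemma infinite_unbounded:
  assumes S: "infinite S" shows "\<not> bounded ((\<lambda>(m, n). M m n) ` S)"
proof
  let ?f = "\<lambda>(m, n). M m n"
  assume "bounded (?f ` S)"
  then obtain K where "\<forall>z\<in>?f ` S. norm z \<le> K"
    unfolding bounded_iff by blast
  then have K: "norm (?f x) \<le> K" if "x \<in> S" for x using that by blast
  obtain \<epsilon> where \<epsilon>: "\<epsilon> > 0" "\<And>m n. norm (M m n - id4) < \<epsilon> \<Longrightarrow> m = 0 \<and> n = 0"
    using discrete by blast
  obtain C where C: "C > 0" "\<And>(A :: real^4^4) (B :: real^4^4). norm (A ** B) \<le> norm A * norm B * C"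
    using matmult.pos_bounded by blast
  have inj: "x = y" if "norm (?f x - ?f y) < \<epsilon> / (16 * (1 + \<bar>K\<bar>) * C)" "x \<in> S" "y \<in> S" for x y
  proof -
    obtain m n m' n' where x: "x = (m, n)" and y: "y = (m', n')" by (metis surj_pair)
    \<comment> \<open>Moving an isometry to the other side of the form inverts it, so inverse
      elements share this entry, and \<open>SO31_plus_norm_le\<close> bounds the inverse.\<close>
    have "M (- m') (- n') $ 4 $ 4 = M m' n' $ 4 $ 4"
    proof -
      have "lorentz_form (axis 4 1) (M (- m') (- n') *v axis 4 1) = lorentz_form (M m' n' *v axis 4 1) (axis 4 1)"
        using O31_D[OF O31, of m' n' "axis 4 1" "M (- m') (- n') *v axis 4 1"]
        by (simp add: matrix_vector_mul_assoc M_uminus)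
      then show ?thesis by (simp add: lorentz_form_def axis_def mult_vec_4)
    qed
    moreover have "M m' n' $ 4 $ 4 \<le> norm (M m' n')"
      using component_le_norm_cart[of "M m' n' $ 4" 4] Finite_Cartesian_Product.norm_nth_le[of "M m' n'" 4] by simp
    moreover have "norm (M m' n') \<le> \<bar>K\<bar>" using K[of y] that(3) y by simp
    ultimately have "1 + M (- m') (- n') $ 4 $ 4 \<le> 1 + \<bar>K\<bar>" by simp
    then have "16 * (1 + M (- m') (- n') $ 4 $ 4) \<le> 16 * (1 + \<bar>K\<bar>)" by simp
    with SO31_plus_norm_le[OF SO] have n: "norm (M (- m') (- n')) \<le> 16 * (1 + \<bar>K\<bar>)"
      by (rule order_trans)
    have "M (m - m') (n - n') - id4 = M (- m') (- n') ** (M m n - M m' n')"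
      using mult[of "- m'" m "- n'" n] M_uminus(2)[of m' n'] by (simp add: matmult.diff_right)
    then have "norm (M (m - m') (n - n') - id4) \<le> norm (M (- m') (- n')) * norm (M m n - M m' n') * C"
      by (simp only: C(2))
    also have "\<dots> \<le> (16 * (1 + \<bar>K\<bar>)) * norm (M m n - M m' n') * C"
      using n C(1) by (intro mult_right_mono) auto
    also have "\<dots> < \<epsilon>"
      using that(1) C(1) by (simp add: x y pos_less_divide_eq mult_ac)
    finally have "m - m' = 0 \<and> n - n' = 0" by (rule \<epsilon>(2))
    then show "x = y" using x y by simp
  qed
  have "inj_on ?f S"
    by (rule inj_onI, rule inj) (use \<epsilon>(1) C(1) in auto)
  then have "infinite (?f ` S)" using S by (simp add: finite_image_iff)
  then obtain l where l: "l islimpt ?f ` S"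
    using bounded_infinite_imp_islimpt[of "?f ` S" "?f ` S"] \<open>bounded (?f ` S)\<close> by blast
  \<comment> \<open>Half of the separation forced by \<open>inj\<close>, so that two points of the
    ball around the limit point are already too close.\<close>
  define \<delta> where "\<delta> = \<epsilon> / (16 * (1 + \<bar>K\<bar>) * C) / 2"
  have "\<delta> > 0" using \<epsilon>(1) C(1) by (simp add: \<delta>_def)
  then have inf: "infinite (?f ` S \<inter> ball l \<delta>)" using l by (simp add: islimpt_eq_infinite_ball)
  then obtain A where A: "A \<in> ?f ` S \<inter> ball l \<delta>" using infinite_imp_nonempty by blast
  have "infinite (?f ` S \<inter> ball l \<delta> - {A})" using inf by simp
  then obtain B where B: "B \<in> ?f ` S \<inter> ball l \<delta>" "B \<noteq> A" using infinite_imp_nonempty by blast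
  obtain x y where xy: "x \<in> S" "y \<in> S" "A = ?f x" "B = ?f y" using A B by blast
  have "dist A B < 2 * \<delta>"
    using A B dist_triangle_half_r[of l A "2 * \<delta>" B] by (simp add: dist_commute)
  then have "norm (?f x - ?f y) < \<epsilon> / (16 * (1 + \<bar>K\<bar>) * C)"
    unfolding xy(3,4) \<delta>_def by (simp add: dist_norm)
  then show False using inj xy B(2) by blast
qed


text \<open>The eigenvalue is 1, as its square is 1 and the future is preserved. All powers of the
  element then fix a timelike vector, so they form a bounded family, which is infinite unless the
  element is trivial.\<close>

lemma no_timelike_eigenvector:
  assumes y: "M m n *v y = \<mu> *\<^sub>R y" "lorentz_form y y < 0" shows "m = 0 \<and> n = 0"
proof (rule ccontr)
  assume mn: "\<not> (m = 0 \<and> n = 0)"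
  have "y $ 4 \<noteq> 0"
    using lorentz_form_spacelike[of y] y(2) by fastforce
  \<comment> \<open>The sign that turns \<open>y\<close> into a future vector.\<close>
  define \<epsilon> :: real where "\<epsilon> = (if y $ 4 > 0 then 1 else - 1)"
  define z where "z = \<epsilon> *\<^sub>R y"
  have "\<epsilon> * \<epsilon> = 1" by (simp add: \<epsilon>_def)
  moreover have "lorentz_form z z = (\<epsilon> * \<epsilon>) * lorentz_form y y" by (simp add: z_def)
  ultimately have "lorentz_form z z = lorentz_form y y" by (simp only: mult_1)
  with y(2) have "lorentz_form z z < 0" by simp
  moreover have "M m n *v z = \<mu> *\<^sub>R z"
    using y(1) by (simp add: z_def matrix_vector_mult_scaleR mult.commute)
  ultimately have z: "M m n *v z = \<mu> *\<^sub>R z" "lorentz_form z z < 0" by auto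
  have z4: "z $ 4 > 0" using \<open>y $ 4 \<noteq> 0\<close> by (auto simp: z_def \<epsilon>_def)
  note z = z z4
  have "(M m n *v z) $ 4 > 0" by (rule SO31_plus_future[OF SO]) (use z in auto)
  then have "\<mu> > 0" using z by (simp add: zero_less_mult_iff)
  have "lorentz_form (M m n *v z) (M m n *v z) = lorentz_form z z" by (rule O31_D[OF O31])
  then have "\<mu> * \<mu> = 1" using z by simp
  then have "\<mu> = 1" using \<open>\<mu> > 0\<close> by (auto simp: square_eq_1_iff)
  have z_fixed: "M (int k * m) (int k * n) *v z = z" for k
  proof (induction k)
    case (Suc k)
    have "M (int (Suc k) * m) (int (Suc k) * n) = M m n ** M (int k * m) (int k * n)"
      by (simp add: distrib_right mult)
    then show ?case using Suc z(1) \<open>\<mu> = 1\<close> by (simp flip: matrix_vector_mul_assoc)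
  qed (simp add: M_0)
  define S where "S = range (\<lambda>k. (int k * m, int k * n))"
  have "inj (\<lambda>k. (int k * m, int k * n))" using mn by (auto intro: injI)
  then have "infinite S" unfolding S_def by (simp add: finite_image_iff)
  moreover have "(\<lambda>(m, n). M m n) ` S \<subseteq> {A \<in> SO31_plus. norm (A *v z) \<le> norm z}"
    using SO z_fixed by (auto simp: S_def)
  then have "bounded ((\<lambda>(m, n). M m n) ` S)"
    using SO31_plus_bounded[OF z(2,3)] bounded_subset by blast
  ultimately show False using infinite_unbounded by blast
qed

text \<open>Fixed points on the sphere at infinity, each represented by the null vector of height 1
  on its ray.\<close>

definition fixed_null :: "int \<Rightarrow> int \<Rightarrow> (real^4) set" where
  "fixed_null m n = {y. y $ 4 = 1 \<and> lorentz_form y y = 0 \<and> (\<exists>\<mu>>0. M m n *v y = \<mu> *\<^sub>R y)}"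

lemma fixed_null_nonempty:
  assumes "\<not> (m = 0 \<and> n = 0)" shows "fixed_null m n \<noteq> {}"
proof -
  obtain y \<mu> where y: "y $ 4 = 1" "lorentz_form y y \<le> 0" "\<mu> > 0" "M m n *v y = \<mu> *\<^sub>R y"
    using SO31_plus_causal_eigenvector[OF SO] .
  have "\<not> lorentz_form y y < 0" using no_timelike_eigenvector[OF y(4)] assms by blast
  then have "y \<in> fixed_null m n" using y by (auto simp: fixed_null_def)
  then show ?thesis by blast
qed

text \<open>Distinct null vectors of height 1 pair negatively, so their eigenvalues multiply to 1.
  Three such vectors would force all eigenvalues to be 1, and the sum of two of them would be a
  fixed timelike vector.\<close>

lemma fixed_null_le_two:
  assumes mn: "\<not> (m = 0 \<and> n = 0)" and y: "y1 \<in> fixed_null m n" "y2 \<in> fixed_null m n" "y1 \<noteq> y2"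
    and z: "z \<in> fixed_null m n"
  shows "z = y1 \<or> z = y2"
proof (rule ccontr)
  assume nz: "\<not> (z = y1 \<or> z = y2)"
  obtain \<mu>1 where 1: "\<mu>1 > 0" "M m n *v y1 = \<mu>1 *\<^sub>R y1" using y by (auto simp: fixed_null_def)
  obtain \<mu>2 where 2: "\<mu>2 > 0" "M m n *v y2 = \<mu>2 *\<^sub>R y2" using y by (auto simp: fixed_null_def)
  obtain \<mu>3 where 3: "\<mu>3 > 0" "M m n *v z = \<mu>3 *\<^sub>R z" using z by (auto simp: fixed_null_def)
  have prod: "\<mu> * \<nu> = 1" if "M m n *v u = \<mu> *\<^sub>R u" "M m n *v w = \<nu> *\<^sub>R w"
    "u \<in> fixed_null m n" "w \<in> fixed_null m n" "u \<noteq> w" for u w \<mu> \<nu>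
  proof -
    have "lorentz_form u w < 0"
      by (rule lorentz_form_causal_neg) (use that in \<open>auto simp: fixed_null_def\<close>)
    moreover have "lorentz_form (M m n *v u) (M m n *v w) = lorentz_form u w" by (rule O31_D[OF O31])
    ultimately show ?thesis by (simp add: that(1,2) mult.commute)
  qed
  have p: "\<mu>1 * \<mu>2 = 1" "\<mu>1 * \<mu>3 = 1" "\<mu>2 * \<mu>3 = 1"
    using prod[OF 1(2) 2(2)] prod[OF 1(2) 3(2)] prod[OF 2(2) 3(2)] y z nz by auto
  then have "\<mu>1 * \<mu>2 = \<mu>1 * \<mu>3" by simp
  then have "\<mu>2 = \<mu>3" using 1 by simp
  then have "\<mu>2 = 1" using p(3) 2(1) by (auto simp: square_eq_1_iff)
  then have "\<mu>1 = 1" using p(1) by simp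
  have "lorentz_form y1 y2 < 0"
    by (rule lorentz_form_causal_neg) (use y in \<open>auto simp: fixed_null_def\<close>)
  then have "lorentz_form (y1 + y2) (y1 + y2) < 0"
    using y lorentz_form_commute[of y1 y2] by (simp add: fixed_null_def)
  moreover have "M m n *v (y1 + y2) = 1 *\<^sub>R (y1 + y2)"
    using 1 2 \<open>\<mu>1 = 1\<close> \<open>\<mu>2 = 1\<close> by (simp add: matrix_vector_right_distrib)
  ultimately show False using no_timelike_eigenvector mn by blast
qed

text \<open>Elements of the group commute, hence permute the fixed points of each other up to
  rescaling to height 1.\<close>

lemma fixed_null_invariant:
  assumes y: "y \<in> fixed_null m n"
  obtains \<alpha> y' where "\<alpha> > 0" "y' \<in> fixed_null m n" "M m' n' *v y = \<alpha> *\<^sub>R y'"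
proof -
  obtain \<mu> where \<mu>: "\<mu> > 0" "M m n *v y = \<mu> *\<^sub>R y" using y by (auto simp: fixed_null_def)
  define \<alpha> where "\<alpha> = (M m' n' *v y) $ 4"
  have \<alpha>: "\<alpha> > 0" unfolding \<alpha>_def
    by (rule SO31_plus_future[OF SO]) (use y in \<open>auto simp: fixed_null_def\<close>)
  define y' where "y' = (1 / \<alpha>) *\<^sub>R (M m' n' *v y)"
  have My: "M m' n' *v y = \<alpha> *\<^sub>R y'" using \<alpha> by (simp add: y'_def)
  have "M m n *v y' = \<mu> *\<^sub>R y'"
    by (simp add: y'_def matrix_vector_mult_scaleR M_commute[of m n m' n'] \<mu>(2))
  moreover have "lorentz_form y' y' = 0"
    using y by (simp add: y'_def O31_D[OF O31] fixed_null_def)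
  moreover have "y' $ 4 = 1" using \<alpha> by (simp add: y'_def \<alpha>_def)
  ultimately show ?thesis using that[of \<alpha> y'] \<mu>(1) \<alpha> My by (auto simp: fixed_null_def)
qed

text \<open>The alternative is that the two fixed points are exchanged. Then the element reverses
  the axis between them and fixes a point on it, that is, it has a timelike eigenvector, so it is
  trivial and exchanges nothing.\<close>

lemma fixed_null_two_preserved:
  assumes mn: "\<not> (m = 0 \<and> n = 0)" and y: "y1 \<in> fixed_null m n" "y2 \<in> fixed_null m n" "y1 \<noteq> y2"
  obtains \<alpha> where "\<alpha> > 0" "M m' n' *v y1 = \<alpha> *\<^sub>R y1"
proof -
  obtain \<alpha> y' where \<alpha>: "\<alpha> > 0" "y' \<in> fixed_null m n" "M m' n' *v y1 = \<alpha> *\<^sub>R y'"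
    using fixed_null_invariant[OF y(1)] .
  obtain \<beta> y'' where \<beta>: "\<beta> > 0" "y'' \<in> fixed_null m n" "M m' n' *v y2 = \<beta> *\<^sub>R y''"
    using fixed_null_invariant[OF y(2)] .
  have neg: "lorentz_form y1 y2 < 0"
    by (rule lorentz_form_causal_neg) (use y in \<open>auto simp: fixed_null_def\<close>)
  have "lorentz_form (M m' n' *v y1) (M m' n' *v y2) = lorentz_form y1 y2" by (rule O31_D[OF O31])
  then have "lorentz_form y' y'' \<noteq> 0" using neg by (auto simp: \<alpha>(3) \<beta>(3))
  then have ne: "y' \<noteq> y''" using \<alpha>(2) by (auto simp: fixed_null_def)
  show ?thesis
  proof (cases "y' = y1")
    case True
    then show ?thesis using that \<alpha> by blast
  next
    case False
    then have "y' = y2" using fixed_null_le_two[OF mn y \<alpha>(2)] by blast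
    moreover then have "y'' = y1" using fixed_null_le_two[OF mn y \<beta>(2)] ne by blast
    ultimately have s: "M m' n' *v y1 = \<alpha> *\<^sub>R y2" "M m' n' *v y2 = \<beta> *\<^sub>R y1" using \<alpha> \<beta> by auto
    \<comment> \<open>The weights balance the two scalings, so that \<open>z\<close> becomes an
      eigenvector for the geometric mean of \<alpha> and \<beta>.\<close>
    define z where "z = sqrt \<beta> *\<^sub>R y1 + sqrt \<alpha> *\<^sub>R y2"
    have ab: "sqrt \<beta> * \<alpha> = sqrt (\<alpha> * \<beta>) * sqrt \<alpha>" "sqrt \<alpha> * \<beta> = sqrt (\<alpha> * \<beta>) * sqrt \<beta>"
      using \<alpha>(1) \<beta>(1) by (simp_all add: real_sqrt_mult)
    have "M m' n' *v z = (sqrt \<beta> * \<alpha>) *\<^sub>R y2 + (sqrt \<alpha> * \<beta>) *\<^sub>R y1"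
      by (simp add: z_def matrix_vector_right_distrib matrix_vector_mult_scaleR s)
    then have "M m' n' *v z = sqrt (\<alpha> * \<beta>) *\<^sub>R z"
      unfolding ab by (simp add: z_def scaleR_right_distrib)
    moreover have "lorentz_form z z = 2 * (sqrt \<alpha> * (sqrt \<beta> * lorentz_form y1 y2))"
      using y lorentz_form_commute[of y1 y2] by (simp add: z_def fixed_null_def)
    then have "lorentz_form z z < 0" using neg \<alpha>(1) \<beta>(1) by (simp add: mult_pos_neg)
    ultimately have "m' = 0 \<and> n' = 0" using no_timelike_eigenvector by blast
    then have "y1 = \<alpha> *\<^sub>R y2" using s(1) by (simp add: M_0)
    then have "y1 $ 4 = \<alpha> * y2 $ 4" by simp
    then have "\<alpha> = 1" using y by (simp add: fixed_null_def)
    then show ?thesis using \<open>y1 = \<alpha> *\<^sub>R y2\<close> y(3) by simp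
  qed
qed

lemma fixed_null_unique:
  assumes mn: "\<not> (m = 0 \<and> n = 0)" and y: "y1 \<in> fixed_null m n" "y2 \<in> fixed_null m n"
  shows "y1 = y2"
proof (rule ccontr)
  assume ne: "y1 \<noteq> y2"
  have neg: "lorentz_form y1 y2 < 0"
    by (rule lorentz_form_causal_neg) (use y ne in \<open>auto simp: fixed_null_def\<close>)
  have y4: "y1 $ 4 = 1" "y2 $ 4 = 1" using y by (auto simp: fixed_null_def)
  define \<alpha> where "\<alpha> i j = (M i j *v y1) $ 4" for i j
  have \<alpha>: "\<alpha> i j > 0" "M i j *v y1 = \<alpha> i j *\<^sub>R y1" for i j
    by (rule fixed_null_two_preserved[OF mn y ne, of i j], use y4 in \<open>simp add: \<alpha>_def\<close>)+
  have \<beta>: "M i j *v y2 = (1 / \<alpha> i j) *\<^sub>R y2" for i j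
  proof -
    obtain b where b: "b > 0" "M i j *v y2 = b *\<^sub>R y2"
      by (rule fixed_null_two_preserved[OF mn y(2,1) ne[symmetric]])
    have "lorentz_form (M i j *v y1) (M i j *v y2) = lorentz_form y1 y2" by (rule O31_D[OF O31])
    then have "\<alpha> i j * b = 1" using neg by (simp add: \<alpha>(2) b(2) mult.commute)
    then show ?thesis using b(2) \<alpha>(1)[of i j] by (simp add: field_simps)
  qed
  define f where "f i j = ln (\<alpha> i j)" for i j
  have "f (i + i') (j + j') = f i j + f i' j'" for i i' j j'
  proof -
    have "M (i + i') (j + j') *v y1 = M i j *v (M i' j' *v y1)"
      by (simp add: mult matrix_vector_mul_assoc)
    then have "\<alpha> (i + i') (j + j') *\<^sub>R y1 = (\<alpha> i j * \<alpha> i' j') *\<^sub>R y1"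
      by (simp add: \<alpha>(2) matrix_vector_mult_scaleR mult.commute)
    moreover have "y1 \<noteq> 0" using y4 by auto
    ultimately have "\<alpha> (i + i') (j + j') = \<alpha> i j * \<alpha> i' j'" by simp
    then show ?thesis using \<alpha>(1)[of i j] \<alpha>(1)[of i' j'] by (simp add: f_def ln_mult)
  qed
  then obtain K where K: "infinite {(i, j). \<bar>f i j\<bar> \<le> K}"
    using additive_infinite_bounded by blast
  let ?z = "y1 + y2"
  have z: "lorentz_form ?z ?z < 0" "?z $ 4 > 0"
    using y y4 neg lorentz_form_commute[of y1 y2] by (auto simp: fixed_null_def)
  have "norm (M i j *v ?z) \<le> exp K * norm y1 + exp K * norm y2" if "\<bar>f i j\<bar> \<le> K" for i j
  proof -
    have l: "ln (\<alpha> i j) \<le> K" "- ln (\<alpha> i j) \<le> K" using that by (auto simp: f_def)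
    have "\<alpha> i j = exp (ln (\<alpha> i j))" using \<alpha>(1)[of i j] by simp
    also have "\<dots> \<le> exp K" using l by simp
    finally have 1: "\<alpha> i j \<le> exp K" .
    have "1 / \<alpha> i j = exp (- ln (\<alpha> i j))" using \<alpha>(1)[of i j] by (simp add: exp_minus field_simps)
    also have "\<dots> \<le> exp K" using l by simp
    finally have 2: "1 / \<alpha> i j \<le> exp K" .
    have "norm (M i j *v ?z) \<le> norm (\<alpha> i j *\<^sub>R y1) + norm ((1 / \<alpha> i j) *\<^sub>R y2)"
      unfolding matrix_vector_right_distrib \<alpha>(2) \<beta> by (rule norm_triangle_ineq)
    also have "norm (\<alpha> i j *\<^sub>R y1) \<le> exp K * norm y1"
      using 1 \<alpha>(1)[of i j] by (simp add: mult_right_mono)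
    also have "norm ((1 / \<alpha> i j) *\<^sub>R y2) \<le> exp K * norm y2"
    proof -
      have "norm ((1 / \<alpha> i j) *\<^sub>R y2) = (1 / \<alpha> i j) * norm y2" using \<alpha>(1)[of i j] by simp
      also have "\<dots> \<le> exp K * norm y2" using 2 by (rule mult_right_mono) simp
      finally show ?thesis .
    qed
    finally show ?thesis by simp
  qed
  then have "(\<lambda>(i, j). M i j) ` {(i, j). \<bar>f i j\<bar> \<le> K}
      \<subseteq> {A \<in> SO31_plus. norm (A *v ?z) \<le> exp K * norm y1 + exp K * norm y2}"
    using SO by auto
  then have "bounded ((\<lambda>(i, j). M i j) ` {(i, j). \<bar>f i j\<bar> \<le> K})"
    using SO31_plus_bounded[OF z] bounded_subset by blast
  then show False using infinite_unbounded[OF K] by blast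
qed

text \<open>The unique fixed null vector of \<open>M 1 0\<close> is an eigenvector of every element
  by commutation. An eigenvalue \<alpha> other than 1 would come with an eigenvector for
  \<open>1 / \<alpha>\<close>, which is null because its eigenvalue is not a sign, and this would be
  a second fixed point.\<close>

lemma common_fixed_null: "\<exists>v. v $ 4 = 1 \<and> lorentz_form v v = 0 \<and> (\<forall>m n. M m n *v v = v)"
proof -
  obtain v where v: "v \<in> fixed_null 1 0" using fixed_null_nonempty[of 1 0] by auto
  then have v': "v $ 4 = 1" "lorentz_form v v = 0" by (auto simp: fixed_null_def)
  have "M m n *v v = v" for m n
  proof -
    obtain \<alpha> y' where \<alpha>: "\<alpha> > 0" "y' \<in> fixed_null 1 0" "M m n *v v = \<alpha> *\<^sub>R y'"
      using fixed_null_invariant[OF v] .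
    have "y' = v" using fixed_null_unique[OF _ \<alpha>(2) v] by simp
    with \<alpha> have Mv: "M m n *v v = \<alpha> *\<^sub>R v" by simp
    have "\<alpha> = 1"
    proof (rule ccontr)
      assume "\<alpha> \<noteq> 1"
      have "v \<noteq> 0" using v' by auto
      obtain w where w: "w \<noteq> 0" "M m n *v w = (1 / \<alpha>) *\<^sub>R w"
        by (rule O31_inverse_eigenvalue[OF O31 Mv \<open>v \<noteq> 0\<close>]) (use \<alpha>(1) in simp)
      have "lorentz_form (M m n *v w) (M m n *v w) = lorentz_form w w" by (rule O31_D[OF O31])
      then have "(1 / \<alpha> * (1 / \<alpha>)) * lorentz_form w w = 1 * lorentz_form w w"
        by (simp only: w(2) lorentz_form_scale mult.assoc mult_1)
      moreover have "\<alpha> * \<alpha> \<noteq> 1" using \<alpha>(1) \<open>\<alpha> \<noteq> 1\<close> by (auto simp: square_eq_1_iff)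
      moreover from this have "1 / \<alpha> * (1 / \<alpha>) \<noteq> 1" by simp
      ultimately have ww: "lorentz_form w w = 0" unfolding mult_cancel_right by blast
      then have "w $ 4 \<noteq> 0" using lorentz_form_spacelike[OF _ w(1)] by fastforce
      define u where "u = (1 / w $ 4) *\<^sub>R w"
      have u: "u $ 4 = 1" "lorentz_form u u = 0" "M m n *v u = (1 / \<alpha>) *\<^sub>R u"
        using \<open>w $ 4 \<noteq> 0\<close> by (simp_all add: u_def ww matrix_vector_mult_scaleR w(2))
      have "u \<in> fixed_null m n" using u \<alpha>(1) by (auto simp: fixed_null_def intro!: exI[of _ "1 / \<alpha>"])
      moreover have "v \<in> fixed_null m n" using v' Mv \<alpha>(1) by (auto simp: fixed_null_def)
      moreover have "\<not> (m = 0 \<and> n = 0)"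
      proof
        assume "m = 0 \<and> n = 0"
        then have "M m n = id4" by (simp add: M_0)
        then have "1 *\<^sub>R v = \<alpha> *\<^sub>R v" using Mv by (simp only: matrix_vector_mul_lid scaleR_one)
        then show False using \<open>v \<noteq> 0\<close> \<open>\<alpha> \<noteq> 1\<close> unfolding scaleR_cancel_right by blast
      qed
      ultimately have "u = v" using fixed_null_unique by blast
      then have "(1 / \<alpha>) *\<^sub>R v = \<alpha> *\<^sub>R v" by (simp only: u(3)[unfolded \<open>u = v\<close>, symmetric] Mv)
      then have "1 / \<alpha> = \<alpha>" using \<open>v \<noteq> 0\<close> unfolding scaleR_cancel_right by blast
      then have "\<alpha> * \<alpha> = 1" using \<alpha>(1) by (simp add: field_simps)
      then show False using \<open>\<alpha> * \<alpha> \<noteq> 1\<close> by simp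
    qed
    then show ?thesis using Mv by simp
  qed
  then show ?thesis using v' by blast
qed

lemma parabolic_translations:
  obtains v p where "v $ 4 = 1" "lorentz_form v v = 0"
    "\<And>m n. lorentz_form (p m n) v = 0" "\<And>m n y. M m n *v y = parabolic v (p m n) y"
proof -
  obtain v where v: "v $ 4 = 1" "lorentz_form v v = 0" and "\<forall>m n. M m n *v v = v"
    using common_fixed_null by blast
  then have Mv: "M m n *v v = v" for m n by blast
  have "\<exists>p. lorentz_form p v = 0 \<and> (\<forall>y. M m n *v y = parabolic v p y)" for m n
  proof (cases "m = 0 \<and> n = 0")
    case True
    then show ?thesis by (intro exI[of _ 0]) (simp add: M_0 parabolic_def)
  next
    case False
    show ?thesis
    proof (rule O31_parabolic[OF O31 SO31_plus_D(2)[OF SO] Mv v(1,2)])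
      fix y assume "M m n *v y = y"
      then show "0 \<le> lorentz_form y y"
        using no_timelike_eigenvector[of m n y 1] False by force
    qed
  qed
  note ex = this
  define p where "p m n = (SOME p. lorentz_form p v = 0 \<and> (\<forall>y. M m n *v y = parabolic v p y))" for m n
  have p: "lorentz_form (p m n) v = 0 \<and> (\<forall>y. M m n *v y = parabolic v (p m n) y)" for m n
    unfolding p_def by (rule someI_ex) (rule ex)
  show ?thesis
    by (rule that[OF v(1,2), of p]) (use p in blast)+
qed

end

section \<open>The Euclidean plane of a null vector: its orthogonal space modulo itself\<close>

text \<open>Subtracting the multiple of \<open>v\<close> that brings \<open>q\<close> to height 0
  does not change its Lorentz square, and at height 0 the form is positive definite.\<close>

lemma null_orthogonal:
  assumes v: "v $ 4 = 1" "lorentz_form v v = 0" and q: "lorentz_form q v = 0"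
  shows "lorentz_form q q \<ge> 0" and "lorentz_form q q = 0 \<Longrightarrow> q = q $ 4 *\<^sub>R v"
proof -
  define r where "r = q - q $ 4 *\<^sub>R v"
  have r4: "r $ 4 = 0" using v by (simp add: r_def)
  have rr: "lorentz_form r r = lorentz_form q q"
    using v q lorentz_form_commute[of v q] by (simp add: r_def)
  show "lorentz_form q q \<ge> 0"
  proof (cases "r = 0")
    case True
    then show ?thesis using rr by simp
  next
    case False
    then show ?thesis using lorentz_form_spacelike[OF r4 False] rr by simp
  qed
  assume "lorentz_form q q = 0"
  then have "r = 0" using lorentz_form_spacelike[OF r4] rr by fastforce
  then show "q = q $ 4 *\<^sub>R v" by (simp add: r_def)
qed

text \<open>Modulo \<open>v\<close> the vectors orthogonal to \<open>v\<close> form a Euclidean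
  plane. There \<open>a\<close> and \<open>b\<close> are an orthogonal basis, so \<open>q\<close>
  vanishes modulo \<open>v\<close>.\<close>

lemma null_orthogonal_three:
  assumes v: "v $ 4 = 1" "lorentz_form v v = 0"
    and perp: "lorentz_form a v = 0" "lorentz_form b v = 0" "lorentz_form q v = 0"
    and orth: "lorentz_form a b = 0" "lorentz_form q a = 0" "lorentz_form q b = 0"
    and pos: "lorentz_form a a > 0" "lorentz_form b b > 0"
  shows "q = q $ 4 *\<^sub>R v"
proof -
  obtain P where P: "P \<in> O31" "P ** P = id4" "P *v null0 = v"
    using O31_involution_null0[OF v] .
  define f where "f x = P *v x" for x
  have f: "lorentz_form (f x) (f y) = lorentz_form x y" for x y
    unfolding f_def by (rule O31_D[OF P(1)])
  have "f v = null0" unfolding f_def P(3)[symmetric] by (simp add: matrix_vector_mul_assoc P(2))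
  then have e: "f x $ 3 = f x $ 4" if "lorentz_form x v = 0" for x
    using f[of x v] that by (simp add: lorentz_form_null0)
  have l: "lorentz_form x y = f x $ 1 * f y $ 1 + f x $ 2 * f y $ 2"
    if "lorentz_form x v = 0" "lorentz_form y v = 0" for x y
    unfolding f[of x y, symmetric] using e[OF that(1)] e[OF that(2)] by (simp add: lorentz_form_def)
  define a1 a2 b1 b2 q1 q2 where "a1 = f a $ 1" and "a2 = f a $ 2" and "b1 = f b $ 1" and "b2 = f b $ 2"
    and "q1 = f q $ 1" and "q2 = f q $ 2"
  have ab: "a1 * b1 + a2 * b2 = 0" and qa: "q1 * a1 + q2 * a2 = 0" and qb: "q1 * b1 + q2 * b2 = 0"
    and aa: "a1 * a1 + a2 * a2 > 0" and bb: "b1 * b1 + b2 * b2 > 0"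
    using l perp orth pos by (simp_all add: a1_def a2_def b1_def b2_def q1_def q2_def)
  have "(a1 * b2 - a2 * b1)\<^sup>2 = (a1 * a1 + a2 * a2) * (b1 * b1 + b2 * b2) - (a1 * b1 + a2 * b2)\<^sup>2"
    by (simp add: power2_eq_square algebra_simps)
  then have D: "a1 * b2 - a2 * b1 \<noteq> 0" using ab aa bb by auto
  have "q1 * (a1 * b2 - a2 * b1) = b2 * (q1 * a1 + q2 * a2) - a2 * (q1 * b1 + q2 * b2)"
    by (simp add: algebra_simps)
  then have "q1 = 0" using D by (simp add: qa qb)
  have "q2 * (a1 * b2 - a2 * b1) = a1 * (q1 * b1 + q2 * b2) - b1 * (q1 * a1 + q2 * a2)"
    by (simp add: algebra_simps)
  then have "q2 = 0" using D by (simp add: qa qb)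
  have "lorentz_form q q = 0"
    using l[OF perp(3) perp(3)] \<open>q1 = 0\<close> \<open>q2 = 0\<close> by (simp add: q1_def q2_def)
  then show ?thesis by (rule null_orthogonal(2)[OF v perp(3)])
qed

text \<open>After \<open>v\<close> is moved to \<open>null0\<close>, the vector \<open>u\<close> is
  the quarter turn of \<open>p\<close> in the plane of the first two coordinates.\<close>

lemma null_orthogonal_complement:
  assumes v: "v $ 4 = 1" "lorentz_form v v = 0" and p: "lorentz_form p v = 0" "lorentz_form p p \<noteq> 0"
  obtains u where "lorentz_form u v = 0" "lorentz_form u p = 0" "lorentz_form u u > 0"
proof -
  obtain P where P: "P \<in> O31" "P ** P = id4" "P *v null0 = v"
    using O31_involution_null0[OF v] .
  define q where "q = P *v p"
  have PP: "P *v (P *v y) = y" for y by (simp add: matrix_vector_mul_assoc P(2))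
  have "lorentz_form q null0 = 0"
    using O31_D[OF P(1), of q null0] p(1) by (simp add: q_def PP P(3))
  then have q34: "q $ 3 = q $ 4" by (simp add: lorentz_form_null0)
  have "lorentz_form q q \<noteq> 0" using p(2) by (simp add: q_def O31_D[OF P(1)])
  then have q: "q $ 1 * q $ 1 + q $ 2 * q $ 2 \<noteq> 0" using q34 by (simp add: lorentz_form_def)
  define w :: "real^4" where "w = (- q $ 2) *\<^sub>R axis 1 1 + q $ 1 *\<^sub>R axis 2 1"
  have w: "w $ 1 = - q $ 2" "w $ 2 = q $ 1" "w $ 3 = 0" "w $ 4 = 0" by (simp_all add: w_def axis_def)
  have "lorentz_form (P *v w) v = lorentz_form w null0" by (metis O31_D P(1,3))
  moreover have "lorentz_form (P *v w) p = lorentz_form w q"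
    using O31_D[OF P(1), of w q] by (simp add: q_def PP)
  moreover have "lorentz_form (P *v w) (P *v w) = lorentz_form w w" by (rule O31_D[OF P(1)])
  moreover have "lorentz_form w w > 0"
  proof -
    have "w \<noteq> 0" using w q by auto
    then show ?thesis using w by (intro lorentz_form_spacelike) auto
  qed
  ultimately show ?thesis
    using that[of "P *v w"] w by (simp add: lorentz_form_null0 lorentz_form_def[of w q])
qed

lemma parabolic_scale:
  "parabolic (\<kappa> *\<^sub>R v) p y = parabolic v (\<kappa> *\<^sub>R p) y"
  by (simp add: parabolic_def algebra_simps)

lemma parabolic_add_null:
  assumes "lorentz_form v v = 0" "lorentz_form p v = 0"
  shows "parabolic v (p + \<kappa> *\<^sub>R v) y = parabolic v p y"
  using assms lorentz_form_commute[of v p] by (simp add: parabolic_def algebra_simps)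

lemma parabolic_inj:
  assumes v: "v $ 4 = 1" and eq: "\<And>y. parabolic v p y = parabolic v q y"
  obtains \<kappa> where "p = q + \<kappa> *\<^sub>R v"
proof -
  let ?e = "axis 4 1 :: real^4"
  have e: "lorentz_form ?e v = - 1" using v by (simp add: lorentz_form_def axis_def)
  have "p = q + ((lorentz_form p p / 2 - lorentz_form ?e p) - (lorentz_form q q / 2 - lorentz_form ?e q)) *\<^sub>R v"
    using eq[of ?e] by (simp add: parabolic_def e algebra_simps)
  then show ?thesis by (rule that)
qed

section \<open>Unipotence of parabolic maps and of conjugation by them\<close>

text \<open>This is the square of the parabolic map minus the identity. Its values lie on the line
  of \<open>v\<close>, which gives nilpotence, and forces any matrix that commutes with the map to
  preserve that line when \<open>p\<close> is not null.\<close>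

lemma parabolic_second_difference:
  assumes "lorentz_form v v = 0" "lorentz_form p v = 0"
  shows "parabolic v p (parabolic v p y) - 2 *\<^sub>R parabolic v p y + y = (- (lorentz_form p p * lorentz_form y v)) *\<^sub>R v"
proof -
  let ?z = "parabolic v p y" and ?c = "lorentz_form p p * lorentz_form y v"
  have 1: "lorentz_form ?z v = lorentz_form y v"
    using assms by (simp add: parabolic_def)
  have 2: "lorentz_form ?z p = lorentz_form y p + ?c"
    using assms lorentz_form_commute[of v p] by (simp add: parabolic_def)
  have 3: "parabolic v p ?z - ?z = lorentz_form y v *\<^sub>R p - (lorentz_form y p + ?c) *\<^sub>R v - (?c / 2) *\<^sub>R v"
    unfolding parabolic_def[of v p ?z] 1 2 by simp
  have 4: "?z - y = lorentz_form y v *\<^sub>R p - lorentz_form y p *\<^sub>R v - (?c / 2) *\<^sub>R v"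
    by (simp add: parabolic_def)
  have "parabolic v p ?z - 2 *\<^sub>R ?z + y = (parabolic v p ?z - ?z) - (?z - y)"
    by (simp add: scaleR_2)
  also have "\<dots> = (- ?c) *\<^sub>R v"
    unfolding 3 4 by (simp add: algebra_simps)
  finally show ?thesis .
qed

lemma parabolic_nilpotent:
  assumes v: "lorentz_form v v = 0" "lorentz_form p v = 0" and A: "\<And>y. A *v y = parabolic v p y"
  shows "(A - id4) ** ((A - id4) ** (A - id4)) = 0"
proof -
  let ?N = "A - id4"
  have "?N *v (?N *v y) = (- (lorentz_form p p * lorentz_form y v)) *\<^sub>R v" for y
    using parabolic_second_difference[OF v, of y]
    by (simp add: matrix_vector_mult_diff_rdistrib matrix_vector_mult_diff_distrib A scaleR_2 algebra_simps)
  moreover have "?N *v v = 0"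
    using v lorentz_form_commute[of v p]
    by (simp add: matrix_vector_mult_diff_rdistrib A parabolic_def)
  ultimately have "?N *v (?N *v (?N *v y)) = 0" for y
    by (simp only: matrix_vector_mult_scaleR scaleR_zero_right)
  then show ?thesis
    by (simp add: matrix_eq flip: matrix_vector_mul_assoc)
qed

text \<open>With \<open>A = 1 + n\<close> and \<open>B = 1 + m\<close> the operator is \<open>l + r + l r\<close> for the commuting
  multiplications \<open>l\<close> by \<open>n\<close> and \<open>r\<close> by \<open>m\<close>, and \<open>l\<^sup>i r\<^sup>j = 0\<close> for \<open>i + j \<ge> 5\<close>.\<close>

lemma conjugation_nilpotent:
  fixes A B :: "real^4^4"
  assumes n: "(A - id4) ** ((A - id4) ** (A - id4)) = 0" and m: "(B - id4) ** ((B - id4) ** (B - id4)) = 0"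
  shows "((\<lambda>Y. A ** Y ** B - Y) ^^ 5) Y = 0"
proof -
  define n m where "n = A - id4" and "m = B - id4"
  define T where "T i j Y = ((\<lambda>Y. n ** Y) ^^ i) (((\<lambda>Y. Y ** m) ^^ j) Y)" for i j Y
  define D where "D Y = A ** Y ** B - Y" for Y
  have "A = id4 + n" "B = id4 + m" by (simp_all add: n_def m_def)
  then have D: "D Y = n ** Y + Y ** m + (n ** Y) ** m" for Y
    by (simp add: D_def matmult.add_left matmult.add_right matrix_mul_assoc)
  have rl: "((\<lambda>Y. Y ** m) ^^ j) (n ** Y) = n ** ((\<lambda>Y. Y ** m) ^^ j) Y" for j Y
    by (induction j) (simp_all add: matrix_mul_assoc)
  have Tl: "T i j (n ** Y) = T (Suc i) j Y" for i j Y
    by (simp add: T_def rl funpow_swap1)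
  have Tr: "T i j (Y ** m) = T i (Suc j) Y" for i j Y
    by (simp add: T_def funpow_swap1[of "\<lambda>Y. Y ** m", symmetric])
  have radd: "((\<lambda>Y. Y ** m) ^^ j) (X + Y) = ((\<lambda>Y. Y ** m) ^^ j) X + ((\<lambda>Y. Y ** m) ^^ j) Y" for j and X Y :: "real^4^4"
    by (induction j) (simp_all add: matmult.add_left)
  have ladd: "((\<lambda>Y. n ** Y) ^^ j) (X + Y) = ((\<lambda>Y. n ** Y) ^^ j) X + ((\<lambda>Y. n ** Y) ^^ j) Y" for j and X Y :: "real^4^4"
    by (induction j) (simp_all add: matmult.add_right)
  have Tadd: "T i j (X + Y) = T i j X + T i j Y" for i j X Y
    by (simp add: T_def radd ladd)
  have TD: "T i j (D Y) = T (Suc i) j Y + T i (Suc j) Y + T (Suc i) (Suc j) Y" for i j Y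
    unfolding D Tadd Tl Tr ..
  have l0: "((\<lambda>Y. n ** Y) ^^ i) Y = 0" if "i \<ge> 3" for i Y
  proof -
    have "((\<lambda>Y. n ** Y) ^^ 3) Z = 0" for Z
      using n by (simp add: numeral_3_eq_3 matrix_mul_assoc n_def[symmetric])
    moreover have "i = 3 + (i - 3)" using that by simp
    ultimately show ?thesis by (metis funpow_add comp_apply)
  qed
  have r0: "((\<lambda>Y. Y ** m) ^^ j) Y = 0" if "j \<ge> 3" for j Y
  proof -
    have "((\<lambda>Y. Y ** m) ^^ 3) Z = 0" for Z
      using m by (simp add: numeral_3_eq_3 m_def[symmetric] flip: matrix_mul_assoc)
    moreover have "j = 3 + (j - 3)" using that by simp
    ultimately show ?thesis by (metis funpow_add comp_apply)
  qed
  have z: "((\<lambda>Y. n ** Y) ^^ i) 0 = 0" for i by (induction i) simp_all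
  have T0: "T i j Y = 0" if "i + j \<ge> 5" for i j Y
  proof (cases "i \<ge> 3")
    case True
    then show ?thesis by (simp add: T_def l0)
  next
    case False
    then have "j \<ge> 3" using that by simp
    then show ?thesis by (simp add: T_def r0 z)
  qed
  \<comment> \<open>Each application of \<open>D\<close> raises \<open>i + j\<close> by at least
    one, so five applications to any \<open>Y\<close> reach the range of \<open>T0\<close>.\<close>
  have TDk: "T i j ((D ^^ k) Y) = 0" if "i + j + k \<ge> 5" for i j k
    using that
  proof (induction k arbitrary: i j)
    case 0
    then show ?case by (simp add: T0)
  next
    case (Suc k)
    then show ?case by (simp add: TD)
  qed
  have "D = (\<lambda>Y. A ** Y ** B - Y)" by (simp add: fun_eq_iff D_def)
  then show ?thesis using TDk[of 0 0 5] by (simp add: T_def)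
qed

section \<open>The commutant of a parabolic and the centralizer of the holonomy group\<close>

text \<open>The rank one operator of \<open>x\<close> and of the covector of \<open>y\<close> for
  the Lorentz form. With the form in place of the Euclidean product, it commutes with every isometry
  that fixes both vectors.\<close>

definition tensor :: "real^4 \<Rightarrow> real^4 \<Rightarrow> real^4^4" where
  "tensor x y = matrix (\<lambda>z. lorentz_form z y *\<^sub>R x)"

lemma tensor_apply: "tensor x y *v z = lorentz_form z y *\<^sub>R x"
proof -
  have "linear (\<lambda>z. lorentz_form z y *\<^sub>R x)" by (rule linearI) (simp_all add: algebra_simps)
  then show ?thesis by (simp add: tensor_def matrix_works)
qed

lemma trace_tensor: "trace (tensor x y) = lorentz_form x y"
proof -
  have "tensor x y $ i $ i = (tensor x y *v axis i 1) $ i" for i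
    by (simp add: matrix_vector_mult_basis Finite_Cartesian_Product.column_def)
  then show ?thesis
    by (simp add: trace_def tensor_apply sum_4) (simp add: lorentz_form_def axis_def algebra_simps)
qed

lemma trace_scaleR: "trace (c *\<^sub>R A) = c * trace (A :: real^4^4)"
  by (simp add: trace_def sum_distrib_left)

lemma tensor_commute:
  assumes "A \<in> O31" "A *v x = x" "A *v y = y" shows "tensor x y ** A = A ** tensor x y"
proof -
  have "lorentz_form (A *v z) y = lorentz_form z y" for z
    using O31_D[OF assms(1), of z y] assms(3) by simp
  then show ?thesis
    by (simp add: matrix_eq tensor_apply matrix_vector_mult_scaleR assms(2) flip: matrix_vector_mul_assoc)
qed

context discrete_rank_two
begin

lemma conjugation_M_nilpotent: "((\<lambda>Y. M m n ** Y ** M (- m) (- n) - Y) ^^ 5) Y = 0"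
proof -
  obtain v p where "v $ 4 = 1" and v: "lorentz_form v v = 0"
    and p: "\<And>m n. lorentz_form (p m n) v = 0" and M: "\<And>m n y. M m n *v y = parabolic v (p m n) y"
    using parabolic_translations by metis
  have "(M m n - id4) ** ((M m n - id4) ** (M m n - id4)) = 0" for m n
    by (rule parabolic_nilpotent[OF v p M])
  then show ?thesis by (intro conjugation_nilpotent)
qed


lemma translation_spacelike:
  assumes v: "v $ 4 = 1" "lorentz_form v v = 0" and p: "\<And>m n. lorentz_form (p m n) v = 0"
    and M: "\<And>m n y. M m n *v y = parabolic v (p m n) y"
  shows "lorentz_form (p 1 0) (p 1 0) > 0"
proof (rule ccontr)
  assume "\<not> lorentz_form (p 1 0) (p 1 0) > 0"
  then have "lorentz_form (p 1 0) (p 1 0) = 0" using null_orthogonal(1)[OF v p, of 1 0] by simp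
  then obtain \<kappa> where "p 1 0 = \<kappa> *\<^sub>R v" using null_orthogonal(2)[OF v p] by blast
  then have "M 1 0 *v y = y" for y
    unfolding M by (simp add: parabolic_def v)
  then have "M 1 0 = id4" by (simp add: matrix_eq)
  then show False using M_eq_id by fastforce
qed

text \<open>Five explicit independent elements. The parabolic \<open>M 1 0\<close> commutes with its
  own nilpotent part and fixes both \<open>v\<close> and the spacelike vector \<open>u\<close>
  orthogonal to \<open>v\<close> and to the translation, hence commutes with the tensors of these
  two vectors; only that of \<open>u\<close> with itself needs a correction of its trace.\<close>

lemma dim_commutant: "dim {Y. trace Y = 0 \<and> Y ** M 1 0 = M 1 0 ** Y} \<ge> 5"
proof -
  obtain v p where v: "v $ 4 = 1" "lorentz_form v v = 0"
    and p: "\<And>m n. lorentz_form (p m n) v = 0" and M: "\<And>m n y. M m n *v y = parabolic v (p m n) y"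
    using parabolic_translations by metis
  define P where "P = p 1 0"
  have P: "lorentz_form P v = 0" "lorentz_form v P = 0" "lorentz_form P P > 0"
    using p translation_spacelike[OF v p M] lorentz_form_commute[of v P] by (simp_all add: P_def)
  obtain u where u: "lorentz_form u v = 0" "lorentz_form u P = 0" "lorentz_form u u > 0"
    using null_orthogonal_complement[OF v P(1)] P(3) by auto
  have u': "lorentz_form v u = 0" "lorentz_form P u = 0"
    using u lorentz_form_commute[of v u] lorentz_form_commute[of P u] by simp_all
  let ?s = "lorentz_form u u" and ?C = "M 1 0" and ?e = "axis 4 1 :: real^4"
  define N where "N = tensor P v - tensor v P - (lorentz_form P P / 2) *\<^sub>R tensor v v"
  \<comment> \<open>The tensor has trace \<open>?s\<close> and the identity has trace 4.\<close>
  define E where "E = tensor u u - (?s / 4) *\<^sub>R id4"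
  define \<phi> :: "real \<times> real \<times> real \<times> real \<times> real \<Rightarrow> real^4^4" where
    "\<phi> t = fst t *\<^sub>R N + fst (snd t) *\<^sub>R tensor v v + fst (snd (snd t)) *\<^sub>R tensor v u
       + fst (snd (snd (snd t))) *\<^sub>R tensor u v + snd (snd (snd (snd t))) *\<^sub>R E" for t
  have Cv: "?C *v v = v" and Cu: "?C *v u = u"
    using v u P by (simp_all add: M parabolic_def flip: P_def)
  have CN: "?C = id4 + N"
    by (simp add: matrix_eq matrix_vector_mult_add_rdistrib matrix_vector_mult_diff_rdistrib N_def tensor_apply
        M parabolic_def flip: P_def scaleR_matrix_vector_assoc)
  have comm: "N ** ?C = ?C ** N" "tensor v v ** ?C = ?C ** tensor v v" "tensor v u ** ?C = ?C ** tensor v u"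
    "tensor u v ** ?C = ?C ** tensor u v" "E ** ?C = ?C ** E"
  proof -
    show "N ** ?C = ?C ** N" unfolding CN by (simp only: matmult.add_left matmult.add_right matrix_mul_lid matrix_mul_rid)
    show "E ** ?C = ?C ** E"
      unfolding E_def matmult.diff_left matmult.diff_right matmult.scaleR_left matmult.scaleR_right tensor_commute[OF O31 Cu Cu]
      by (simp only: matrix_mul_lid matrix_mul_rid)
  qed (rule tensor_commute[OF O31], rule Cv Cu, rule Cv Cu)+
  have tr: "trace N = 0" "trace (tensor v v) = 0" "trace (tensor v u) = 0" "trace (tensor u v) = 0" "trace E = 0"
    by (simp_all add: N_def E_def trace_sub trace_tensor trace_I trace_scaleR v u u' P)
  have lin: "linear \<phi>"
    by (rule linearI) (simp_all add: \<phi>_def algebra_simps)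
  have "inj \<phi>"
    unfolding linear_injective_0[OF lin]
  proof (intro allI impI)
    fix t assume t0: "\<phi> t = 0"
    obtain a b c d e where t: "t = (a, b, c, d, e)" by (metis surj_pair)
    have app: "a *\<^sub>R (N *v z) + b *\<^sub>R (tensor v v *v z) + c *\<^sub>R (tensor v u *v z)
        + d *\<^sub>R (tensor u v *v z) + e *\<^sub>R (E *v z) = 0" for z
    proof -
      have "\<phi> t *v z = 0" by (simp add: t0)
      then show ?thesis by (simp add: t \<phi>_def matrix_vector_mult_add_rdistrib flip: scaleR_matrix_vector_assoc)
    qed
    have Nz: "N *v z = lorentz_form z v *\<^sub>R P - lorentz_form z P *\<^sub>R v
        - (lorentz_form P P / 2) *\<^sub>R (lorentz_form z v *\<^sub>R v)" for z
      by (simp add: N_def matrix_vector_mult_diff_rdistrib tensor_apply flip: scaleR_matrix_vector_assoc)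
    have Ez: "E *v z = lorentz_form z u *\<^sub>R u - (?s / 4) *\<^sub>R z" for z
      by (simp add: E_def matrix_vector_mult_diff_rdistrib tensor_apply flip: scaleR_matrix_vector_assoc)
    \<comment> \<open>The coefficients are recovered by evaluation at \<open>P\<close>, which gives
      \<open>e\<close> and then \<open>a\<close>, at \<open>u\<close>, which gives \<open>c\<close>,
      and at a vector that pairs to -1 with \<open>v\<close>, which gives \<open>d\<close> and
      \<open>b\<close>.\<close>
    have FP: "a *\<^sub>R (- lorentz_form P P *\<^sub>R v) + e *\<^sub>R (- (?s / 4) *\<^sub>R P) = 0"
      using app[of P] by (simp add: Nz Ez tensor_apply P u')
    then have "lorentz_form (a *\<^sub>R (- lorentz_form P P *\<^sub>R v) + e *\<^sub>R (- (?s / 4) *\<^sub>R P)) P = 0"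
      by (simp only: lorentz_form_zero)
    then have "e * (?s / 4) * lorentz_form P P = 0"
      unfolding lorentz_form_add lorentz_form_scale P(2) by simp
    then have e: "e = 0" using P(3) u(3) by simp
    have v0: "v \<noteq> 0" using v by auto
    have a: "a = 0" using FP e P(3) v0 by simp
    have c: "c = 0" using app[of u] a e u(3) v0 by (simp add: tensor_apply u)
    have "lorentz_form ?e v = - 1" using v by (simp add: lorentz_form_def axis_def)
    then have "- (b *\<^sub>R v) - d *\<^sub>R u = 0"
      using app[of ?e] a c e by (simp add: tensor_apply)
    moreover from this have "lorentz_form (- (b *\<^sub>R v) - d *\<^sub>R u) u = 0" by (simp only: lorentz_form_zero)
    then have "d = 0" using u(3) u' by (simp flip: scaleR_minus_left)
    ultimately have "b = 0" using v0 by simp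
    show "t = 0" using a \<open>b = 0\<close> c \<open>d = 0\<close> e t by (simp add: zero_prod_def)
  qed
  then have "dim (\<phi> ` UNIV) = dim (UNIV :: (real \<times> real \<times> real \<times> real \<times> real) set)"
    by (intro dim_image_eq[OF lin]) simp
  also have "\<dots> = 5" by simp
  finally have "dim (range \<phi>) = 5" .
  moreover have "range \<phi> \<subseteq> {Y. trace Y = 0 \<and> Y ** ?C = ?C ** Y}"
  proof
    fix Y assume "Y \<in> range \<phi>"
    then obtain t where Y: "Y = \<phi> t" by blast
    have "trace Y = 0" by (simp add: Y \<phi>_def trace_add trace_scaleR tr)
    moreover have "Y ** ?C = ?C ** Y"
      unfolding Y \<phi>_def matmult.add_left matmult.add_right matmult.scaleR_left matmult.scaleR_right comm ..
    ultimately show "Y \<in> {Y. trace Y = 0 \<and> Y ** ?C = ?C ** Y}" by simp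
  qed
  ultimately show ?thesis using dim_subset[of "range \<phi>"] by simp
qed

text \<open>A Schur type argument: \<open>Y\<close> preserves the line of \<open>v\<close>, hence
  acts by one scalar on the orbit of \<open>v\<close> under \<open>G\<close>, and this orbit spans.
  Its orthogonal space \<open>U\<close> is zero, since a nonzero vector there would confine the
  parabolic translations to a line modulo \<open>v\<close>, where a discrete group of rank two has
  no room.\<close>

lemma centralizer_trivial:
  assumes G: "\<And>A. A \<in> G \<Longrightarrow> A \<in> SO31_plus" "\<And>A B. A \<in> G \<Longrightarrow> B \<in> G \<Longrightarrow> A ** B \<in> G"
    and inv: "\<And>A. A \<in> G \<Longrightarrow> \<exists>B\<in>G. A ** B = id4 \<and> B ** A = id4"
    and MG: "\<And>m n. M m n \<in> G"
    and hk: "h \<in> G" "k \<in> G" "h ** k = id4" "k ** h = id4"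
    and nc: "(h ** M 1 0 ** k) ** M 1 0 \<noteq> M 1 0 ** (h ** M 1 0 ** k)"
    and Y: "\<And>A. A \<in> G \<Longrightarrow> Y ** A = A ** Y"
  shows "\<exists>l. Y = l *\<^sub>R id4"
proof -
  obtain v p where v: "v $ 4 = 1" "lorentz_form v v = 0"
    and p: "\<And>m n. lorentz_form (p m n) v = 0" and M: "\<And>m n y. M m n *v y = parabolic v (p m n) y"
    using parabolic_translations by metis
  define P where "P = p 1 0"
  have P: "lorentz_form P v = 0" "lorentz_form v P = 0" "lorentz_form P P > 0"
    using p translation_spacelike[OF v p M] lorentz_form_commute[of v P] by (simp_all add: P_def)
  let ?C = "M 1 0" and ?e = "axis 4 1 :: real^4" and ?c = "lorentz_form P P"
  have Y': "Y *v (A *v y) = A *v (Y *v y)" if "A \<in> G" for A y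
    using Y[OF that] by (simp add: matrix_vector_mul_assoc)
  have sd: "?C *v (?C *v y) - 2 *\<^sub>R (?C *v y) + y = (- (?c * lorentz_form y v)) *\<^sub>R v" for y
    unfolding M P_def[symmetric] by (rule parabolic_second_difference[OF v(2) P(1)])
  \<comment> \<open>The vector \<open>?e\<close> pairs to -1 with \<open>v\<close>, so its second
    difference is a positive multiple of \<open>v\<close>. Comparing it with the second difference
    of \<open>Y *v ?e\<close> identifies \<open>Y *v v\<close>.\<close>
  define l where "l = - lorentz_form (Y *v ?e) v"
  have e: "lorentz_form ?e v = - 1" using v by (simp add: lorentz_form_def axis_def)
  have "Y *v (?C *v (?C *v ?e) - 2 *\<^sub>R (?C *v ?e) + ?e) = (- (?c * lorentz_form (Y *v ?e) v)) *\<^sub>R v"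
    unfolding sd[symmetric]
    by (simp add: matrix_vector_right_distrib matrix_vector_mult_diff_distrib matrix_vector_mult_scaleR Y'[OF MG])
  then have "?c *\<^sub>R (Y *v v) = ?c *\<^sub>R (l *\<^sub>R v)"
    unfolding sd e by (simp add: l_def matrix_vector_mult_scaleR)
  then have "?c = 0 \<or> Y *v v = l *\<^sub>R v" unfolding scaleR_cancel_left by blast
  then have Yv: "Y *v v = l *\<^sub>R v" using P(3) by simp
  have Ygv: "Y *v (A *v v) = l *\<^sub>R (A *v v)" if "A \<in> G" for A
    by (simp add: Y'[OF that] Yv matrix_vector_mult_scaleR)
  define U where "U = {u. \<forall>A\<in>G. lorentz_form u (A *v v) = 0}"
  have idG: "id4 \<in> G" using MG[of 0 0] by (simp add: M_0)
  have Uinv: "A *v u \<in> U" if u: "u \<in> U" and A: "A \<in> G" for u A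
  proof -
    obtain B where B: "B \<in> G" "A ** B = id4" using inv[OF A] by blast
    have "lorentz_form (A *v u) (A' *v v) = 0" if "A' \<in> G" for A'
    proof -
      have "lorentz_form (A *v u) (A *v (B *v (A' *v v))) = lorentz_form u (B *v (A' *v v))"
        using G(1)[OF A] by (intro O31_D SO31_plus_D(1))
      also have "\<dots> = 0" using u G(2)[OF B(1) that] by (simp add: U_def matrix_vector_mul_assoc)
      finally show ?thesis by (simp add: matrix_vector_mul_assoc matrix_mul_assoc B(2))
    qed
    then show ?thesis by (simp add: U_def)
  qed
  have Udiff: "u - w \<in> U" if "u \<in> U" "w \<in> U" for u w using that by (simp add: U_def)
  have Uscale: "a *\<^sub>R u \<in> U" if "u \<in> U" for u a using that by (simp add: U_def)
  have Uv: "lorentz_form u v = 0" if "u \<in> U" for u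
    using that idG by (force simp: U_def)
  \<comment> \<open>Otherwise \<open>h *v v\<close> is null and orthogonal to \<open>v\<close>,
    hence a multiple of \<open>v\<close>. The conjugate of \<open>M 1 0\<close> by \<open>h\<close>
    is then parabolic with the same null vector, and such maps commute, against
    \<open>nc\<close>.\<close>
  have vU: "v \<notin> U"
  proof
    assume "v \<in> U"
    then have "lorentz_form (h *v v) v = 0" using hk(1) lorentz_form_commute by (simp add: U_def)
    moreover have h: "h \<in> O31" using G(1) hk(1) SO31_plus_D(1) by blast
    moreover from this have "lorentz_form (h *v v) (h *v v) = 0" by (simp add: O31_D v)
    ultimately obtain \<kappa> where \<kappa>: "h *v v = \<kappa> *\<^sub>R v" using null_orthogonal(2)[OF v] by blast
    define q where "q = \<kappa> *\<^sub>R (h *v P)"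
    have "lorentz_form (h *v P) (h *v v) = lorentz_form P v" by (rule O31_D[OF h])
    then have q: "lorentz_form q v = 0" using P(1) by (simp add: q_def \<kappa>)
    have hC: "(h ** ?C ** k) *v y = parabolic v q y" for y
    proof -
      have "(h ** ?C ** k) *v y = h *v parabolic v P (k *v y)"
        by (simp add: M flip: matrix_vector_mul_assoc P_def)
      also have "\<dots> = parabolic (h *v v) (h *v P) (h *v (k *v y))"
        by (rule parabolic_transport[OF h])
      also have "h *v (k *v y) = y" by (simp add: matrix_vector_mul_assoc hk)
      finally show ?thesis by (simp add: \<kappa> parabolic_scale q_def)
    qed
    have "((h ** ?C ** k) ** ?C) *v y = (?C ** (h ** ?C ** k)) *v y" for y
    proof -
      have "((h ** ?C ** k) ** ?C) *v y = parabolic v q (parabolic v P y)"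
        unfolding matrix_vector_mul_assoc[of "h ** ?C ** k", symmetric] hC M P_def ..
      also have "\<dots> = parabolic v P (parabolic v q y)"
        using parabolic_add[OF v(2) P(1) q] parabolic_add[OF v(2) q P(1)] by (simp add: add.commute)
      also have "\<dots> = (?C ** (h ** ?C ** k)) *v y"
        unfolding matrix_vector_mul_assoc[of ?C, symmetric] hC M P_def ..
      finally show ?thesis .
    qed
    then show False using nc by (simp add: matrix_eq)
  qed
  have "U = {0}"
  proof (rule ccontr)
    assume "U \<noteq> {0}"
    moreover have "0 \<in> U" by (simp add: U_def)
    ultimately obtain u where u: "u \<in> U" "u \<noteq> 0" by blast
    have uv: "lorentz_form u v = 0" by (rule Uv[OF u(1)])
    have uu: "lorentz_form u u > 0"
    proof (rule ccontr)
      assume "\<not> lorentz_form u u > 0"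
      then have "u = u $ 4 *\<^sub>R v" using null_orthogonal[OF v uv] by simp
      moreover from this have "u $ 4 \<noteq> 0" using u(2) by (metis scaleR_zero_left)
      ultimately have "(1 / u $ 4) *\<^sub>R u = v" by (metis scaleR_one scaleR_scaleR nonzero_eq_divide_eq)
      then show False using Uscale[OF u(1), of "1 / u $ 4"] vU by simp
    qed
    \<comment> \<open>As \<open>U\<close> is invariant, it contains \<open>u - M m n *v u\<close>,
      which is a multiple of \<open>v\<close>; but \<open>v\<close> is not in
      \<open>U\<close>.\<close>
    have up: "lorentz_form u (p m n) = 0" for m n
    proof (rule ccontr)
      assume ne: "lorentz_form u (p m n) \<noteq> 0"
      have "u - M m n *v u = lorentz_form u (p m n) *\<^sub>R v"
        by (simp add: M parabolic_def uv)
      then have "lorentz_form u (p m n) *\<^sub>R v \<in> U" using Udiff[OF u(1) Uinv[OF u(1) MG]] by metis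
      then have "(1 / lorentz_form u (p m n)) *\<^sub>R (lorentz_form u (p m n) *\<^sub>R v) \<in> U" by (rule Uscale)
      then show False using vU ne by simp
    qed
    \<comment> \<open>The coordinate along \<open>P\<close> of the translation vector. There is no
      component along \<open>u\<close>, so modulo \<open>v\<close> this coordinate is all that is
      left.\<close>
    define f where "f m n = lorentz_form (p m n) P / ?c" for m n
    have Mf: "M m n *v y = parabolic v (f m n *\<^sub>R P) y" for m n y
    proof -
      define q where "q = p m n - f m n *\<^sub>R P"
      have "q = q $ 4 *\<^sub>R v"
      proof (rule null_orthogonal_three[OF v])
        show "lorentz_form u P = 0" using up by (simp add: P_def)
        show "lorentz_form q u = 0" using up lorentz_form_commute by (simp add: q_def P_def)
        show "lorentz_form q P = 0" using P(3) by (simp add: q_def f_def)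
      qed (use p P uv uu in \<open>auto simp: q_def\<close>)
      then have "p m n = f m n *\<^sub>R P + q $ 4 *\<^sub>R v" unfolding q_def by (simp add: algebra_simps)
      then show ?thesis
        unfolding M using parabolic_add_null[OF v(2), of "f m n *\<^sub>R P"] P(1) by simp
    qed
    have "f (m + m') (n + n') = f m n + f m' n'" for m m' n n'
    proof -
      have "parabolic v (p (m + m') (n + n')) y = parabolic v (p m n + p m' n') y" for y
        unfolding M[symmetric] parabolic_add[OF v(2) p p, symmetric] by (simp add: mult matrix_vector_mul_assoc)
      then obtain \<kappa> where "p (m + m') (n + n') = (p m n + p m' n') + \<kappa> *\<^sub>R v"
        using parabolic_inj[OF v(1)] by metis
      then show ?thesis by (simp add: f_def P(2) add_divide_distrib)
    qed
    then obtain K where K: "infinite {(i, j). \<bar>f i j\<bar> \<le> K}"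
      using additive_infinite_bounded by blast
    \<comment> \<open>The bound obtained from the formula for a parabolic with translation
      \<open>f i j *\<^sub>R P\<close>, estimated term by term.\<close>
    define R where "R = norm ?e + K * norm P + K * \<bar>lorentz_form ?e P\<bar> * norm v + K\<^sup>2 * ?c / 2 * norm v"
    have "norm (M i j *v ?e) \<le> R" if f: "\<bar>f i j\<bar> \<le> K" for i j
    proof -
      have "M i j *v ?e = ?e + (- f i j) *\<^sub>R P + (- f i j * lorentz_form ?e P) *\<^sub>R v + ((f i j)\<^sup>2 * ?c / 2) *\<^sub>R v"
        by (simp add: Mf parabolic_def e power2_eq_square)
      then have "norm (M i j *v ?e) \<le> norm ?e + norm ((- f i j) *\<^sub>R P) + norm ((- f i j * lorentz_form ?e P) *\<^sub>R v)
          + norm (((f i j)\<^sup>2 * ?c / 2) *\<^sub>R v)"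
        by (metis norm_triangle_mono norm_triangle_ineq order_refl)
      also have "\<dots> = norm ?e + \<bar>f i j\<bar> * norm P + \<bar>f i j\<bar> * \<bar>lorentz_form ?e P\<bar> * norm v + \<bar>f i j\<bar>\<^sup>2 * ?c / 2 * norm v"
        using P(3) by (simp add: abs_mult)
      also have "\<dots> \<le> R"
        unfolding R_def using f P(3)
        by (intro add_mono mult_right_mono divide_right_mono power_mono order_refl) auto
      finally show ?thesis .
    qed
    then have "(\<lambda>(i, j). M i j) ` {(i, j). \<bar>f i j\<bar> \<le> K} \<subseteq> {A \<in> SO31_plus. norm (A *v ?e) \<le> R}"
      using SO by auto
    moreover have "bounded {A \<in> SO31_plus. norm (A *v ?e) \<le> R}"
      by (rule SO31_plus_bounded) (simp_all add: lorentz_form_def axis_def)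
    ultimately have "bounded ((\<lambda>(i, j). M i j) ` {(i, j). \<bar>f i j\<bar> \<le> K})"
      by (rule bounded_subset[rotated])
    then show False using infinite_unbounded[OF K] by blast
  qed
  let ?W = "(\<lambda>A. A *v v) ` G"
  have "span ?W = UNIV"
  proof (rule ccontr)
    assume "span ?W \<noteq> UNIV"
    then have "dim ?W < DIM(real^4)" using dim_eq_full[of ?W] dim_subset_UNIV[of ?W] by linarith
    then obtain x where x: "x \<noteq> 0" "\<And>y. y \<in> span ?W \<Longrightarrow> Linear_Algebra.orthogonal x y"
      using orthogonal_to_subspace_exists by blast
    \<comment> \<open>Turns Euclidean orthogonality to the orbit into Lorentz orthogonality, hence
      membership in \<open>U\<close>.\<close>
    define u where "u = minkowski *v x"
    have mu: "minkowski *v u = x" by (simp add: u_def matrix_vector_mul_assoc minkowski_mult_minkowski)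
    have "lorentz_form u y = inner x y" for y
      using lorentz_form_commute[of u y] lorentz_form_eq_inner[of y u] by (simp add: mu inner_commute)
    then have "u \<in> U" using x(2) span_base[of _ ?W] by (auto simp: U_def Linear_Algebra.orthogonal_def)
    then have "u = 0" using \<open>U = {0}\<close> by blast
    then show False using x(1) mu by simp
  qed
  moreover have "Y *v y = l *\<^sub>R y" if "y \<in> span ?W" for y
    using that
  proof (induction rule: span_induct_alt)
    case (step c x y)
    then show ?case using Ygv by (auto simp: matrix_vector_right_distrib matrix_vector_mult_scaleR algebra_simps)
  qed simp
  ultimately have "Y = l *\<^sub>R id4" by (simp add: matrix_eq flip: scaleR_matrix_vector_assoc)
  then show ?thesis by blast
qed

end

section \<open>The group of a punctured torus bundle\<close>

lemma (in group) commute_int_pow: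
  assumes xy: "x \<otimes> y = y \<otimes> x" and x: "x \<in> carrier G" and y: "y \<in> carrier G"
  shows "x [^] (i::int) \<otimes> y [^] (j::int) = y [^] j \<otimes> x [^] i"
proof -
  have nat: "a \<otimes> b [^] (n::nat) = b [^] n \<otimes> a" if "a \<otimes> b = b \<otimes> a" "a \<in> carrier G" "b \<in> carrier G" for a b n
  proof (induction n)
    case (Suc n)
    have "a \<otimes> b [^] Suc n = (a \<otimes> b [^] n) \<otimes> b" using that by (simp add: m_assoc)
    also have "\<dots> = b [^] n \<otimes> (a \<otimes> b)" using that by (simp add: Suc m_assoc)
    also have "\<dots> = b [^] Suc n \<otimes> a" unfolding that(1) using that by (simp add: m_assoc)
    finally show ?case .
  qed (use that in simp)
  have inv: "a \<otimes> inv b = inv b \<otimes> a" if "a \<otimes> b = b \<otimes> a" "a \<in> carrier G" "b \<in> carrier G" for a b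
  proof -
    have "inv b \<otimes> a = inv b \<otimes> ((a \<otimes> b) \<otimes> inv b)" using that(2,3) by (simp add: m_assoc)
    also have "\<dots> = (inv b \<otimes> b) \<otimes> (a \<otimes> inv b)"
      by (simp only: that m_assoc inv_closed m_closed)
    finally show ?thesis using that(2,3) by simp
  qed
  have int: "a \<otimes> b [^] (n::int) = b [^] n \<otimes> a" if ab: "a \<otimes> b = b \<otimes> a" "a \<in> carrier G" "b \<in> carrier G" for a b n
  proof (cases n rule: int_cases2)
    case (nonneg m)
    then show ?thesis using nat[OF ab] by (simp add: int_pow_int)
  next
    case (nonpos m)
    then show ?thesis using inv[OF nat[OF ab]] ab by (simp add: int_pow_neg_int)
  qed
  have "x \<otimes> y [^] j = y [^] j \<otimes> x" by (rule int[OF xy x y])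
  then have "y [^] j \<otimes> x = x \<otimes> y [^] j" by simp
  then have "y [^] j \<otimes> x [^] i = x [^] i \<otimes> y [^] j" by (rule int) (use x y in auto)
  then show ?thesis by simp
qed

lemma in_free_group: "w \<in> carrier (free_group n) \<longleftrightarrow> reduced w \<and> fst ` set w \<subseteq> {..<n}"
  by (simp add: free_group_def)

lemma free_group_mult: "u \<otimes>\<^bsub>free_group n\<^esub> v = reduce (u @ v)"
  by (simp add: free_group_def)

lemma free_group_one: "\<one>\<^bsub>free_group n\<^esub> = []"
  by (simp add: free_group_def)

lemma reduce_in_free_group: "fst ` set w \<subseteq> {..<n} \<Longrightarrow> reduce w \<in> carrier (free_group n)"
  using set_reduce[of w] by (auto simp: in_free_group)

lemma free_group_mono: "w \<in> carrier (free_group n) \<Longrightarrow> n \<le> m \<Longrightarrow> w \<in> carrier (free_group m)"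
  by (auto simp: in_free_group)

lemma fst_set_inv_word: "fst ` set (inv_word w) = fst ` set w"
  by (force simp: inv_word_def image_iff)

lemma inv_word_inv_word: "inv_word (inv_word w) = w"
  by (simp add: inv_word_def rev_map comp_def case_prod_unfold)

lemma reduce_inv_word_right: "reduce (w @ inv_word w) = []"
  using reduce_inv_word[of "inv_word w"] by (simp add: inv_word_inv_word)

lemma free_group_inv:
  assumes "w \<in> carrier (free_group n)" shows "inv\<^bsub>free_group n\<^esub> w = reduce (inv_word w)"
proof (rule group.inv_equality[OF group_free_group])
  show "reduce (inv_word w) \<in> carrier (free_group n)"
    using assms by (intro reduce_in_free_group) (simp add: fst_set_inv_word in_free_group)
qed (use assms in \<open>simp_all add: free_group_mult free_group_one reduce_append_left reduce_inv_word\<close>)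

lemma relators_normal:
  assumes "set rs \<subseteq> carrier (free_group n)"
  shows "normal_closure (free_group n) (set rs) \<lhd> free_group n"
proof -
  interpret F: group "free_group n" by (rule group_free_group)
  show ?thesis
    unfolding normal_closure_def
  proof (rule F.normal_generateI)
    show "{g \<otimes>\<^bsub>free_group n\<^esub> r \<otimes>\<^bsub>free_group n\<^esub> inv\<^bsub>free_group n\<^esub> g | g r.
        g \<in> carrier (free_group n) \<and> r \<in> set rs} \<subseteq> carrier (free_group n)"
      using assms by auto
    fix h g assume "h \<in> {g \<otimes>\<^bsub>free_group n\<^esub> r \<otimes>\<^bsub>free_group n\<^esub> inv\<^bsub>free_group n\<^esub> g | g r.
        g \<in> carrier (free_group n) \<and> r \<in> set rs}" and g: "g \<in> carrier (free_group n)"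
    then obtain k r where k: "k \<in> carrier (free_group n)" "r \<in> set rs"
      and h: "h = k \<otimes>\<^bsub>free_group n\<^esub> r \<otimes>\<^bsub>free_group n\<^esub> inv\<^bsub>free_group n\<^esub> k" by blast
    have r: "r \<in> carrier (free_group n)" using k assms by blast
    have "g \<otimes>\<^bsub>free_group n\<^esub> h \<otimes>\<^bsub>free_group n\<^esub> inv\<^bsub>free_group n\<^esub> g
        = (g \<otimes>\<^bsub>free_group n\<^esub> k) \<otimes>\<^bsub>free_group n\<^esub> r \<otimes>\<^bsub>free_group n\<^esub> inv\<^bsub>free_group n\<^esub> (g \<otimes>\<^bsub>free_group n\<^esub> k)"
      using g k r by (simp add: h F.m_assoc F.inv_mult_group)
    then show "g \<otimes>\<^bsub>free_group n\<^esub> h \<otimes>\<^bsub>free_group n\<^esub> inv\<^bsub>free_group n\<^esub> g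
      \<in> {g \<otimes>\<^bsub>free_group n\<^esub> r \<otimes>\<^bsub>free_group n\<^esub> inv\<^bsub>free_group n\<^esub> g | g r.
        g \<in> carrier (free_group n) \<and> r \<in> set rs}"
      using g k by blast
  qed
qed

locale punctured_torus_bundle =
  fixes \<phi> :: "word \<Rightarrow> word"
  assumes hyperbolic: "hyperbolic_monodromy \<phi>"
begin

abbreviation "F2 \<equiv> free_group 2"
abbreviation "F3 \<equiv> free_group 3"
abbreviation "R \<equiv> bundle_relators \<phi>"
abbreviation "NR \<equiv> normal_closure F3 (set R)"
abbreviation "\<Gamma> \<equiv> bundle_group \<phi>"

text \<open>Reducing first makes this meaningful for all words, so that concatenation of words, not
  only the product of reduced ones, becomes multiplication in \<Gamma>.\<close>

definition cls :: "word \<Rightarrow> word set" where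
  "cls w = word_class 3 R (reduce w)"

lemma \<phi>_iso: "\<phi> \<in> iso F2 F2" and \<phi>_boundary: "\<phi> boundary_word = boundary_word"
  using hyperbolic by (simp_all add: hyperbolic_monodromy_def)

lemma \<phi>_hom: "\<phi> \<in> hom F2 F2" and \<phi>_bij: "bij_betw \<phi> (carrier F2) (carrier F2)"
  using \<phi>_iso by (simp_all add: iso_def)

lemma \<phi>_closed: "w \<in> carrier F2 \<Longrightarrow> \<phi> w \<in> carrier F2"
  using \<phi>_hom by (auto simp: hom_def)

lemma \<phi>_mult: "u \<in> carrier F2 \<Longrightarrow> v \<in> carrier F2 \<Longrightarrow> \<phi> (reduce (u @ v)) = reduce (\<phi> u @ \<phi> v)"
  using \<phi>_hom by (auto simp: hom_def free_group_mult)

lemma \<phi>_letters: "w \<in> carrier F2 \<Longrightarrow> fst ` set (\<phi> w) \<subseteq> {..<2}"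
  using \<phi>_closed[of w] by (simp add: in_free_group)

lemma gen_F2: "i < 2 \<Longrightarrow> [(i, s)] \<in> carrier F2"
  by (auto simp: in_free_group reduced_Cons)

lemma \<phi>_gen_letters: "i < 2 \<Longrightarrow> fst ` set (\<phi> (gen i)) \<subseteq> {..<2}"
  using \<phi>_letters gen_F2 by blast

definition relator :: "nat \<Rightarrow> word" where
  "relator i = gen 2 @ gen i @ gen_inv 2 @ inv_word (\<phi> (gen i))"

lemma R_eq: "R = [reduce (relator 0), reduce (relator 1)]"
  by (simp add: bundle_relators_def relator_def)

lemma relator_letters: "i < 2 \<Longrightarrow> fst ` set (relator i) \<subseteq> {..<3}"
  using \<phi>_gen_letters[of i] by (auto simp: relator_def fst_set_inv_word image_Un)

lemma R_closed: "set R \<subseteq> carrier F3"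
  using relator_letters[of 0] relator_letters[of 1] by (auto simp: R_eq intro: reduce_in_free_group)

lemma NR_normal: "NR \<lhd> F3"
  by (rule relators_normal[OF R_closed])

sublocale \<Gamma>: group \<Gamma>
  using normal.factorgroup_is_group[OF NR_normal] by (simp add: bundle_group_def presented_group_def)

lemma cls_closed: "fst ` set w \<subseteq> {..<3} \<Longrightarrow> cls w \<in> carrier \<Gamma>"
  using reduce_in_free_group[of w 3]
  by (auto simp: cls_def word_class_def bundle_group_def presented_group_def FactGroup_def RCOSETS_def)

lemma cls_append:
  assumes "fst ` set u \<subseteq> {..<3}" "fst ` set v \<subseteq> {..<3}"
  shows "cls (u @ v) = cls u \<otimes>\<^bsub>\<Gamma>\<^esub> cls v"
proof -
  have "reduce (u @ v) = reduce u \<otimes>\<^bsub>F3\<^esub> reduce v"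
    by (simp add: free_group_mult reduce_append_left reduce_append_right)
  then show ?thesis
    using normal.rcos_sum[OF NR_normal, of "reduce u" "reduce v"] assms reduce_in_free_group[of _ 3]
    by (simp add: cls_def word_class_def bundle_group_def presented_group_def FactGroup_def)
qed

lemma cls_reduce: "cls (reduce w) = cls w"
  by (simp add: cls_def reduce_id)

lemma cls_Nil: "cls [] = \<one>\<^bsub>\<Gamma>\<^esub>"
proof -
  have "cls ([] @ []) = cls [] \<otimes>\<^bsub>\<Gamma>\<^esub> cls []" by (rule cls_append) auto
  then show ?thesis using cls_closed[of "[]"] \<Gamma>.l_cancel_one[of "cls []" "cls []"] by simp
qed

lemma cls_inv_word: "fst ` set w \<subseteq> {..<3} \<Longrightarrow> cls (inv_word w) = inv\<^bsub>\<Gamma>\<^esub> cls w"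
  using cls_append[of "inv_word w" w] cls_closed[of w] cls_closed[of "inv_word w"]
    cls_reduce[of "inv_word w @ w"]
  by (intro \<Gamma>.inv_equality[symmetric]) (auto simp: fst_set_inv_word reduce_inv_word cls_Nil)

lemma cls_surj:
  assumes "g \<in> carrier \<Gamma>" obtains w where "fst ` set w \<subseteq> {..<3}" "g = cls w"
proof -
  obtain w where "w \<in> carrier F3" "g = NR #>\<^bsub>F3\<^esub> w"
    using assms by (auto simp: bundle_group_def presented_group_def FactGroup_def RCOSETS_def)
  then show ?thesis using that[of w] by (simp add: in_free_group cls_def word_class_def reduce_id)
qed

lemma cls_word: "w \<in> carrier F3 \<Longrightarrow> word_class 3 R w = cls w"
  by (simp add: cls_def in_free_group reduce_id)

lemma cls_relator: "i < 2 \<Longrightarrow> cls (relator i) = \<one>\<^bsub>\<Gamma>\<^esub>"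
proof -
  assume i: "i < 2"
  interpret F: group F3 by (rule group_free_group)
  have "reduce (relator i) \<in> set R" using i less_2_cases[OF i] by (auto simp: R_eq)
  then have "\<one>\<^bsub>F3\<^esub> \<otimes>\<^bsub>F3\<^esub> reduce (relator i) \<otimes>\<^bsub>F3\<^esub> inv\<^bsub>F3\<^esub> \<one>\<^bsub>F3\<^esub> \<in> NR"
    unfolding normal_closure_def by (intro generate.incl) blast
  then have "reduce (relator i) \<in> NR"
    using R_closed \<open>reduce (relator i) \<in> set R\<close> by auto
  moreover have "subgroup NR F3" using NR_normal by (simp add: normal_def)
  moreover have "reduce (relator i) \<in> carrier F3" using R_closed \<open>reduce (relator i) \<in> set R\<close> by blast
  ultimately have "NR #>\<^bsub>F3\<^esub> reduce (relator i) = NR"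
    by (intro F.coset_join2)
  then show ?thesis
    by (simp add: cls_def word_class_def bundle_group_def presented_group_def FactGroup_def)
qed

lemma cls_conj_gen:
  assumes i: "i < 2"
  shows "cls (gen 2 @ gen i @ gen_inv 2) = cls (\<phi> (gen i))"
proof -
  let ?u = "gen 2 @ gen i @ gen_inv 2" and ?w = "\<phi> (gen i)"
  have u: "fst ` set ?u \<subseteq> {..<3}" using i by auto
  have w: "fst ` set ?w \<subseteq> {..<3}" using \<phi>_gen_letters[OF i] by auto
  have "cls ?u \<otimes>\<^bsub>\<Gamma>\<^esub> inv\<^bsub>\<Gamma>\<^esub> cls ?w = \<one>\<^bsub>\<Gamma>\<^esub>"
    using cls_append[OF u, of "inv_word ?w"] cls_relator[OF i] w
    by (simp add: relator_def fst_set_inv_word cls_inv_word[OF w])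
  then show ?thesis
    using cls_closed[OF u] cls_closed[OF w] \<Gamma>.inv_equality[of "cls ?u" "inv\<^bsub>\<Gamma>\<^esub> cls ?w"] by simp
qed

lemma cls_gen_inv: "i < 3 \<Longrightarrow> cls (gen_inv i) = inv\<^bsub>\<Gamma>\<^esub> cls (gen i)"
  using cls_inv_word[of "gen i"] by (simp add: inv_word_def)

lemma F2_induct [consumes 1, case_names Nil Cons]:
  assumes "w \<in> carrier F2" "P []"
    "\<And>i s w. i < 2 \<Longrightarrow> w \<in> carrier F2 \<Longrightarrow> (i, s) # w \<in> carrier F2 \<Longrightarrow> P w \<Longrightarrow> P ((i, s) # w)"
  shows "P w"
  using assms(1)
proof (induction w)
  case (Cons l w)
  obtain i s where "l = (i, s)" by force
  with Cons show ?case by (auto simp: in_free_group reduced_Cons intro!: assms(3))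
qed (rule assms(2))

lemma \<phi>_Nil: "\<phi> [] = []"
  using hom_one[OF \<phi>_hom group_free_group group_free_group] by (simp add: free_group_one)

lemma \<phi>_inv: "w \<in> carrier F2 \<Longrightarrow> \<phi> (reduce (inv_word w)) = reduce (inv_word (\<phi> w))"
  using group_hom.hom_inv[of F2 F2 \<phi> w] \<phi>_hom group_free_group[of 2] \<phi>_closed[of w]
  by (simp add: group_hom_def group_hom_axioms_def free_group_inv)

lemma \<phi>_gen_inv: "i < 2 \<Longrightarrow> \<phi> (gen_inv i) = reduce (inv_word (\<phi> (gen i)))"
  using \<phi>_inv[OF gen_F2[of i True]] by (simp add: inv_word_def)

lemma \<phi>_Cons:
  assumes "(i, s) # w \<in> carrier F2" "i < 2" "w \<in> carrier F2"
  shows "\<phi> ((i, s) # w) = reduce (\<phi> [(i, s)] @ \<phi> w)"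
proof -
  have "reduce ([(i, s)] @ w) = (i, s) # w"
    using assms(1) by (subst reduce_id) (auto simp: in_free_group)
  then show ?thesis using \<phi>_mult[OF gen_F2[OF assms(2)] assms(3), of s] by simp
qed

lemma cls_conj:
  assumes "w \<in> carrier F2"
  shows "cls (gen 2) \<otimes>\<^bsub>\<Gamma>\<^esub> cls w \<otimes>\<^bsub>\<Gamma>\<^esub> inv\<^bsub>\<Gamma>\<^esub> cls (gen 2) = cls (\<phi> w)"
  using assms
proof (induction w rule: F2_induct)
  case Nil
  then show ?case using cls_closed[of "gen 2"] by (simp add: cls_Nil \<phi>_Nil)
next
  case (Cons i s w)
  let ?x = "cls (gen 2)"
  have x: "?x \<in> carrier \<Gamma>" by (rule cls_closed) simp
  have w1: "fst ` set w \<subseteq> {..<3}" using Cons(2) by (auto simp: in_free_group)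
  note w = w1 cls_closed[OF w1]
  have g: "cls [(i, t)] \<in> carrier \<Gamma>" for t by (rule cls_closed) (use Cons(1) in simp)
  have pos: "?x \<otimes>\<^bsub>\<Gamma>\<^esub> cls (gen i) \<otimes>\<^bsub>\<Gamma>\<^esub> inv\<^bsub>\<Gamma>\<^esub> ?x = cls (\<phi> (gen i))"
    using cls_conj_gen[OF Cons(1)] cls_append[of "gen 2" "gen i @ gen_inv 2"] cls_append[of "gen i" "gen_inv 2"]
      Cons(1) cls_gen_inv[of 2] x g by (simp add: \<Gamma>.m_assoc)
  have gen: "?x \<otimes>\<^bsub>\<Gamma>\<^esub> cls [(i, s)] \<otimes>\<^bsub>\<Gamma>\<^esub> inv\<^bsub>\<Gamma>\<^esub> ?x = cls (\<phi> [(i, s)])"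
  proof (cases s)
    case True
    then show ?thesis using pos by simp
  next
    case False
    have f: "fst ` set (\<phi> (gen i)) \<subseteq> {..<3}" using \<phi>_gen_letters[OF Cons(1)] by auto
    have "cls (\<phi> (gen_inv i)) = inv\<^bsub>\<Gamma>\<^esub> cls (\<phi> (gen i))"
      using \<phi>_gen_inv[OF Cons(1)] cls_inv_word[OF f] by (simp add: cls_reduce)
    also have "\<dots> = ?x \<otimes>\<^bsub>\<Gamma>\<^esub> inv\<^bsub>\<Gamma>\<^esub> cls (gen i) \<otimes>\<^bsub>\<Gamma>\<^esub> inv\<^bsub>\<Gamma>\<^esub> ?x"
      unfolding pos[symmetric] using x g[of True] by (simp add: \<Gamma>.inv_mult_group \<Gamma>.m_assoc)
    finally show ?thesis using False cls_gen_inv[of i] Cons(1) by simp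
  qed
  have "cls ((i, s) # w) = cls [(i, s)] \<otimes>\<^bsub>\<Gamma>\<^esub> cls w"
    using cls_append[of "[(i, s)]" w] w Cons(1) by simp
  moreover have "cls (\<phi> ((i, s) # w)) = cls (\<phi> [(i, s)]) \<otimes>\<^bsub>\<Gamma>\<^esub> cls (\<phi> w)"
  proof -
    have "fst ` set (\<phi> [(i, s)]) \<subseteq> {..<3}" "fst ` set (\<phi> w) \<subseteq> {..<3}"
      using \<phi>_letters[OF gen_F2[OF Cons(1)], of s] \<phi>_letters[OF Cons(2)] by auto
    then show ?thesis
      unfolding \<phi>_Cons[OF Cons(3,1,2)] cls_reduce by (rule cls_append)
  qed
  ultimately show ?case
    unfolding Cons(4)[symmetric] gen[symmetric] using x w(2) g[of s]
    by (simp add: \<Gamma>.m_assoc) (simp add: x w(2) g[of s] \<Gamma>.inv_solve_left' flip: \<Gamma>.m_assoc)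
qed

text \<open>The action of \<open>\<Gamma>\<close> on its fiber subgroup, in which \<open>a\<close> and \<open>b\<close> act by translations and \<open>x\<close>
  acts by \<open>\<phi>\<close>; it shows that the fiber subgroup is free.\<close>

fun letter_act :: "letter \<Rightarrow> word \<Rightarrow> word" where
  "letter_act (i, s) v = (if i = 2 then if s then \<phi> v else inv_into (carrier F2) \<phi> v else push (i, s) v)"

definition act :: "word \<Rightarrow> word \<Rightarrow> word" where
  "act w v = foldr letter_act w v"

lemma act_simps [simp]: "act [] v = v" "act (l # w) v = letter_act l (act w v)"
  by (simp_all add: act_def)

lemma act_append: "act (u @ w) v = act u (act w v)"
  by (simp add: act_def)

lemma letter_act_closed:
  assumes "fst l < 3" "v \<in> carrier F2" shows "letter_act l v \<in> carrier F2"
proof -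
  obtain i s where l: "l = (i, s)" by force
  have "inv_into (carrier F2) \<phi> v \<in> carrier F2"
    using assms(2) \<phi>_bij by (metis bij_betw_def inv_into_into)
  moreover have "push (i, s) v \<in> carrier F2" if "i \<noteq> 2"
  proof -
    have "fst ` set (push (i, s) v) \<subseteq> insert i (fst ` set v)" using set_push[of "(i, s)" v] by force
    also have "\<dots> \<subseteq> {..<2}" using assms that by (auto simp: l in_free_group)
    finally show ?thesis using assms(2) by (simp add: in_free_group reduced_push)
  qed
  ultimately show ?thesis using \<phi>_closed[OF assms(2)] by (simp add: l)
qed

lemma act_closed: "fst ` set w \<subseteq> {..<3} \<Longrightarrow> v \<in> carrier F2 \<Longrightarrow> act w v \<in> carrier F2"
  by (induction w) (auto intro: letter_act_closed simp del: letter_act.simps)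

lemma letter_act_inverse:
  assumes "v \<in> carrier F2" shows "letter_act (i, s) (letter_act (i, \<not> s) v) = v"
  using assms \<phi>_bij push_push[of v i "\<not> s"]
  by (cases "i = 2"; cases s) (auto simp: bij_betw_def f_inv_into_f inv_into_f_f in_free_group)

lemma act_push:
  assumes "fst ` set w \<subseteq> {..<3}" "v \<in> carrier F2"
  shows "act (push l w) v = act (l # w) v"
proof (cases w)
  case (Cons m u)
  obtain i s where l: "l = (i, s)" by force
  show ?thesis
  proof (cases "cancels l m")
    case True
    then have "m = (i, \<not> s)" using l by (cases m) auto
    then show ?thesis
      using Cons l assms act_closed[of u v] letter_act_inverse[of "act u v" i s] by (simp del: letter_act.simps)
  qed (use Cons in auto)
qed simp

lemma act_reduce:
  assumes "fst ` set w \<subseteq> {..<3}" "v \<in> carrier F2"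
  shows "act (reduce w) v = act w v"
  using assms(1)
proof (induction w)
  case (Cons l w)
  then have "fst ` set (reduce w) \<subseteq> {..<3}" using set_reduce[of w] by auto
  then have "act (push l (reduce w)) v = letter_act l (act (reduce w) v)"
    using act_push[OF _ assms(2)] by simp
  also have "act (reduce w) v = act w v" by (rule Cons.IH) (use Cons.prems in auto)
  finally show ?case by simp
qed simp

text \<open>On fiber words the action is left translation; applied to the empty word it recovers the
  reduced word, which is how elements of \<Gamma> are told apart below.\<close>

lemma act_F2: "fst ` set w \<subseteq> {..<2} \<Longrightarrow> v \<in> carrier F2 \<Longrightarrow> act w v = reduce (w @ v)"
  by (induction w) (auto simp: in_free_group reduce_id)

text \<open>Conjugating the left translation by a generator with \<phi> gives the left translation
  by its image under \<phi>, because \<phi> is a homomorphism; this is what the relator asks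
  for.\<close>

lemma act_relator:
  assumes i: "i < 2" and v: "v \<in> carrier F2" shows "act (relator i) v = v"
proof -
  let ?w = "\<phi> (gen i)"
  have w: "fst ` set (inv_word ?w) \<subseteq> {..<2}" using \<phi>_gen_letters[OF i] by (simp add: fst_set_inv_word)
  have wc: "?w \<in> carrier F2" using \<phi>_closed[OF gen_F2[OF i]] .
  let ?v = "reduce (inv_word ?w @ v)"
  have vc: "?v \<in> carrier F2" using w v by (intro reduce_in_free_group) (auto simp: in_free_group image_Un)
  define u where "u = inv_into (carrier F2) \<phi> ?v"
  have u: "u \<in> carrier F2" "\<phi> u = ?v"
    using vc \<phi>_bij unfolding u_def by (auto simp: bij_betw_def inv_into_into f_inv_into_f)
  have "act (relator i) v = \<phi> (push (i, True) u)"
    using i by (simp add: relator_def act_append act_F2[OF w v] u_def)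
  also have "push (i, True) u = reduce (gen i @ u)" using u(1) by (simp add: in_free_group reduce_id)
  also have "\<phi> (reduce (gen i @ u)) = reduce (?w @ ?v)" using \<phi>_mult[OF gen_F2[OF i] u(1)] u(2) by simp
  also have "\<dots> = reduce (reduce (?w @ inv_word ?w) @ v)"
    by (simp add: reduce_append_right reduce_append_left)
  also have "\<dots> = v" using v by (simp add: reduce_inv_word_right in_free_group reduce_id)
  finally show ?thesis .
qed

text \<open>The words that act as the identity form a subgroup, and it contains all conjugates of
  the relators. Hence the action descends to \<Gamma>.\<close>

lemma act_NR:
  assumes "n \<in> NR" "v \<in> carrier F2" shows "act n v = v"
proof -
  interpret F: group F3 by (rule group_free_group)
  define H where "H = {w \<in> carrier F3. \<forall>v\<in>carrier F2. act w v = v}"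
  have mult: "act (u \<otimes>\<^bsub>F3\<^esub> w) v = act u (act w v)"
    if "u \<in> carrier F3" "w \<in> carrier F3" "v \<in> carrier F2" for u w v
    using that by (simp add: free_group_mult act_reduce act_append in_free_group image_Un)
  have inv: "act (inv\<^bsub>F3\<^esub> u) (act u v) = v" "act u (act (inv\<^bsub>F3\<^esub> u) v) = v"
    if "u \<in> carrier F3" "v \<in> carrier F2" for u v
    using mult[of "inv\<^bsub>F3\<^esub> u" u v] mult[of u "inv\<^bsub>F3\<^esub> u" v] that by (simp_all add: free_group_one)
  have closed: "act u v \<in> carrier F2" if "u \<in> carrier F3" "v \<in> carrier F2" for u v
    using act_closed[of u v] that in_free_group[of u 3] by blast
  have "subgroup H F3"
  proof (rule F.subgroupI)
    have "\<one>\<^bsub>F3\<^esub> \<in> H" using F.one_closed by (auto simp: H_def free_group_one)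
    then show "H \<noteq> {}" by blast
  next
    fix u assume u: "u \<in> H"
    have "act (inv\<^bsub>F3\<^esub> u) v = v" if "v \<in> carrier F2" for v
      using inv(1)[of u v] u that by (simp add: H_def)
    then show "inv\<^bsub>F3\<^esub> u \<in> H" using u by (simp add: H_def)
  next
    fix u w assume "u \<in> H" "w \<in> H"
    then show "u \<otimes>\<^bsub>F3\<^esub> w \<in> H" by (simp add: H_def mult)
  qed (auto simp: H_def)
  moreover have "{g \<otimes>\<^bsub>F3\<^esub> r \<otimes>\<^bsub>F3\<^esub> inv\<^bsub>F3\<^esub> g | g r. g \<in> carrier F3 \<and> r \<in> set R} \<subseteq> H"
  proof
    fix w assume "w \<in> {g \<otimes>\<^bsub>F3\<^esub> r \<otimes>\<^bsub>F3\<^esub> inv\<^bsub>F3\<^esub> g | g r. g \<in> carrier F3 \<and> r \<in> set R}"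
    then obtain g r where g: "g \<in> carrier F3" "r \<in> set R"
      and w: "w = g \<otimes>\<^bsub>F3\<^esub> r \<otimes>\<^bsub>F3\<^esub> inv\<^bsub>F3\<^esub> g" by blast
    have r: "r \<in> carrier F3" using g R_closed by blast
    have "r = reduce (relator 0) \<or> r = reduce (relator 1)" using g(2) by (auto simp: R_eq)
    then obtain i where "i < 2" "r = reduce (relator i)" by (metis one_less_numeral_iff pos2 semiring_norm(76))
    then have ar: "act r v = v" if "v \<in> carrier F2" for v
      using act_reduce[OF relator_letters that] act_relator that by simp
    have "act w v = v" if "v \<in> carrier F2" for v
      using that g r by (simp add: w mult ar closed inv)
    then show "w \<in> H" using g r by (simp add: H_def w)
  qed
  ultimately have "NR \<subseteq> H"
    unfolding normal_closure_def by (rule F.generate_subgroup_incl[rotated])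
  then show ?thesis using assms by (auto simp: H_def)
qed

lemma cls_eq_act:
  assumes "cls u = cls w" "fst ` set u \<subseteq> {..<3}" "fst ` set w \<subseteq> {..<3}" "v \<in> carrier F2"
  shows "act u v = act w v"
proof -
  interpret F: group F3 by (rule group_free_group)
  have uw: "reduce u \<in> carrier F3" "reduce w \<in> carrier F3" using assms(2,3) reduce_in_free_group by auto
  have "reduce u \<in> NR #>\<^bsub>F3\<^esub> reduce w"
    using assms(1) F.rcos_self[OF uw(1)] NR_normal by (auto simp: cls_def word_class_def normal_def)
  then obtain n where n: "n \<in> NR" "reduce u = n \<otimes>\<^bsub>F3\<^esub> reduce w" by (auto simp: r_coset_def)
  have nc: "n \<in> carrier F3" using n(1) NR_normal by (meson normal_imp_subgroup subgroup.mem_carrier)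
  have "act (reduce u) v = act n (act (reduce w) v)"
    using nc uw assms(4) by (simp add: n(2) free_group_mult act_reduce act_append in_free_group image_Un)
  also have "\<dots> = act (reduce w) v"
    using uw assms(4) by (intro act_NR[OF n(1)] act_closed) (auto simp: in_free_group)
  finally show ?thesis using assms by (simp add: act_reduce)
qed

lemma Nil_F2: "[] \<in> carrier F2"
  by (simp add: in_free_group)

abbreviation "bd \<equiv> cls boundary_word"
abbreviation "mer \<equiv> cls (gen 2)"
abbreviation "ga \<equiv> cls (gen 0)"

lemma c_closed: "bd \<in> carrier \<Gamma>" and x_closed: "mer \<in> carrier \<Gamma>" and a_closed: "ga \<in> carrier \<Gamma>"
  by (rule cls_closed, simp add: boundary_word_def)+

lemma boundary_F2: "boundary_word \<in> carrier F2"
  by (simp add: in_free_group boundary_word_def reduced_Cons)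

lemma c_x_commute: "mer \<otimes>\<^bsub>\<Gamma>\<^esub> bd = bd \<otimes>\<^bsub>\<Gamma>\<^esub> mer"
proof -
  have "mer \<otimes>\<^bsub>\<Gamma>\<^esub> bd \<otimes>\<^bsub>\<Gamma>\<^esub> inv\<^bsub>\<Gamma>\<^esub> mer = bd"
    using cls_conj[OF boundary_F2] by (simp add: \<phi>_boundary)
  then show ?thesis
    using c_closed x_closed by (metis \<Gamma>.inv_solve_right' \<Gamma>.m_closed)
qed

text \<open>The powers of the commutator are already reduced as words, so acting on the empty word
  they return themselves.\<close>

lemma c_pow_ne_one: "k > 0 \<Longrightarrow> bd [^]\<^bsub>\<Gamma>\<^esub> (k::nat) \<noteq> \<one>\<^bsub>\<Gamma>\<^esub>"
proof
  assume k: "k > 0" and one: "bd [^]\<^bsub>\<Gamma>\<^esub> k = \<one>\<^bsub>\<Gamma>\<^esub>"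
  let ?w = "\<lambda>k. concat (replicate k boundary_word)"
  have letters: "fst ` set (?w k) \<subseteq> {..<3}" for k by (auto simp: boundary_word_def)
  have "cls (?w k) = bd [^]\<^bsub>\<Gamma>\<^esub> k" for k
  proof (induction k)
    case (Suc k)
    have "cls (boundary_word @ ?w k) = bd \<otimes>\<^bsub>\<Gamma>\<^esub> cls (?w k)"
      by (rule cls_append) (use letters in \<open>auto simp: boundary_word_def\<close>)
    then show ?case using Suc c_closed \<Gamma>.nat_pow_Suc2[of bd k] by simp
  qed (simp add: cls_Nil)
  then have "act (?w k) [] = act [] []"
    using one letters by (intro cls_eq_act) (auto simp: cls_Nil Nil_F2)
  moreover have "act (?w k) [] = ?w k" for k
  proof (induction k)
    case (Suc k)
    \<comment> \<open>A nonempty power begins with the letter of \<open>gen 0\<close>, while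
      \<open>boundary_word\<close> ends with \<open>gen_inv 1\<close>; nothing cancels at the
      junction.\<close>
    have "?w k = [] \<or> (\<exists>u. ?w k = (0, True) # u)" by (cases k) (auto simp: boundary_word_def)
    then show ?case using Suc by (auto simp: act_append) (auto simp: boundary_word_def)
  qed simp
  ultimately have "?w k = []" by simp
  then show False using k by (cases k) (auto simp: boundary_word_def)
qed

text \<open>Acting on the empty word, the two products give reduced words that differ in their
  second letter.\<close>

lemma c_conj_noncommute:
  "(ga \<otimes>\<^bsub>\<Gamma>\<^esub> bd \<otimes>\<^bsub>\<Gamma>\<^esub> inv\<^bsub>\<Gamma>\<^esub> ga) \<otimes>\<^bsub>\<Gamma>\<^esub> bd \<noteq> bd \<otimes>\<^bsub>\<Gamma>\<^esub> (ga \<otimes>\<^bsub>\<Gamma>\<^esub> bd \<otimes>\<^bsub>\<Gamma>\<^esub> inv\<^bsub>\<Gamma>\<^esub> ga)"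
proof
  let ?u = "gen 0 @ boundary_word @ gen_inv 0"
  have b: "fst ` set boundary_word \<subseteq> {..<3}" by (simp add: boundary_word_def)
  have letters: "fst ` set ?u \<subseteq> {..<3}" by (simp add: boundary_word_def)
  have u: "cls ?u = ga \<otimes>\<^bsub>\<Gamma>\<^esub> bd \<otimes>\<^bsub>\<Gamma>\<^esub> inv\<^bsub>\<Gamma>\<^esub> ga"
    using cls_append[of "gen 0" "boundary_word @ gen_inv 0"] cls_append[of boundary_word "gen_inv 0"]
      cls_gen_inv[of 0] a_closed c_closed b by (simp add: \<Gamma>.m_assoc)
  assume "(ga \<otimes>\<^bsub>\<Gamma>\<^esub> bd \<otimes>\<^bsub>\<Gamma>\<^esub> inv\<^bsub>\<Gamma>\<^esub> ga) \<otimes>\<^bsub>\<Gamma>\<^esub> bd = bd \<otimes>\<^bsub>\<Gamma>\<^esub> (ga \<otimes>\<^bsub>\<Gamma>\<^esub> bd \<otimes>\<^bsub>\<Gamma>\<^esub> inv\<^bsub>\<Gamma>\<^esub> ga)"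
  then have "cls (?u @ boundary_word) = cls (boundary_word @ ?u)"
    using cls_append[OF letters b] cls_append[OF b letters] u by simp
  then have "act (?u @ boundary_word) [] = act (boundary_word @ ?u) []"
    by (rule cls_eq_act) (simp_all add: boundary_word_def Nil_F2)
  then show False by (simp add: boundary_word_def)
qed

end

section \<open>The holonomy and the adjoint action\<close>

abbreviation coset4 :: "real^4^4 \<Rightarrow> (real^4^4) set" where
  "coset4 A \<equiv> scalars4 #>\<^bsub>GL4\<^esub> A"

lemma coset4_iff: "B \<in> coset4 A \<longleftrightarrow> (\<exists>c. c \<noteq> 0 \<and> B = c *\<^sub>R A)"
  by (auto simp: r_coset_def scalars4_def GL4_def smult_one_mult)

lemma self_in_coset4: "A \<in> coset4 A"
  unfolding coset4_iff by (rule exI[of _ 1]) simp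

lemma carrier_PGL4: "carrier PGL4 = coset4 ` {A. invertible A}"
  by (auto simp: PGL4_def FactGroup_def RCOSETS_def GL4_def)

lemma coset4_mult:
  assumes "invertible A" "invertible B"
  shows "coset4 A \<otimes>\<^bsub>PGL4\<^esub> coset4 B = coset4 (A ** B)"
  using normal.rcos_sum[OF normal_scalars4, of A B] assms
  by (simp add: PGL4_def FactGroup_def GL4_def)

lemma coset4_eq:
  assumes "A \<in> coset4 B" shows "coset4 A = coset4 B"
proof -
  obtain c where c: "c \<noteq> 0" "A = c *\<^sub>R B" using assms by (auto simp: coset4_iff)
  have "D \<in> coset4 A \<longleftrightarrow> D \<in> coset4 B" for D
  proof
    assume "D \<in> coset4 A"
    then obtain d where "d \<noteq> 0" "D = d *\<^sub>R A" by (auto simp: coset4_iff)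
    then have "D = (d * c) *\<^sub>R B" "d * c \<noteq> 0" using c by auto
    then show "D \<in> coset4 B" unfolding coset4_iff by blast
  next
    assume "D \<in> coset4 B"
    then obtain d where d: "d \<noteq> 0" "D = d *\<^sub>R B" by (auto simp: coset4_iff)
    then have "D = (d / c) *\<^sub>R A" "d / c \<noteq> 0" using c by auto
    then show "D \<in> coset4 A" unfolding coset4_iff by blast
  qed
  then show ?thesis by blast
qed

lemma matrix_inv_eq:
  fixes A B :: "real^4^4"
  assumes "A ** B = id4" "B ** A = id4" shows "matrix_inv A = B"
proof -
  have "A ** matrix_inv A = id4 \<and> matrix_inv A ** A = id4"
    unfolding matrix_inv_def by (rule someI[of _ B]) (use assms in simp)
  then have "(B ** A) ** matrix_inv A = B" by (simp flip: matrix_mul_assoc)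
  then show ?thesis by (simp add: assms(2))
qed

text \<open>The scalar by which the chosen representative differs from \<open>A\<close> cancels
  against its inverse.\<close>

lemma Ad_coset4:
  fixes A B :: "real^4^4"
  assumes AB: "A ** B = id4" "B ** A = id4" shows "Ad (coset4 A) X = A ** X ** B"
proof -
  have "(SOME D. D \<in> coset4 A) \<in> coset4 A" by (rule someI) (rule self_in_coset4)
  then obtain c where c: "c \<noteq> 0" "(SOME D. D \<in> coset4 A) = c *\<^sub>R A" by (auto simp: coset4_iff)
  have "matrix_inv (c *\<^sub>R A) = (1 / c) *\<^sub>R B"
    by (rule matrix_inv_eq) (use c AB in \<open>simp_all add: matmult.scaleR_left matmult.scaleR_right\<close>)
  then show ?thesis
    unfolding Ad_def Let_def c(2) using c(1) by (simp add: matmult.scaleR_left matmult.scaleR_right)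
qed

text \<open>The scalar between two representatives has square 1 because both preserve the form, and
  is positive because both have a positive entry at (4, 4).\<close>

lemma SO31_0_coset4_inj:
  assumes A: "A \<in> SO31_0" and B: "B \<in> SO31_0" and eq: "coset4 A = coset4 B"
  shows "A = B"
proof -
  obtain c where c: "A = c *\<^sub>R B" using self_in_coset4[of A] eq by (auto simp: coset4_iff)
  have P: "A \<in> SO31_plus" "B \<in> SO31_plus" using A B SO31_0_subset by auto
  have "lorentz_form (A *v axis 4 1) (A *v axis 4 1) = c * (c * lorentz_form (B *v axis 4 1) (B *v axis 4 1))"
    by (simp add: c flip: scaleR_matrix_vector_assoc)
  then have "c * c = 1"
    using O31_D[OF SO31_plus_D(1)[OF P(1)]] O31_D[OF SO31_plus_D(1)[OF P(2)]]
    by (simp add: lorentz_form_def axis_def)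
  moreover have "c > 0"
    using SO31_plus_D(3)[OF P(1)] SO31_plus_D(3)[OF P(2)] by (simp add: c zero_less_mult_iff)
  ultimately show ?thesis using c by (auto simp: square_eq_1_iff)
qed

locale torus_bundle_holonomy = punctured_torus_bundle +
  fixes \<rho> :: "word set \<Rightarrow> (real^4^4) set"
  assumes holonomy: "is_holonomy \<phi> \<rho>"
begin

text \<open>The lift of the holonomy to matrices in the identity component. It is unique by
  \<open>SO31_0_coset4_inj\<close>, hence multiplicative without any choice of signs.\<close>

definition L :: "word set \<Rightarrow> real^4^4" where
  "L g = (SOME A. A \<in> SO31_0 \<and> \<rho> g = coset4 A)"

lemma L: assumes "g \<in> carrier \<Gamma>" shows "L g \<in> SO31_0" "\<rho> g = coset4 (L g)"
proof -
  have "\<rho> g \<in> PSO31" using holonomy assms by (auto simp: is_holonomy_def)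
  then have "\<exists>A. A \<in> SO31_0 \<and> \<rho> g = coset4 A" by (auto simp: PSO31_def)
  then have "L g \<in> SO31_0 \<and> \<rho> g = coset4 (L g)" unfolding L_def by (rule someI_ex)
  then show "L g \<in> SO31_0" "\<rho> g = coset4 (L g)" by auto
qed

lemma \<rho>_inj: "g \<in> carrier \<Gamma> \<Longrightarrow> h \<in> carrier \<Gamma> \<Longrightarrow> \<rho> g = \<rho> h \<Longrightarrow> g = h"
proof -
  have "inj_on \<rho> (carrier \<Gamma>)" using holonomy by (simp add: is_holonomy_def)
  then show "g \<in> carrier \<Gamma> \<Longrightarrow> h \<in> carrier \<Gamma> \<Longrightarrow> \<rho> g = \<rho> h \<Longrightarrow> g = h" by (simp add: inj_onD)
qed

lemma L_inj: "g \<in> carrier \<Gamma> \<Longrightarrow> h \<in> carrier \<Gamma> \<Longrightarrow> L g = L h \<Longrightarrow> g = h"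
  by (rule \<rho>_inj) (simp_all add: L(2))

lemma L_plus: "g \<in> carrier \<Gamma> \<Longrightarrow> L g \<in> SO31_plus"
  using L(1) SO31_0_subset by blast

lemma L_invertible: "g \<in> carrier \<Gamma> \<Longrightarrow> invertible (L g)"
  using L_plus SO31_plus_D(1) O31_invertible by blast

lemma L_mult:
  assumes g: "g \<in> carrier \<Gamma>" and h: "h \<in> carrier \<Gamma>"
  shows "L (g \<otimes>\<^bsub>\<Gamma>\<^esub> h) = L g ** L h"
proof (rule SO31_0_coset4_inj)
  have "coset4 (L (g \<otimes>\<^bsub>\<Gamma>\<^esub> h)) = \<rho> (g \<otimes>\<^bsub>\<Gamma>\<^esub> h)" using L(2) g h by simp
  also have "\<dots> = \<rho> g \<otimes>\<^bsub>PGL4\<^esub> \<rho> h" using holonomy g h by (auto simp: is_holonomy_def hom_def)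
  also have "\<dots> = coset4 (L g ** L h)" using L(2) g h by (simp add: coset4_mult L_invertible)
  finally show "coset4 (L (g \<otimes>\<^bsub>\<Gamma>\<^esub> h)) = coset4 (L g ** L h)" .
qed (use g h L(1) SO31_0_mult in auto)

lemma L_one: "L \<one>\<^bsub>\<Gamma>\<^esub> = id4"
proof -
  have LL: "L \<one>\<^bsub>\<Gamma>\<^esub> ** L \<one>\<^bsub>\<Gamma>\<^esub> = L \<one>\<^bsub>\<Gamma>\<^esub>" using L_mult[of "\<one>\<^bsub>\<Gamma>\<^esub>" "\<one>\<^bsub>\<Gamma>\<^esub>"] by simp
  obtain B where B: "B ** L \<one>\<^bsub>\<Gamma>\<^esub> = id4" using L_invertible[of "\<one>\<^bsub>\<Gamma>\<^esub>"] by (auto simp: invertible_def)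
  have "B ** (L \<one>\<^bsub>\<Gamma>\<^esub> ** L \<one>\<^bsub>\<Gamma>\<^esub>) = id4" unfolding LL by (rule B)
  then show ?thesis by (simp add: matrix_mul_assoc B)
qed

lemma L_inv:
  assumes "g \<in> carrier \<Gamma>"
  shows "L g ** L (inv\<^bsub>\<Gamma>\<^esub> g) = id4" "L (inv\<^bsub>\<Gamma>\<^esub> g) ** L g = id4"
  using assms L_one by (simp_all flip: L_mult)

lemma Ad_\<rho>: "g \<in> carrier \<Gamma> \<Longrightarrow> Ad (\<rho> g) X = L g ** X ** L (inv\<^bsub>\<Gamma>\<^esub> g)"
  using Ad_coset4[OF L_inv] L(2) by simp

lemma Ad_mult:
  "g \<in> carrier \<Gamma> \<Longrightarrow> h \<in> carrier \<Gamma> \<Longrightarrow> Ad (\<rho> (g \<otimes>\<^bsub>\<Gamma>\<^esub> h)) X = Ad (\<rho> g) (Ad (\<rho> h) X)"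
  by (simp add: Ad_\<rho> L_mult \<Gamma>.inv_mult_group matrix_mul_assoc)

lemma Ad_one: "Ad (\<rho> \<one>\<^bsub>\<Gamma>\<^esub>) X = X"
  by (simp add: Ad_\<rho> L_one)

lemma Ad_inv: "g \<in> carrier \<Gamma> \<Longrightarrow> Ad (\<rho> g) (Ad (\<rho> (inv\<^bsub>\<Gamma>\<^esub> g)) X) = X"
  "g \<in> carrier \<Gamma> \<Longrightarrow> Ad (\<rho> (inv\<^bsub>\<Gamma>\<^esub> g)) (Ad (\<rho> g) X) = X"
  by (simp_all add: Ad_one flip: Ad_mult)

lemma linear_Ad: "g \<in> carrier \<Gamma> \<Longrightarrow> linear (Ad (\<rho> g))"
proof -
  assume g: "g \<in> carrier \<Gamma>"
  show ?thesis
    by (rule linearI) (simp_all add: Ad_\<rho> g matmult.add_left matmult.add_right matmult.scaleR_left matmult.scaleR_right)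
qed

lemma Ad_sl4: "g \<in> carrier \<Gamma> \<Longrightarrow> Y \<in> sl4 \<Longrightarrow> Ad (\<rho> g) Y \<in> sl4"
proof -
  assume g: "g \<in> carrier \<Gamma>" and Y: "Y \<in> sl4"
  have "trace (L g ** Y ** L (inv\<^bsub>\<Gamma>\<^esub> g)) = trace (L (inv\<^bsub>\<Gamma>\<^esub> g) ** (L g ** Y))"
    by (rule trace_mul_sym)
  also have "\<dots> = trace Y" by (simp add: matrix_mul_assoc L_inv g)
  finally show ?thesis using g Y by (simp add: Ad_\<rho> sl4_def)
qed

text \<open>An open set of the quotient topology that isolates the class of the identity has an open
  union of matrices, which contains a ball around \<open>id4\<close>.\<close>

lemma L_discrete: "\<exists>\<epsilon>>0. \<forall>g\<in>carrier \<Gamma>. norm (L g - id4) < \<epsilon> \<longrightarrow> g = \<one>\<^bsub>\<Gamma>\<^esub>"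
proof -
  let ?I = "\<rho> ` carrier \<Gamma>"
  have "openin (subtopology PGL4_topology ?I) {\<rho> \<one>\<^bsub>\<Gamma>\<^esub>}"
    using holonomy by (simp add: is_holonomy_def)
  then obtain U where U: "openin PGL4_topology U" "{\<rho> \<one>\<^bsub>\<Gamma>\<^esub>} = U \<inter> ?I"
    unfolding openin_subtopology by blast
  have U': "U \<subseteq> carrier PGL4" "open (\<Union> U)"
    using U(1) unfolding PGL4_topology_def topology_inverse'[OF istopology_PGL4] by auto
  have "\<rho> \<one>\<^bsub>\<Gamma>\<^esub> \<in> U" using U(2) by blast
  then have "id4 \<in> \<Union> U" using self_in_coset4[of id4] L(2)[of "\<one>\<^bsub>\<Gamma>\<^esub>"] by (auto simp: L_one)
  then obtain \<epsilon> where \<epsilon>: "\<epsilon> > 0" "ball id4 \<epsilon> \<subseteq> \<Union> U" using U'(2) open_contains_ball by blast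
  have "g = \<one>\<^bsub>\<Gamma>\<^esub>" if g: "g \<in> carrier \<Gamma>" "norm (L g - id4) < \<epsilon>" for g
  proof -
    have "L g \<in> ball id4 \<epsilon>" using g(2) by (simp add: dist_norm norm_minus_commute)
    then obtain Q where Q: "Q \<in> U" "L g \<in> Q" using \<epsilon>(2) by blast
    then obtain A where A: "Q = coset4 A" using U'(1) by (auto simp: carrier_PGL4)
    then have "Q = \<rho> g" using coset4_eq[of "L g" A] Q(2) L(2)[OF g(1)] by simp
    then have "\<rho> g \<in> U \<inter> ?I" using Q(1) g(1) by blast
    then have "\<rho> g = \<rho> \<one>\<^bsub>\<Gamma>\<^esub>" using U(2) by blast
    then show ?thesis by (rule \<rho>_inj[OF g(1) \<Gamma>.one_closed])
  qed
  then show ?thesis using \<epsilon>(1) by blast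
qed

end

locale fibered_holonomy = torus_bundle_holonomy +
  fixes \<alpha> :: "word set \<Rightarrow> int"
  assumes fibration: "is_fibration_hom \<phi> \<alpha>"
begin

lemma \<alpha>_mult: "g \<in> carrier \<Gamma> \<Longrightarrow> h \<in> carrier \<Gamma> \<Longrightarrow> \<alpha> (g \<otimes>\<^bsub>\<Gamma>\<^esub> h) = \<alpha> g + \<alpha> h"
  using fibration by (auto simp: is_fibration_hom_def hom_def integer_group_def)

lemma \<alpha>_F2: "w \<in> carrier F2 \<Longrightarrow> \<alpha> (cls w) = 0"
  using fibration cls_word[of w] free_group_mono[of w 2 3] by (auto simp: is_fibration_hom_def)

lemma \<alpha>_mer: "\<alpha> mer = 1"
  using fibration cls_word[of "gen 2"] by (auto simp: is_fibration_hom_def in_free_group reduced_Cons)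

lemma \<alpha>_one: "\<alpha> \<one>\<^bsub>\<Gamma>\<^esub> = 0"
  using \<alpha>_mult[of "\<one>\<^bsub>\<Gamma>\<^esub>" "\<one>\<^bsub>\<Gamma>\<^esub>"] by simp

lemma \<alpha>_pow: "g \<in> carrier \<Gamma> \<Longrightarrow> \<alpha> (g [^]\<^bsub>\<Gamma>\<^esub> (n::int)) = n * \<alpha> g"
proof (induction n rule: int_induct[of _ 0])
  case base
  then show ?case by (simp add: \<alpha>_one)
next
  case (step1 i)
  then show ?case
    using \<alpha>_mult[of "g [^]\<^bsub>\<Gamma>\<^esub> i" g] \<Gamma>.int_pow_mult[of g i 1] by (simp add: algebra_simps)
next
  case (step2 i)
  then show ?case
    using \<alpha>_mult[of "g [^]\<^bsub>\<Gamma>\<^esub> (i - 1)" g] \<Gamma>.int_pow_mult[of g "i - 1" 1] by (simp add: algebra_simps)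
qed

definition M :: "int \<Rightarrow> int \<Rightarrow> real^4^4" where
  "M m n = L (bd [^]\<^bsub>\<Gamma>\<^esub> m \<otimes>\<^bsub>\<Gamma>\<^esub> mer [^]\<^bsub>\<Gamma>\<^esub> n)"

lemma peripheral_closed: "bd [^]\<^bsub>\<Gamma>\<^esub> (m::int) \<otimes>\<^bsub>\<Gamma>\<^esub> mer [^]\<^bsub>\<Gamma>\<^esub> (n::int) \<in> carrier \<Gamma>"
  using c_closed x_closed by simp

lemma peripheral_mult:
  "bd [^]\<^bsub>\<Gamma>\<^esub> (m + m' :: int) \<otimes>\<^bsub>\<Gamma>\<^esub> mer [^]\<^bsub>\<Gamma>\<^esub> (n + n' :: int)
    = (bd [^]\<^bsub>\<Gamma>\<^esub> m \<otimes>\<^bsub>\<Gamma>\<^esub> mer [^]\<^bsub>\<Gamma>\<^esub> n) \<otimes>\<^bsub>\<Gamma>\<^esub> (bd [^]\<^bsub>\<Gamma>\<^esub> m' \<otimes>\<^bsub>\<Gamma>\<^esub> mer [^]\<^bsub>\<Gamma>\<^esub> n')"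
proof -
  have cl: "bd [^]\<^bsub>\<Gamma>\<^esub> (i::int) \<in> carrier \<Gamma>" "mer [^]\<^bsub>\<Gamma>\<^esub> (i::int) \<in> carrier \<Gamma>" for i
    using c_closed x_closed by auto
  have comm: "mer [^]\<^bsub>\<Gamma>\<^esub> n \<otimes>\<^bsub>\<Gamma>\<^esub> bd [^]\<^bsub>\<Gamma>\<^esub> m' = bd [^]\<^bsub>\<Gamma>\<^esub> m' \<otimes>\<^bsub>\<Gamma>\<^esub> mer [^]\<^bsub>\<Gamma>\<^esub> n"
    by (rule \<Gamma>.commute_int_pow[OF c_x_commute x_closed c_closed])
  have "(bd [^]\<^bsub>\<Gamma>\<^esub> m \<otimes>\<^bsub>\<Gamma>\<^esub> mer [^]\<^bsub>\<Gamma>\<^esub> n) \<otimes>\<^bsub>\<Gamma>\<^esub> (bd [^]\<^bsub>\<Gamma>\<^esub> m' \<otimes>\<^bsub>\<Gamma>\<^esub> mer [^]\<^bsub>\<Gamma>\<^esub> n')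
      = bd [^]\<^bsub>\<Gamma>\<^esub> m \<otimes>\<^bsub>\<Gamma>\<^esub> (mer [^]\<^bsub>\<Gamma>\<^esub> n \<otimes>\<^bsub>\<Gamma>\<^esub> bd [^]\<^bsub>\<Gamma>\<^esub> m') \<otimes>\<^bsub>\<Gamma>\<^esub> mer [^]\<^bsub>\<Gamma>\<^esub> n'"
    using cl by (simp add: \<Gamma>.m_assoc)
  also have "\<dots> = (bd [^]\<^bsub>\<Gamma>\<^esub> m \<otimes>\<^bsub>\<Gamma>\<^esub> bd [^]\<^bsub>\<Gamma>\<^esub> m') \<otimes>\<^bsub>\<Gamma>\<^esub> (mer [^]\<^bsub>\<Gamma>\<^esub> n \<otimes>\<^bsub>\<Gamma>\<^esub> mer [^]\<^bsub>\<Gamma>\<^esub> n')"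
    unfolding comm using cl by (simp add: \<Gamma>.m_assoc)
  finally show ?thesis using c_closed x_closed by (simp add: \<Gamma>.int_pow_mult)
qed

text \<open>The map \<alpha> sends the boundary curve to 0 and the meridian to 1, so it reads off
  \<open>n\<close>; the boundary curve has infinite order, so \<open>m\<close> vanishes as
  well.\<close>

lemma peripheral_free:
  assumes "bd [^]\<^bsub>\<Gamma>\<^esub> (m::int) \<otimes>\<^bsub>\<Gamma>\<^esub> mer [^]\<^bsub>\<Gamma>\<^esub> (n::int) = \<one>\<^bsub>\<Gamma>\<^esub>"
  shows "m = 0 \<and> n = 0"
proof -
  have "\<alpha> (bd [^]\<^bsub>\<Gamma>\<^esub> m \<otimes>\<^bsub>\<Gamma>\<^esub> mer [^]\<^bsub>\<Gamma>\<^esub> n) = m * \<alpha> bd + n * \<alpha> mer"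
    using c_closed x_closed by (simp add: \<alpha>_mult \<alpha>_pow)
  then have n: "n = 0" using \<alpha>_F2[OF boundary_F2] by (simp add: assms \<alpha>_one \<alpha>_mer)
  then have m1: "bd [^]\<^bsub>\<Gamma>\<^esub> m = \<one>\<^bsub>\<Gamma>\<^esub>" using assms c_closed by simp
  have "m = 0"
  proof (cases m rule: int_cases2)
    case (nonneg k)
    then have "bd [^]\<^bsub>\<Gamma>\<^esub> k = \<one>\<^bsub>\<Gamma>\<^esub>" using m1 by (simp only: int_pow_int)
    then have "k = 0" using c_pow_ne_one by blast
    then show ?thesis using nonneg by simp
  next
    case (nonpos k)
    then have "inv\<^bsub>\<Gamma>\<^esub> (bd [^]\<^bsub>\<Gamma>\<^esub> k) = \<one>\<^bsub>\<Gamma>\<^esub>"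
      using m1 by (simp only: \<Gamma>.int_pow_neg_int[OF c_closed])
    moreover have "bd [^]\<^bsub>\<Gamma>\<^esub> k \<in> carrier \<Gamma>" using c_closed by (rule \<Gamma>.nat_pow_closed)
    ultimately have "bd [^]\<^bsub>\<Gamma>\<^esub> k = \<one>\<^bsub>\<Gamma>\<^esub>" by (simp only: \<Gamma>.inv_eq_1_iff)
    then have "k = 0" using c_pow_ne_one by blast
    then show ?thesis using nonpos by simp
  qed
  with n show ?thesis by simp
qed

sublocale M: discrete_rank_two M
proof
  show "M (m + m') (n + n') = M m n ** M m' n'" for m m' n n'
    unfolding M_def peripheral_mult by (rule L_mult[OF peripheral_closed peripheral_closed])
  show "M m n \<in> SO31_plus" for m n unfolding M_def by (rule L_plus[OF peripheral_closed])
  obtain \<epsilon> where "\<epsilon> > 0" "\<forall>g\<in>carrier \<Gamma>. norm (L g - id4) < \<epsilon> \<longrightarrow> g = \<one>\<^bsub>\<Gamma>\<^esub>"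
    using L_discrete by blast
  then have "norm (M m n - id4) < \<epsilon> \<Longrightarrow> m = 0 \<and> n = 0" for m n
    using peripheral_free[of m n] peripheral_closed[of m n] unfolding M_def by simp
  then show "\<exists>\<epsilon>>0. \<forall>m n. norm (M m n - id4) < \<epsilon> \<longrightarrow> m = 0 \<and> n = 0"
    using \<open>\<epsilon> > 0\<close> by blast
qed

lemma M_gens: "M 1 0 = L bd" "M 0 1 = L mer" "M 0 (- 1) = L (inv\<^bsub>\<Gamma>\<^esub> mer)"
  using c_closed x_closed by (simp_all add: M_def \<Gamma>.int_pow_neg)

lemma Ad_mer_inv_nilpotent: "((\<lambda>Y. Ad (\<rho> (inv\<^bsub>\<Gamma>\<^esub> mer)) Y - Y) ^^ 5) Y = 0"
  using M.conjugation_M_nilpotent[of 0 "- 1" Y] x_closed by (simp add: M_gens Ad_\<rho>)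

lemma Ad_fixed_iff:
  assumes "g \<in> carrier \<Gamma>" shows "Ad (\<rho> g) Y = Y \<longleftrightarrow> Y ** L g = L g ** Y"
proof
  assume "Ad (\<rho> g) Y = Y"
  then have "L g ** Y ** L (inv\<^bsub>\<Gamma>\<^esub> g) ** L g = Y ** L g" by (simp add: Ad_\<rho> assms)
  then show "Y ** L g = L g ** Y" by (simp add: L_inv assms flip: matrix_mul_assoc)
next
  assume "Y ** L g = L g ** Y"
  then have "Ad (\<rho> g) Y = Y ** (L g ** L (inv\<^bsub>\<Gamma>\<^esub> g))" by (simp add: Ad_\<rho> assms matrix_mul_assoc)
  then show "Ad (\<rho> g) Y = Y" by (simp add: L_inv assms)
qed

lemma dim_Ad_bd_fixed: "dim {Y \<in> sl4. Ad (\<rho> bd) Y = Y} \<ge> 5"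
proof -
  have "{Y \<in> sl4. Ad (\<rho> bd) Y = Y} = {Y. trace Y = 0 \<and> Y ** M 1 0 = M 1 0 ** Y}"
    by (auto simp: sl4_def Ad_fixed_iff[OF c_closed] M_gens)
  then show ?thesis using M.dim_commutant by simp
qed

text \<open>An invariant matrix commutes with the whole holonomy group, so it is scalar, and its
  trace is zero. The conjugate of the boundary curve by \<open>ga\<close> supplies the noncommuting
  parabolic that \<open>centralizer_trivial\<close> asks for.\<close>

lemma invariants_trivial:
  assumes Y: "Y \<in> sl4" "\<And>g. g \<in> carrier \<Gamma> \<Longrightarrow> Ad (\<rho> g) Y = Y"
  shows "Y = 0"
proof -
  have "\<exists>l. Y = l *\<^sub>R id4"
  proof (rule M.centralizer_trivial[of "L ` carrier \<Gamma>" "L ga" "L (inv\<^bsub>\<Gamma>\<^esub> ga)"])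
    show "A ** B \<in> L ` carrier \<Gamma>" if "A \<in> L ` carrier \<Gamma>" "B \<in> L ` carrier \<Gamma>" for A B
      using that by (auto simp flip: L_mult)
    show "\<exists>B\<in>L ` carrier \<Gamma>. A ** B = id4 \<and> B ** A = id4" if A: "A \<in> L ` carrier \<Gamma>" for A
    proof -
      obtain g where g: "g \<in> carrier \<Gamma>" "A = L g" using A by blast
      then show ?thesis using L_inv[OF g(1)] by (intro bexI[of _ "L (inv\<^bsub>\<Gamma>\<^esub> g)"]) auto
    qed
    show "M m n \<in> L ` carrier \<Gamma>" for m n using peripheral_closed by (simp add: M_def)
    show "L ga ** M 1 0 ** L (inv\<^bsub>\<Gamma>\<^esub> ga) ** M 1 0 \<noteq> M 1 0 ** (L ga ** M 1 0 ** L (inv\<^bsub>\<Gamma>\<^esub> ga))"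
    proof
      let ?g = "ga \<otimes>\<^bsub>\<Gamma>\<^esub> bd \<otimes>\<^bsub>\<Gamma>\<^esub> inv\<^bsub>\<Gamma>\<^esub> ga"
      have cl: "?g \<in> carrier \<Gamma>" "bd \<in> carrier \<Gamma>" "ga \<in> carrier \<Gamma>" using c_closed a_closed by auto
      assume "L ga ** M 1 0 ** L (inv\<^bsub>\<Gamma>\<^esub> ga) ** M 1 0 = M 1 0 ** (L ga ** M 1 0 ** L (inv\<^bsub>\<Gamma>\<^esub> ga))"
      then have "L ?g ** L bd = L bd ** L ?g" using cl by (simp add: M_gens L_mult)
      then have "L (?g \<otimes>\<^bsub>\<Gamma>\<^esub> bd) = L (bd \<otimes>\<^bsub>\<Gamma>\<^esub> ?g)"
        using L_mult[OF cl(1,2)] L_mult[OF cl(2,1)] by simp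
      then have "?g \<otimes>\<^bsub>\<Gamma>\<^esub> bd = bd \<otimes>\<^bsub>\<Gamma>\<^esub> ?g"
        by (rule L_inj[rotated 2]) (use cl in auto)
      then show False using c_conj_noncommute by simp
    qed
    show "A \<in> SO31_plus" if "A \<in> L ` carrier \<Gamma>" for A using that L_plus by blast
    show "L ga \<in> L ` carrier \<Gamma>" "L (inv\<^bsub>\<Gamma>\<^esub> ga) \<in> L ` carrier \<Gamma>" using a_closed by auto
    show "L ga ** L (inv\<^bsub>\<Gamma>\<^esub> ga) = id4" "L (inv\<^bsub>\<Gamma>\<^esub> ga) ** L ga = id4" using L_inv[OF a_closed] by auto
    show "Y ** A = A ** Y" if A: "A \<in> L ` carrier \<Gamma>" for A
    proof -
      obtain g where g: "g \<in> carrier \<Gamma>" "A = L g" using A by blast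
      show ?thesis unfolding g(2) by (rule iffD1[OF Ad_fixed_iff[OF g(1)] Y(2)[OF g(1)]])
    qed
  qed
  then obtain l where l: "Y = l *\<^sub>R id4" by blast
  then have "4 * l = 0" using Y(1) by (simp add: sl4_def trace_scaleR trace_I)
  then show ?thesis by (simp add: l)
qed

end

section \<open>Crossed homomorphisms\<close>

lemma subspace_sl4: "subspace sl4"
  by (auto simp: subspace_def sl4_def trace_add trace_scaleR) (simp add: trace_def)

lemma sl4_basis_in_sl4: "m < 15 \<Longrightarrow> sl4_basis m \<in> sl4"
proof -
  assume "m < 15"
  have tr: "trace (mat_unit i j) = (if i = j then 1 else 0)" for i j
    by (cases "i = j") (auto simp: trace_def mat_unit_def intro!: sum.neutral)
  show ?thesis
    by (simp add: sl4_basis_def sl4_def Let_def tr trace_sub)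
qed

lemma linear_sl4_coord: "linear (sl4_coord m)"
  by (rule linearI) (simp_all add: sl4_coord_def)

lemma dim_sl4: "dim sl4 = 15"
proof (rule dim_unique)
  let ?B = "sl4_basis ` {..<15}"
  have inj: "inj_on sl4_basis {..<15}"
  proof (rule inj_onI)
    fix m m' assume "m \<in> {..<15}" "m' \<in> {..<15}" "sl4_basis m = sl4_basis m'"
    then show "m = m'" using sl4_coord_basis[of m m] sl4_coord_basis[of m m'] by (auto split: if_splits)
  qed
  show "?B \<subseteq> sl4" using sl4_basis_in_sl4 by auto
  show "card ?B = 15" using inj by (simp add: card_image)
  show "sl4 \<subseteq> span ?B"
  proof
    fix X assume "X \<in> sl4"
    then have "X = (\<Sum>m<15. sl4_coord m X *\<^sub>R sl4_basis m)" by (rule sl4_expansion)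
    also have "\<dots> \<in> span ?B" by (intro span_sum span_scale span_base) auto
    finally show "X \<in> span ?B" .
  qed
  show "independent ?B"
    unfolding independent_explicit
  proof (intro conjI allI impI ballI)
    fix c X assume 0: "(\<Sum>X\<in>?B. c X *\<^sub>R X) = 0" and "X \<in> ?B"
    then obtain m where m: "m < 15" "X = sl4_basis m" by auto
    have "(\<Sum>j<15. c (sl4_basis j) *\<^sub>R sl4_basis j) = 0"
      using 0 by (simp add: sum.reindex[OF inj])
    then have "sl4_coord m (\<Sum>j<15. c (sl4_basis j) *\<^sub>R sl4_basis j) = 0"
      using linear_sl4_coord linear_0 by metis
    then have "(\<Sum>j<15. c (sl4_basis j) * sl4_coord m (sl4_basis j)) = 0"
      by (simp add: linear_sum[OF linear_sl4_coord] linear_scale[OF linear_sl4_coord])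
    then have "(\<Sum>j<15. if j = m then c (sl4_basis j) else 0) = 0"
    proof -
      have "(\<Sum>j<15. c (sl4_basis j) * sl4_coord m (sl4_basis j)) = (\<Sum>j<15. if j = m then c (sl4_basis j) else 0)"
        using m(1) by (intro sum.cong) (auto simp: sl4_coord_basis)
      then show ?thesis using \<open>(\<Sum>j<15. c (sl4_basis j) * sl4_coord m (sl4_basis j)) = 0\<close> by simp
    qed
    then show "c X = 0" using m by simp
  qed simp
qed

text \<open>The orthogonal complement of the kernel inside \<open>S\<close> maps bijectively onto
  the image.\<close>

lemma dim_kernel_image:
  fixes f :: "'a::euclidean_space \<Rightarrow> 'b::euclidean_space"
  assumes f: "linear f" and S: "subspace S"
  shows "dim {x \<in> S. f x = 0} + dim (f ` S) = dim S"
proof -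
  define K where "K = {x \<in> S. f x = 0}"
  define C where "C = {y \<in> S. \<forall>x\<in>K. Linear_Algebra.orthogonal x y}"
  have K: "subspace K"
    unfolding K_def using S f by (auto simp: subspace_def linear_0 linear_add linear_scale)
  have C: "subspace C"
    unfolding C_def using S by (auto simp: subspace_def orthogonal_clauses)
  have "inj_on f C"
  proof (rule inj_onI)
    fix x y assume xy: "x \<in> C" "y \<in> C" "f x = f y"
    have "x - y \<in> C" using subspace_diff[OF C xy(1,2)] .
    moreover from this have "x - y \<in> K" using xy(3) f by (simp add: C_def K_def linear_diff)
    ultimately have "Linear_Algebra.orthogonal (x - y) (x - y)" by (auto simp: C_def)
    then show "x = y" by (simp add: Linear_Algebra.orthogonal_def)
  qed
  then have "inj_on f (span C)" using C by (simp add: span_eq_iff[THEN iffD2])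
  then have "dim (f ` C) = dim C" by (rule dim_image_eq[OF f])
  moreover have "f ` C = f ` S"
  proof
    show "f ` S \<subseteq> f ` C"
    proof
      fix z assume "z \<in> f ` S"
      then obtain x where x: "x \<in> S" "z = f x" by blast
      obtain y w where yw: "y \<in> span K" "\<And>u. u \<in> span K \<Longrightarrow> Linear_Algebra.orthogonal w u" "x = y + w"
        using orthogonal_subspace_decomp_exists[of K x] by blast
      have yK: "y \<in> K" using yw(1) K by (simp add: span_eq_iff[THEN iffD2])
      have "w = x - y" using yw(3) by simp
      then have "w \<in> S" using x yK S by (auto simp: K_def subspace_diff)
      then have "w \<in> C"
        using yw(2) span_base by (auto simp: C_def Linear_Algebra.orthogonal_commute)
      moreover have "f w = z" using yK x(2) yw(3) f by (simp add: K_def linear_add)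
      ultimately show "z \<in> f ` C" by blast
    qed
  qed (auto simp: C_def)
  moreover have "dim C + dim K = dim S"
    unfolding C_def by (rule dim_subspace_orthogonal_to_vectors) (use K S in \<open>auto simp: K_def\<close>)
  ultimately show ?thesis unfolding K_def by simp
qed

text \<open>Pairing \<open>Z\<close> with its transpose gives the sum of the squares of its
  entries.\<close>

lemma trace_form_nondegenerate:
  assumes Z: "Z \<in> sl4" and tr: "\<And>Y. Y \<in> sl4 \<Longrightarrow> trace (Z ** Y) = 0"
  shows "Z = 0"
proof -
  have "trace (Z ** Finite_Cartesian_Product.transpose Z) = 0"
    by (rule tr) (use Z in \<open>simp add: sl4_def trace_def Finite_Cartesian_Product.transpose_def\<close>)
  then have "(\<Sum>i\<in>UNIV. \<Sum>j\<in>UNIV. (Z $ i $ j)\<^sup>2) = 0"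
    by (simp add: trace_def matrix_matrix_mult_def Finite_Cartesian_Product.transpose_def power2_eq_square)
  then have "Z $ i $ j = 0" for i j
    by (simp add: sum_nonneg_eq_0_iff sum_nonneg)
  then show ?thesis by (simp add: Finite_Cartesian_Product.vec_eq_iff)
qed

context fibered_holonomy
begin

text \<open>The crossed homomorphism of the free group with values \<open>e i\<close> at the
  generators. Its value at an inverse letter is forced by the value 0 at the product of the letter
  with its inverse.\<close>

fun cz :: "(nat \<Rightarrow> real^4^4) \<Rightarrow> word \<Rightarrow> real^4^4" where
  "cz e [] = 0"
| "cz e ((i, s) # w) = (if s then e i else - Ad (\<rho> (cls (gen_inv i))) (e i)) + Ad (\<rho> (cls [(i, s)])) (cz e w)"

abbreviation "lt3 w \<equiv> fst ` set w \<subseteq> {..<3}"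

lemma linear_Ad_cls: "lt3 w \<Longrightarrow> linear (Ad (\<rho> (cls w)))"
  by (rule linear_Ad) (rule cls_closed)

lemma Ad_cls_append: "lt3 u \<Longrightarrow> lt3 w \<Longrightarrow> Ad (\<rho> (cls (u @ w))) Y = Ad (\<rho> (cls u)) (Ad (\<rho> (cls w)) Y)"
  by (simp only: cls_append Ad_mult cls_closed)

lemma cz_append: "lt3 u \<Longrightarrow> lt3 w \<Longrightarrow> cz e (u @ w) = cz e u + Ad (\<rho> (cls u)) (cz e w)"
proof (induction u)
  case Nil
  then show ?case by (simp add: cls_Nil Ad_one)
next
  case (Cons l u)
  obtain i s where l: "l = (i, s)" by force
  have u: "lt3 u" "lt3 [(i, s)]" using Cons.prems l by auto
  have "Ad (\<rho> (cls ([(i, s)] @ u))) (cz e w) = Ad (\<rho> (cls [(i, s)])) (Ad (\<rho> (cls u)) (cz e w))"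
    by (rule Ad_cls_append[OF u(2,1)])
  then show ?case
    using Cons.IH[OF u(1) Cons.prems(2)] linear_Ad_cls[OF u(2)] by (simp add: l linear_add)
qed

lemma cz_cancel:
  assumes "i < 3" shows "cz e [(i, s), (i, \<not> s)] = 0"
proof -
  have l: "lt3 [(i, t)]" for t using assms by simp
  have gi: "cls (gen_inv i) = inv\<^bsub>\<Gamma>\<^esub> cls (gen i)" by (rule cls_gen_inv[OF assms])
  have "linear (Ad (\<rho> (cls (gen i))))" "linear (Ad (\<rho> (cls (gen_inv i))))" by (rule linear_Ad_cls[OF l])+
  then show ?thesis
    using cls_closed[OF l[of True]] by (cases s) (simp_all add: gi linear_neg linear_0 Ad_inv)
qed

lemma cz_push:
  assumes "fst l < 3" "lt3 w" shows "cz e (push l w) = cz e (l # w)"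
proof (cases w)
  case (Cons m u)
  obtain i s where l: "l = (i, s)" by force
  show ?thesis
  proof (cases "cancels l m")
    case True
    then have m: "m = (i, \<not> s)" using l by (cases m) auto
    have i: "i < 3" "lt3 [(i, s), (i, \<not> s)]" "lt3 u" using assms l Cons by auto
    have "cz e ([(i, s), (i, \<not> s)] @ u) = cz e [(i, s), (i, \<not> s)] + Ad (\<rho> (cls [(i, s), (i, \<not> s)])) (cz e u)"
      by (rule cz_append[OF i(2,3)])
    moreover have "cls [(i, s), (i, \<not> s)] = \<one>\<^bsub>\<Gamma>\<^esub>"
      using cls_reduce[of "[(i, s), (i, \<not> s)]"] by (simp add: cls_Nil)
    ultimately have "cz e ([(i, s), (i, \<not> s)] @ u) = cz e u"
      by (simp only: cz_cancel[OF i(1)] Ad_one add_0_left)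
    moreover have "push l w = u" using True Cons by simp
    moreover have "l # w = [(i, s), (i, \<not> s)] @ u" using l m Cons by simp
    ultimately show ?thesis by (simp only:)
  qed (use Cons in auto)
qed simp

lemma lt3_reduce: "lt3 w \<Longrightarrow> lt3 (reduce w)"
  using set_reduce[of w] by auto

lemma cz_reduce: "lt3 w \<Longrightarrow> cz e (reduce w) = cz e w"
proof (induction w)
  case (Cons l w)
  obtain i s where l: "l = (i, s)" by force
  have "cz e (reduce (l # w)) = cz e (l # reduce w)"
    using cz_push[of l "reduce w"] lt3_reduce[of w] Cons.prems by simp
  then show ?case using Cons by (simp add: l)
qed simp

lemma cz_inv_word: "lt3 w \<Longrightarrow> cz e (inv_word w) = - Ad (\<rho> (inv\<^bsub>\<Gamma>\<^esub> cls w)) (cz e w)"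
  using cz_append[of "inv_word w" w e] cz_reduce[of "inv_word w @ w" e]
  by (simp add: fst_set_inv_word reduce_inv_word cls_inv_word image_Un eq_neg_iff_add_eq_0)

lemma cz_sl4: "(\<And>i. i < 3 \<Longrightarrow> e i \<in> sl4) \<Longrightarrow> lt3 w \<Longrightarrow> cz e w \<in> sl4"
proof (induction w)
  case Nil
  then show ?case using subspace_0[OF subspace_sl4] by simp
next
  case (Cons l w)
  obtain i s where l: "l = (i, s)" by force
  have i: "i < 3" using Cons.prems l by simp
  have "Ad (\<rho> (cls [(i, t)])) Y \<in> sl4" if "Y \<in> sl4" for Y t
    by (rule Ad_sl4[OF cls_closed that]) (use i in simp)
  then show ?case
    using Cons i by (auto simp: l intro!: subspace_add[OF subspace_sl4] subspace_diff[OF subspace_sl4])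
qed

lemma cz_add: "lt3 w \<Longrightarrow> cz (\<lambda>i. e i + e' i) w = cz e w + cz e' w"
proof (induction w)
  case (Cons l w)
  obtain i s where l: "l = (i, s)" by force
  have "lt3 [(i, t)]" for t using Cons.prems l by simp
  then have "linear (Ad (\<rho> (cls [(i, t)])))" for t by (rule linear_Ad_cls)
  then show ?case using Cons by (simp add: l linear_add)
qed simp

lemma cz_scale: "lt3 w \<Longrightarrow> cz (\<lambda>i. r *\<^sub>R e i) w = r *\<^sub>R cz e w"
proof (induction w)
  case (Cons l w)
  obtain i s where l: "l = (i, s)" by force
  have "lt3 [(i, t)]" for t using Cons.prems l by simp
  then have "linear (Ad (\<rho> (cls [(i, t)])))" for t by (rule linear_Ad_cls)
  then show ?case using Cons by (simp add: l linear_scale scaleR_right_distrib)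
qed simp

lemma cz_cong: "(\<And>i. i < n \<Longrightarrow> e i = e' i) \<Longrightarrow> fst ` set w \<subseteq> {..<n} \<Longrightarrow> cz e w = cz e' w"
  by (induction w) auto

lemma cz_coboundary:
  "lt3 w \<Longrightarrow> cz (\<lambda>i. Ad (\<rho> (cls (gen i))) Y - Y) w = Ad (\<rho> (cls w)) Y - Y"
proof (induction w)
  case Nil
  then show ?case by (simp add: cls_Nil Ad_one)
next
  case (Cons l w)
  obtain i s where l: "l = (i, s)" by force
  have lt: "lt3 [(i, t)]" "i < 3" "lt3 w" for t using Cons.prems l by auto
  have lin: "linear (Ad (\<rho> (cls [(i, t)])))" for t by (rule linear_Ad_cls[OF lt(1)])
  have "cls (gen_inv i) = inv\<^bsub>\<Gamma>\<^esub> cls (gen i)" by (rule cls_gen_inv[OF lt(2)])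
  then have "Ad (\<rho> (cls (gen_inv i))) (Ad (\<rho> (cls (gen i))) Y) = Y"
    using cls_closed[OF lt(1)[of True]] by (simp add: Ad_inv)
  then have g: "(if s then Ad (\<rho> (cls (gen i))) Y - Y else - Ad (\<rho> (cls (gen_inv i))) (Ad (\<rho> (cls (gen i))) Y - Y))
      = Ad (\<rho> (cls [(i, s)])) Y - Y"
    using lin[of False] by (simp add: linear_diff)
  have "Ad (\<rho> (cls (l # w))) Y = Ad (\<rho> (cls [(i, s)])) (Ad (\<rho> (cls w)) Y)"
    using Ad_cls_append[OF lt(1,3), of s Y] by (simp add: l)
  then show ?case
    unfolding l cz.simps g Cons.IH[OF lt(3)] using lin[of s] by (simp add: linear_diff)
qed

abbreviation "Z1 \<equiv> cocycles1 \<Gamma> (\<lambda>g. Ad (\<rho> g)) sl4"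

lemma Z1_mult: "d \<in> Z1 \<Longrightarrow> g \<in> carrier \<Gamma> \<Longrightarrow> h \<in> carrier \<Gamma> \<Longrightarrow> d (g \<otimes>\<^bsub>\<Gamma>\<^esub> h) = d g + Ad (\<rho> g) (d h)"
  by (simp add: cocycles1_def)

lemma Z1_sl4: "d \<in> Z1 \<Longrightarrow> g \<in> carrier \<Gamma> \<Longrightarrow> d g \<in> sl4"
  by (simp add: cocycles1_def)

lemma Z1_cls:
  assumes d: "d \<in> Z1" shows "lt3 w \<Longrightarrow> d (cls w) = cz (\<lambda>i. d (cls (gen i))) w"
proof (induction w)
  case Nil
  have "d (\<one>\<^bsub>\<Gamma>\<^esub> \<otimes>\<^bsub>\<Gamma>\<^esub> \<one>\<^bsub>\<Gamma>\<^esub>) = d \<one>\<^bsub>\<Gamma>\<^esub> + d \<one>\<^bsub>\<Gamma>\<^esub>"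
    using Z1_mult[OF d, of "\<one>\<^bsub>\<Gamma>\<^esub>" "\<one>\<^bsub>\<Gamma>\<^esub>"] by (simp add: Ad_one)
  then show ?case by (simp add: cls_Nil)
next
  case (Cons l w)
  have one: "d \<one>\<^bsub>\<Gamma>\<^esub> = 0"
    using Z1_mult[OF d, of "\<one>\<^bsub>\<Gamma>\<^esub>" "\<one>\<^bsub>\<Gamma>\<^esub>"] by (simp add: Ad_one)
  obtain i s where l: "l = (i, s)" by force
  have lt: "lt3 [(i, t)]" "i < 3" "lt3 w" for t using Cons.prems l by auto
  have gc: "cls (gen i) \<in> carrier \<Gamma>" by (rule cls_closed[OF lt(1)])
  have gi: "cls (gen_inv i) = inv\<^bsub>\<Gamma>\<^esub> cls (gen i)" by (rule cls_gen_inv[OF lt(2)])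
  have "d (inv\<^bsub>\<Gamma>\<^esub> cls (gen i) \<otimes>\<^bsub>\<Gamma>\<^esub> cls (gen i)) = d (inv\<^bsub>\<Gamma>\<^esub> cls (gen i)) + Ad (\<rho> (inv\<^bsub>\<Gamma>\<^esub> cls (gen i))) (d (cls (gen i)))"
    using gc by (intro Z1_mult[OF d]) auto
  then have "d (cls (gen_inv i)) = - Ad (\<rho> (cls (gen_inv i))) (d (cls (gen i)))"
    unfolding gi using gc by (simp add: one eq_neg_iff_add_eq_0)
  then have g: "(if s then d (cls (gen i)) else - Ad (\<rho> (cls (gen_inv i))) (d (cls (gen i)))) = d (cls [(i, s)])"
    by simp
  have "d (cls ([(i, s)] @ w)) = d (cls [(i, s)]) + Ad (\<rho> (cls [(i, s)])) (d (cls w))"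
    unfolding cls_append[OF lt(1,3)] by (rule Z1_mult[OF d cls_closed[OF lt(1)] cls_closed[OF lt(3)]])
  then show ?case unfolding l cz.simps g Cons.IH[OF lt(3)] by simp
qed

end

section \<open>The monodromy on the cohomology of the fiber\<close>

context fibered_holonomy
begin

abbreviation "gb \<equiv> cls (gen 1)"

definition mer_inv :: "real^4^4 \<Rightarrow> real^4^4" where
  "mer_inv Y = Ad (\<rho> (inv\<^bsub>\<Gamma>\<^esub> mer)) Y"

definition D :: "real^4^4 \<Rightarrow> real^4^4" where
  "D Y = mer_inv Y - Y"

text \<open>A cocycle of the free group \<open>F2\<close> is determined by its values on the two generators, hence
  the cocycles are the pairs in \<open>V\<close>.\<close>

definition V :: "((real^4^4) \<times> (real^4^4)) set" where
  "V = sl4 \<times> sl4"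

text \<open>The value at the meridian is a filler: only words of the fiber are evaluated with
  it.\<close>

definition vals :: "(real^4^4) \<times> (real^4^4) \<Rightarrow> nat \<Rightarrow> real^4^4" where
  "vals d i = (if i = 0 then fst d else if i = 1 then snd d else 0)"

text \<open>The action of the meridian on cocycles: the new cocycle sends w to the inverse of x
  applied to the old value at x w \<open>x\<^sup>-\<^sup>1\<close>, that is, at
  \<open>\<phi> w\<close>. Here it is recorded on the two generators; \<open>cz_T\<close> gives it
  on all words.\<close>

definition T :: "(real^4^4) \<times> (real^4^4) \<Rightarrow> (real^4^4) \<times> (real^4^4)" where
  "T d = (mer_inv (cz (vals d) (\<phi> (gen 0))), mer_inv (cz (vals d) (\<phi> (gen 1))))"

definition N :: "(real^4^4) \<times> (real^4^4) \<Rightarrow> (real^4^4) \<times> (real^4^4)" where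
  "N d = T d - d"

definition cobd :: "real^4^4 \<Rightarrow> (real^4^4) \<times> (real^4^4)" where
  "cobd Y = (Ad (\<rho> ga) Y - Y, Ad (\<rho> gb) Y - Y)"

definition ev :: "(real^4^4) \<times> (real^4^4) \<Rightarrow> real^4^4" where
  "ev d = cz (vals d) boundary_word"

lemma gb_closed: "gb \<in> carrier \<Gamma>"
  by (rule cls_closed) simp

lemma mer_inv_closed: "inv\<^bsub>\<Gamma>\<^esub> mer \<in> carrier \<Gamma>"
  using x_closed by simp

lemma linear_mer_inv: "linear mer_inv"
  using linear_Ad[OF mer_inv_closed] by (simp add: mer_inv_def[abs_def])

lemma D_nilpotent: assumes "k \<ge> 5" shows "(D ^^ k) Y = 0"
proof -
  have "(D ^^ 5) Z = 0" for Z
    using Ad_mer_inv_nilpotent[of Z] by (simp add: D_def[abs_def] mer_inv_def)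
  moreover have "(D ^^ k) Y = (D ^^ (5 + (k - 5))) Y" using assms by simp
  ultimately show ?thesis unfolding funpow_add by simp
qed

lemma mer_inv_sl4: "Y \<in> sl4 \<Longrightarrow> mer_inv Y \<in> sl4"
  unfolding mer_inv_def by (rule Ad_sl4[OF mer_inv_closed])

lemma D_sl4: "Y \<in> sl4 \<Longrightarrow> D Y \<in> sl4"
  unfolding D_def by (intro subspace_diff[OF subspace_sl4] mer_inv_sl4)

lemma lt3_F2: "w \<in> carrier F2 \<Longrightarrow> lt3 w"
  by (auto simp: in_free_group)

lemma lt3_\<phi>: "w \<in> carrier F2 \<Longrightarrow> lt3 (\<phi> w)"
  by (rule lt3_F2[OF \<phi>_closed])

text \<open>In \<Gamma> the inverse meridian moves past \<open>cls (\<phi> u)\<close> and turns it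
  into \<open>cls u\<close>.\<close>

lemma mer_inv_Ad_\<phi>:
  assumes u: "u \<in> carrier F2"
  shows "mer_inv (Ad (\<rho> (cls (\<phi> u))) Y) = Ad (\<rho> (cls u)) (mer_inv Y)"
proof -
  have cl: "cls u \<in> carrier \<Gamma>" "cls (\<phi> u) \<in> carrier \<Gamma>" "mer \<in> carrier \<Gamma>"
    using cls_closed[OF lt3_F2[OF u]] cls_closed[OF lt3_\<phi>[OF u]] x_closed by auto
  have "inv\<^bsub>\<Gamma>\<^esub> mer \<otimes>\<^bsub>\<Gamma>\<^esub> cls (\<phi> u) = inv\<^bsub>\<Gamma>\<^esub> mer \<otimes>\<^bsub>\<Gamma>\<^esub> (mer \<otimes>\<^bsub>\<Gamma>\<^esub> (cls u \<otimes>\<^bsub>\<Gamma>\<^esub> inv\<^bsub>\<Gamma>\<^esub> mer))"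
    unfolding cls_conj[OF u, symmetric] using cl by (simp add: \<Gamma>.m_assoc)
  also have "\<dots> = cls u \<otimes>\<^bsub>\<Gamma>\<^esub> inv\<^bsub>\<Gamma>\<^esub> mer"
    using cl by (simp add: \<Gamma>.inv_solve_left')
  finally have "Ad (\<rho> (inv\<^bsub>\<Gamma>\<^esub> mer \<otimes>\<^bsub>\<Gamma>\<^esub> cls (\<phi> u))) Y = Ad (\<rho> (cls u \<otimes>\<^bsub>\<Gamma>\<^esub> inv\<^bsub>\<Gamma>\<^esub> mer)) Y" by simp
  then show ?thesis unfolding mer_inv_def using cl by (simp add: Ad_mult)
qed

lemma vals_linear: "vals (d + d') = (\<lambda>i. vals d i + vals d' i)" "vals (r *\<^sub>R d) = (\<lambda>i. r *\<^sub>R vals d i)"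
  by (auto simp: vals_def fun_eq_iff)

lemma linear_cz: "lt3 w \<Longrightarrow> linear (\<lambda>d. cz (vals d) w)"
  by (rule linearI) (simp_all add: vals_linear cz_add cz_scale)

lemma gen_F2_01: "gen 0 \<in> carrier F2" "gen 1 \<in> carrier F2"
  by (rule gen_F2, simp)+

lemma linear_T: "linear T"
proof -
  have "linear (\<lambda>d. mer_inv (cz (vals d) w))" if "lt3 w" for w
    using linear_compose[OF linear_cz[OF that] linear_mer_inv] by (simp add: comp_def)
  then have f: "linear (\<lambda>d. mer_inv (cz (vals d) (\<phi> (gen 0))))" "linear (\<lambda>d. mer_inv (cz (vals d) (\<phi> (gen 1))))"
    using lt3_\<phi> gen_F2_01 by blast+
  show ?thesis
    by (rule linearI) (simp_all only: T_def linear_add[OF f(1)] linear_add[OF f(2)] linear_scale[OF f(1)]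
        linear_scale[OF f(2)] add_Pair scaleR_Pair)
qed

lemma linear_N: "linear N"
  unfolding N_def[abs_def] by (intro linear_compose_sub linear_T linear_id[unfolded id_def])

lemma linear_ev: "linear ev"
  unfolding ev_def[abs_def] by (rule linear_cz[OF lt3_F2[OF boundary_F2]])

lemma linear_cobd: "linear cobd"
  using linear_Ad[OF a_closed] linear_Ad[OF gb_closed]
  by (intro linearI) (simp_all add: cobd_def linear_add linear_scale algebra_simps)

lemma subspace_V: "subspace V"
  unfolding V_def by (intro subspace_Times subspace_sl4)

lemma dim_V: "dim V = 30"
  unfolding V_def using dim_Times[OF subspace_sl4 subspace_sl4] by (simp add: dim_sl4)

lemma vals_sl4: "d \<in> V \<Longrightarrow> vals d i \<in> sl4"
  using subspace_0[OF subspace_sl4] by (auto simp: V_def vals_def)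

lemma T_V: "d \<in> V \<Longrightarrow> T d \<in> V"
proof -
  assume d: "d \<in> V"
  have "mer_inv (cz (vals d) (\<phi> (gen i))) \<in> sl4" if "i < 2" for i
    by (rule mer_inv_sl4, rule cz_sl4) (use vals_sl4[OF d] lt3_\<phi>[OF gen_F2[OF that]] in auto)
  then show ?thesis by (simp add: T_def V_def)
qed

lemma N_V: "d \<in> V \<Longrightarrow> N d \<in> V"
  unfolding N_def by (intro subspace_diff[OF subspace_V] T_V)

lemma cobd_V: "Y \<in> sl4 \<Longrightarrow> cobd Y \<in> V"
  using Ad_sl4[OF a_closed] Ad_sl4[OF gb_closed] subspace_diff[OF subspace_sl4] by (simp add: cobd_def V_def)

text \<open>The right side is again a crossed homomorphism in \<open>w\<close>, by
  \<open>mer_inv_Ad_\<phi>\<close>, and the two sides agree at the generators by definition of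
  \<open>T\<close>.\<close>

lemma cz_T:
  assumes "w \<in> carrier F2" shows "cz (vals (T d)) w = mer_inv (cz (vals d) (\<phi> w))"
  using assms
proof (induction w rule: F2_induct)
  case Nil
  then show ?case using linear_0[OF linear_mer_inv] by (simp add: \<phi>_Nil)
next
  case (Cons i s w)
  note mer_add = linear_add[OF linear_mer_inv] and mer_neg = linear_neg[OF linear_mer_inv]
  have v: "vals (T d) i = mer_inv (cz (vals d) (\<phi> (gen i)))"
    using less_2_cases[OF Cons(1)] by (auto simp: vals_def T_def)
  have gi: "gen_inv i \<in> carrier F2" "gen i \<in> carrier F2" by (rule gen_F2[OF Cons(1)])+
  have lt: "lt3 (\<phi> [(i, t)])" for t by (rule lt3_\<phi>[OF gen_F2[OF Cons(1)]])
  have "mer_inv (cz (vals d) (\<phi> (gen_inv i))) = - Ad (\<rho> (cls (gen_inv i))) (mer_inv (cz (vals d) (\<phi> (gen i))))"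
  proof -
    have "cz (vals d) (\<phi> (gen_inv i)) = cz (vals d) (inv_word (\<phi> (gen i)))"
      unfolding \<phi>_gen_inv[OF Cons(1)] by (rule cz_reduce) (use lt in \<open>simp add: fst_set_inv_word\<close>)
    also have "\<dots> = - Ad (\<rho> (inv\<^bsub>\<Gamma>\<^esub> cls (\<phi> (gen i)))) (cz (vals d) (\<phi> (gen i)))"
      by (rule cz_inv_word[OF lt])
    also have "inv\<^bsub>\<Gamma>\<^esub> cls (\<phi> (gen i)) = cls (\<phi> (gen_inv i))"
      unfolding \<phi>_gen_inv[OF Cons(1)] cls_reduce by (rule cls_inv_word[OF lt, symmetric])
    finally show ?thesis by (simp add: mer_neg mer_inv_Ad_\<phi>[OF gi(1)])
  qed
  then have g: "(if s then vals (T d) i else - Ad (\<rho> (cls (gen_inv i))) (vals (T d) i))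
      = mer_inv (cz (vals d) (\<phi> [(i, s)]))"
    by (simp add: v)
  have "cz (vals d) (\<phi> ((i, s) # w)) = cz (vals d) (\<phi> [(i, s)] @ \<phi> w)"
    unfolding \<phi>_Cons[OF Cons(3,1,2)]
    by (rule cz_reduce) (use lt[of s] lt3_\<phi>[OF Cons(2)] in auto)
  also have "\<dots> = cz (vals d) (\<phi> [(i, s)]) + Ad (\<rho> (cls (\<phi> [(i, s)]))) (cz (vals d) (\<phi> w))"
    by (rule cz_append[OF lt lt3_\<phi>[OF Cons(2)]])
  finally have "mer_inv (cz (vals d) (\<phi> ((i, s) # w)))
      = mer_inv (cz (vals d) (\<phi> [(i, s)])) + Ad (\<rho> (cls [(i, s)])) (mer_inv (cz (vals d) (\<phi> w)))"
    by (simp only: mer_add mer_inv_Ad_\<phi>[OF gen_F2[OF Cons(1)]])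
  then show ?case unfolding cz.simps g Cons(4) by simp
qed

text \<open>The monodromy fixes \<open>boundary_word\<close>, so evaluation there carries
  \<open>T\<close> to \<open>mer_inv\<close>. High powers of \<open>N\<close> therefore kill the
  value at the boundary curve.\<close>

lemma ev_N: "ev (N d) = D (ev d)"
proof -
  have "ev (T d) = mer_inv (ev d)" unfolding ev_def using cz_T[OF boundary_F2] by (simp add: \<phi>_boundary)
  then show ?thesis by (simp add: N_def D_def linear_diff[OF linear_ev])
qed

lemma ev_N_pow: "ev ((N ^^ k) d) = (D ^^ k) (ev d)"
  by (induction k) (simp_all add: ev_N)

text \<open>Conjugation by the meridian takes the coboundary of \<open>Y\<close> to that of
  \<open>mer_inv Y\<close>, so \<open>N\<close> is nilpotent on coboundaries along with
  \<open>D\<close>.\<close>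

lemma N_cobd: "N (cobd Y) = cobd (D Y)"
proof -
  have T: "mer_inv (cz (vals (cobd Y)) (\<phi> (gen i))) = Ad (\<rho> (cls (gen i))) (mer_inv Y) - mer_inv Y" if i: "i < 2" for i
  proof -
    have "cz (vals (cobd Y)) (\<phi> (gen i)) = cz (\<lambda>i. Ad (\<rho> (cls (gen i))) Y - Y) (\<phi> (gen i))"
    proof (rule cz_cong)
      fix j :: nat assume "j < 2"
      then show "vals (cobd Y) j = Ad (\<rho> (cls (gen j))) Y - Y"
        using less_2_cases[of j] by (auto simp: vals_def cobd_def)
    qed (rule \<phi>_gen_letters[OF i])
    also have "\<dots> = Ad (\<rho> (cls (\<phi> (gen i)))) Y - Y" by (rule cz_coboundary[OF lt3_\<phi>[OF gen_F2[OF i]]])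
    finally show ?thesis by (simp add: linear_diff[OF linear_mer_inv] mer_inv_Ad_\<phi>[OF gen_F2[OF i]])
  qed
  have "T (cobd Y) = cobd (mer_inv Y)" using T[of 0] T[of 1] by (simp add: T_def cobd_def)
  then show ?thesis by (simp add: N_def D_def linear_diff[OF linear_cobd])
qed

lemma N_pow_cobd: "(N ^^ k) (cobd Y) = cobd ((D ^^ k) Y)"
  by (induction k) (simp_all add: N_cobd)

lemma Ad_cls_fixed:
  assumes "\<And>i. i < n \<Longrightarrow> Ad (\<rho> (cls (gen i))) Z = Z" "fst ` set w \<subseteq> {..<n}" "n \<le> 3"
  shows "Ad (\<rho> (cls w)) Z = Z"
proof -
  have lt: "lt3 w" using assms(2,3) by force
  have "cz (\<lambda>i. Ad (\<rho> (cls (gen i))) Z - Z) w = cz (\<lambda>i. 0 *\<^sub>R Z) w"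
    by (rule cz_cong[OF _ assms(2)]) (simp add: assms(1))
  also have "\<dots> = 0" using cz_scale[OF lt, of 0 "\<lambda>i. Z"] by simp
  finally show ?thesis using cz_coboundary[OF lt, of Z] by simp
qed

text \<open>The fiber group is normal, so \<open>D\<close> acts on its invariants, and it does so
  nilpotently. If some were nonzero, the last nonzero iterate of \<open>D\<close> would be fixed by
  the meridian as well, hence by all of \<Gamma>.\<close>

lemma fiber_invariants_trivial:
  assumes Z: "Z \<in> sl4" "Ad (\<rho> ga) Z = Z" "Ad (\<rho> gb) Z = Z"
  shows "Z = 0"
proof -
  have "Z = 0" if "Z \<in> sl4" "\<And>w. w \<in> carrier F2 \<Longrightarrow> Ad (\<rho> (cls w)) Z = Z" "(D ^^ k) Z = 0" for k Z
    using that
  proof (induction k arbitrary: Z)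
    case (Suc k)
    have "Ad (\<rho> (cls w)) (D Z) = D Z" if w: "w \<in> carrier F2" for w
    proof -
      have "Ad (\<rho> (cls w)) (mer_inv Z) = mer_inv Z"
        using mer_inv_Ad_\<phi>[OF w, of Z] Suc.prems(2)[OF \<phi>_closed[OF w]] by simp
      then show ?thesis
        using Suc.prems(2)[OF w] linear_Ad_cls[OF lt3_F2[OF w]] by (simp add: D_def linear_diff)
    qed
    moreover have "(D ^^ k) (D Z) = 0" using Suc.prems(3) by (simp add: funpow_swap1)
    ultimately have "D Z = 0" by (intro Suc.IH[of "D Z"] D_sl4 Suc.prems(1))
    then have "mer_inv Z = Z" by (simp add: D_def)
    then have mer: "Ad (\<rho> mer) Z = Z" using Ad_inv(1)[OF x_closed, of Z] by (simp add: mer_inv_def)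
    have gens: "Ad (\<rho> (cls (gen i))) Z = Z" if "i < 3" for i
    proof (cases "i = 2")
      case False
      then show ?thesis using that by (intro Suc.prems(2) gen_F2) simp
    qed (simp add: mer)
    show ?case
    proof (rule invariants_trivial[OF Suc.prems(1)])
      fix g assume "g \<in> carrier \<Gamma>"
      then obtain w where "lt3 w" "g = cls w" by (rule cls_surj)
      then show "Ad (\<rho> g) Z = Z" using Ad_cls_fixed[of 3, OF gens] by simp
    qed
  qed simp
  moreover have "Ad (\<rho> (cls w)) Z = Z" if "w \<in> carrier F2" for w
  proof (rule Ad_cls_fixed[of 2])
    fix i :: nat assume "i < 2"
    then show "Ad (\<rho> (cls (gen i))) Z = Z" using less_2_cases[of i] Z by auto
  qed (use that in \<open>auto simp: in_free_group\<close>)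
  ultimately show ?thesis using Z(1) D_nilpotent[of 5 Z] by blast
qed

lemma trace_Ad:
  assumes "g \<in> carrier \<Gamma>" shows "trace (Z ** Ad (\<rho> g) Y) = trace (Ad (\<rho> (inv\<^bsub>\<Gamma>\<^esub> g)) Z ** Y)"
proof -
  have "trace (Z ** Ad (\<rho> g) Y) = trace ((Z ** L g ** Y) ** L (inv\<^bsub>\<Gamma>\<^esub> g))"
    by (simp add: Ad_\<rho> assms matrix_mul_assoc)
  also have "\<dots> = trace (L (inv\<^bsub>\<Gamma>\<^esub> g) ** (Z ** L g ** Y))" by (rule trace_mul_sym)
  finally show ?thesis using assms by (simp add: Ad_\<rho> matrix_mul_assoc)
qed

abbreviation "Zc \<equiv> {Y \<in> sl4. Ad (\<rho> bd) Y = Y}"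

lemma Ad_inv_fixed: "g \<in> carrier \<Gamma> \<Longrightarrow> Ad (\<rho> g) Y = Y \<Longrightarrow> Ad (\<rho> (inv\<^bsub>\<Gamma>\<^esub> g)) Y = Y"
  using Ad_inv(2)[of g Y] by simp

text \<open>Testing against cocycles that vanish at one of the two generators shows that
  \<open>Z\<close> is fixed by both, so it is zero. In dual terms, the conditions that define
  \<open>W\<close> are independent.\<close>

lemma ev_annihilator_trivial:
  assumes Z: "Z \<in> Zc" and ann: "\<And>d. d \<in> V \<Longrightarrow> trace (Z ** ev d) = 0"
  shows "Z = 0"
proof -
  have g: "cls (gen_inv 0) = inv\<^bsub>\<Gamma>\<^esub> ga" "cls (gen_inv 1) = inv\<^bsub>\<Gamma>\<^esub> gb" by (rule cls_gen_inv, simp)+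
  have A: "linear (Ad (\<rho> ga))" "linear (Ad (\<rho> (inv\<^bsub>\<Gamma>\<^esub> ga)))" "linear (Ad (\<rho> gb))" "linear (Ad (\<rho> (inv\<^bsub>\<Gamma>\<^esub> gb)))"
    using linear_Ad a_closed gb_closed by auto
  have sl: "Ad (\<rho> h) Y \<in> sl4" if "h \<in> carrier \<Gamma>" "Y \<in> sl4" for h Y using Ad_sl4 that .
  have bd: "Ad (\<rho> bd) Y = Ad (\<rho> ga) (Ad (\<rho> gb) (Ad (\<rho> (inv\<^bsub>\<Gamma>\<^esub> ga)) (Ad (\<rho> (inv\<^bsub>\<Gamma>\<^esub> gb)) Y)))" for Y
    unfolding boundary_word_def g[symmetric]
    using Ad_cls_append[of "gen 0" "gen 1 @ gen_inv 0 @ gen_inv 1" Y] Ad_cls_append[of "gen 1" "gen_inv 0 @ gen_inv 1" Y]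
      Ad_cls_append[of "gen_inv 0" "gen_inv 1" Y] by simp
  note A' = A[unfolded One_nat_def]
  have ev: "ev (d0, d1) = d0 - Ad (\<rho> ga) (Ad (\<rho> gb) (Ad (\<rho> (inv\<^bsub>\<Gamma>\<^esub> ga)) d0)) + (Ad (\<rho> ga) d1 - Ad (\<rho> bd) d1)" for d0 d1
    unfolding bd by (simp add: ev_def boundary_word_def vals_def g g[unfolded One_nat_def] A'[THEN linear_add] A'[THEN linear_neg]
        A'[THEN linear_0] A'[THEN linear_diff])
  have zero: "0 \<in> sl4" using subspace_0[OF subspace_sl4] .
  have "Ad (\<rho> (inv\<^bsub>\<Gamma>\<^esub> ga)) Z - Z = 0"
  proof (rule trace_form_nondegenerate)
    show "Ad (\<rho> (inv\<^bsub>\<Gamma>\<^esub> ga)) Z - Z \<in> sl4"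
      using Z a_closed by (intro subspace_diff[OF subspace_sl4] sl) auto
    fix Y assume Y: "Y \<in> sl4"
    have "trace (Z ** ev (0, Y)) = 0" using Y zero by (intro ann) (simp add: V_def)
    \<comment> \<open>The trace form is invariant, so both actions can be moved to \<open>Z\<close>,
      where that of the boundary curve disappears because \<open>Z\<close> is fixed by it.\<close>
    then have "trace (Z ** Ad (\<rho> ga) Y) - trace (Z ** Ad (\<rho> bd) Y) = 0"
      unfolding ev by (simp add: A'[THEN linear_0] matmult.diff_right trace_sub)
    then have "trace (Ad (\<rho> (inv\<^bsub>\<Gamma>\<^esub> ga)) Z ** Y) - trace (Z ** Y) = 0"
      using Z Ad_inv_fixed[OF c_closed, of Z] by (simp add: trace_Ad a_closed c_closed)
    then show "trace ((Ad (\<rho> (inv\<^bsub>\<Gamma>\<^esub> ga)) Z - Z) ** Y) = 0" by (simp add: matmult.diff_left trace_sub)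
  qed
  then have ai: "Ad (\<rho> (inv\<^bsub>\<Gamma>\<^esub> ga)) Z = Z" by simp
  then have a: "Ad (\<rho> ga) Z = Z" using Ad_inv(1)[OF a_closed, of Z] by simp
  have "Z - Ad (\<rho> ga) (Ad (\<rho> (inv\<^bsub>\<Gamma>\<^esub> gb)) Z) = 0"
  proof (rule trace_form_nondegenerate)
    show "Z - Ad (\<rho> ga) (Ad (\<rho> (inv\<^bsub>\<Gamma>\<^esub> gb)) Z) \<in> sl4"
      using Z a_closed gb_closed by (intro subspace_diff[OF subspace_sl4] sl) auto
    fix Y assume Y: "Y \<in> sl4"
    have "trace (Z ** ev (Y, 0)) = 0" using Y zero by (intro ann) (simp add: V_def)
    then have "trace (Z ** Y) - trace (Z ** Ad (\<rho> ga) (Ad (\<rho> gb) (Ad (\<rho> (inv\<^bsub>\<Gamma>\<^esub> ga)) Y))) = 0"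
      unfolding ev using linear_0[OF linear_Ad[OF c_closed]] by (simp add: A'[THEN linear_0] matmult.diff_right trace_sub)
    then have "trace (Z ** Y) - trace (Ad (\<rho> ga) (Ad (\<rho> (inv\<^bsub>\<Gamma>\<^esub> gb)) Z) ** Y) = 0"
      using a_closed gb_closed by (simp add: trace_Ad ai)
    then show "trace ((Z - Ad (\<rho> ga) (Ad (\<rho> (inv\<^bsub>\<Gamma>\<^esub> gb)) Z)) ** Y) = 0" by (simp add: matmult.diff_left trace_sub)
  qed
  then have "Ad (\<rho> ga) (Ad (\<rho> (inv\<^bsub>\<Gamma>\<^esub> gb)) Z) = Z" by simp
  then have "Ad (\<rho> (inv\<^bsub>\<Gamma>\<^esub> ga)) (Ad (\<rho> ga) (Ad (\<rho> (inv\<^bsub>\<Gamma>\<^esub> gb)) Z)) = Z" using ai by simp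
  then have "Ad (\<rho> (inv\<^bsub>\<Gamma>\<^esub> gb)) Z = Z" by (simp add: Ad_inv(2)[OF a_closed])
  then have "Ad (\<rho> gb) Z = Z" using Ad_inv(1)[OF gb_closed, of Z] by simp
  then show ?thesis using fiber_invariants_trivial Z a by blast
qed

text \<open>A condition at the boundary curve in linear form: by invariance of the trace form,
  values \<open>Ad (\<rho> bd) v - v\<close> are orthogonal to \<open>Zc\<close>.\<close>

definition W :: "((real^4^4) \<times> (real^4^4)) set" where
  "W = {d \<in> V. \<forall>Z\<in>Zc. trace (Z ** ev d) = 0}"

lemma subspace_Zc: "subspace Zc"
  using subspace_sl4 linear_Ad[OF c_closed] by (auto simp: subspace_def linear_0 linear_add linear_scale)

text \<open>The functional given by \<open>Z\<close> is represented by the vector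
  \<open>\<Theta> Z\<close> of \<open>V\<close>. The map is injective on \<open>Zc\<close> by
  \<open>ev_annihilator_trivial\<close>, and \<open>W\<close> is the orthogonal complement of its
  image, of dimension \<open>30 - dim Zc\<close>.\<close>

lemma dim_W: "dim W \<le> 25"
proof -
  obtain B where B: "B \<subseteq> V" "pairwise Linear_Algebra.orthogonal B" "\<And>x. x \<in> B \<Longrightarrow> norm x = 1"
    "independent B" "span B = V"
    using orthonormal_basis_subspace[OF subspace_V] by metis
  have fin: "finite B" using B(4) by (rule independent_imp_finite)
  define \<Theta> where "\<Theta> Z = (\<Sum>b\<in>B. trace (Z ** ev b) *\<^sub>R b)" for Z
  have lin: "linear \<Theta>"
    by (rule linearI) (simp_all add: \<Theta>_def matmult.add_left matmult.scaleR_left trace_add trace_scaleR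
        scaleR_left_distrib sum.distrib scaleR_sum_right)
  have inner: "inner (\<Theta> Z) d = trace (Z ** ev d)" if d: "d \<in> V" for Z d
  proof -
    have tl: "linear (\<lambda>d. trace (Z ** ev d))"
      by (rule linearI) (simp_all add: linear_add[OF linear_ev] linear_scale[OF linear_ev] matmult.add_right matmult.scaleR_right
          trace_add trace_scaleR)
    have "(\<Sum>b\<in>B. inner d b *\<^sub>R b) = d"
      by (rule orthonormal_basis_expand) (use B d fin in auto)
    then have "trace (Z ** ev d) = trace (Z ** ev (\<Sum>b\<in>B. inner d b *\<^sub>R b))" by simp
    also have "\<dots> = (\<Sum>b\<in>B. inner d b * trace (Z ** ev b))"
      using linear_sum[OF tl, of "\<lambda>b. inner d b *\<^sub>R b" B] linear_scale[OF tl] by simp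
    also have "\<dots> = inner (\<Theta> Z) d"
      unfolding \<Theta>_def inner_sum_left by (intro sum.cong) (auto simp: inner_commute)
    finally show ?thesis by simp
  qed
  have "inj_on \<Theta> Zc"
  proof (rule inj_onI)
    fix Z Z' assume Z: "Z \<in> Zc" "Z' \<in> Zc" "\<Theta> Z = \<Theta> Z'"
    have "Z - Z' = 0"
    proof (rule ev_annihilator_trivial)
      show "Z - Z' \<in> Zc" by (rule subspace_diff[OF subspace_Zc Z(1,2)])
      fix d assume "d \<in> V"
      then have "trace ((Z - Z') ** ev d) = inner (\<Theta> (Z - Z')) d" by (simp add: inner)
      then show "trace ((Z - Z') ** ev d) = 0" using Z(3) by (simp add: linear_diff[OF lin])
    qed
    then show "Z = Z'" by simp
  qed
  then have "dim (\<Theta> ` Zc) = dim Zc"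
    using subspace_Zc by (intro dim_image_eq[OF lin]) (simp add: span_eq_iff[THEN iffD2])
  moreover have "dim {y \<in> V. \<forall>x\<in>\<Theta> ` Zc. Linear_Algebra.orthogonal x y} + dim (\<Theta> ` Zc) = dim V"
  proof (rule dim_subspace_orthogonal_to_vectors)
    show "subspace (\<Theta> ` Zc)" by (rule linear_subspace_image[OF lin subspace_Zc])
    show "\<Theta> ` Zc \<subseteq> V"
      using B(1) by (auto simp: \<Theta>_def intro!: subspace_sum[OF subspace_V] subspace_scale[OF subspace_V])
  qed (rule subspace_V)
  moreover have "{y \<in> V. \<forall>x\<in>\<Theta> ` Zc. Linear_Algebra.orthogonal x y} = W"
    by (auto simp: W_def Linear_Algebra.orthogonal_def inner)
  ultimately show ?thesis using dim_Ad_bd_fixed by (simp add: dim_V)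
qed

lemma subspace_W: "subspace W"
proof -
  show ?thesis
    using subspace_V unfolding subspace_def W_def
    by (auto simp: linear_0[OF linear_ev] linear_add[OF linear_ev] linear_scale[OF linear_ev] matmult.zero_right matmult.add_right
        matmult.scaleR_right trace_add trace_scaleR) (simp add: trace_def)
qed

lemma in_W:
  assumes d: "d \<in> V" and v: "v \<in> sl4" "ev d = Ad (\<rho> bd) v - v" shows "d \<in> W"
proof -
  have "trace (Z ** ev d) = 0" if Z: "Z \<in> Zc" for Z
    using Z Ad_inv_fixed[OF c_closed, of Z] by (simp add: v(2) matmult.diff_right trace_sub trace_Ad c_closed)
  then show ?thesis using d by (simp add: W_def)
qed

lemma cobd_W: "Y \<in> sl4 \<Longrightarrow> cobd Y \<in> W"
proof (rule in_W)
  have b2: "fst ` set boundary_word \<subseteq> {..<2}" by (simp add: boundary_word_def)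
  have "ev (cobd Y) = cz (\<lambda>i. Ad (\<rho> (cls (gen i))) Y - Y) boundary_word"
    unfolding ev_def
  proof (rule cz_cong[OF _ b2])
    fix i :: nat assume "i < 2"
    then show "vals (cobd Y) i = Ad (\<rho> (cls (gen i))) Y - Y"
      using less_2_cases[of i] by (auto simp: vals_def cobd_def)
  qed
  then show "ev (cobd Y) = Ad (\<rho> bd) Y - Y" by (simp add: cz_coboundary[OF lt3_F2[OF boundary_F2]])
qed (rule cobd_V)

lemma linear_funpow: "linear f \<Longrightarrow> linear (f ^^ k)" for f :: "'a::real_vector \<Rightarrow> 'a"
  by (induction k) (auto intro: linear_compose simp: linear_id[unfolded id_def] id_def)

text \<open>The dimension count makes the restriction to the fiber a coboundary. What remains at the
  meridian is a vector fixed by the fiber group, and that is zero.\<close>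

lemma cocycle_coboundary:
  assumes small: "dim {y \<in> V. (N ^^ 16) y = 0} \<le> 20"
    and d: "d \<in> Z1" and v: "v \<in> sl4" "d bd = Ad (\<rho> bd) v - v"
  obtains v where "v \<in> sl4" "\<And>g. g \<in> carrier \<Gamma> \<Longrightarrow> d g = Ad (\<rho> g) v - v"
proof -
  define d0 where "d0 = (d ga, d gb)"
  have d0V: "d0 \<in> V" using Z1_sl4[OF d a_closed] Z1_sl4[OF d gb_closed] by (simp add: d0_def V_def)
  have cz: "d (cls w) = cz (vals d0) w" if w: "fst ` set w \<subseteq> {..<2}" for w
  proof -
    have "lt3 w" using w by force
    then have "d (cls w) = cz (\<lambda>i. d (cls (gen i))) w" by (rule Z1_cls[OF d])
    also have "\<dots> = cz (vals d0) w"
    proof (rule cz_cong[OF _ w])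
      fix i :: nat assume "i < 2"
      then show "d (cls (gen i)) = vals d0 i" using less_2_cases[of i] by (auto simp: vals_def d0_def)
    qed
    finally show ?thesis .
  qed
  have conj: "mer \<otimes>\<^bsub>\<Gamma>\<^esub> cls w = cls (\<phi> w) \<otimes>\<^bsub>\<Gamma>\<^esub> mer" if w: "w \<in> carrier F2" for w
    unfolding cls_conj[OF w, symmetric] using cls_closed[OF lt3_F2[OF w]] x_closed by (simp add: \<Gamma>.m_assoc)
  have d\<phi>: "d (cls (\<phi> w)) = d mer + Ad (\<rho> mer) (d (cls w)) - Ad (\<rho> (cls (\<phi> w))) (d mer)"
    if w: "w \<in> carrier F2" for w
  proof -
    have "d mer + Ad (\<rho> mer) (d (cls w)) = d (cls (\<phi> w) \<otimes>\<^bsub>\<Gamma>\<^esub> mer)"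
      using Z1_mult[OF d x_closed cls_closed[OF lt3_F2[OF w]]] by (simp add: conj[OF w])
    also have "\<dots> = d (cls (\<phi> w)) + Ad (\<rho> (cls (\<phi> w))) (d mer)"
      by (rule Z1_mult[OF d cls_closed[OF lt3_\<phi>[OF w]] x_closed])
    finally show ?thesis by simp
  qed
  have Td: "mer_inv (cz (vals d0) (\<phi> (gen i))) = mer_inv (d mer) + d (cls (gen i)) - Ad (\<rho> (cls (gen i))) (mer_inv (d mer))"
    if i: "i < 2" for i
    unfolding cz[OF \<phi>_gen_letters[OF i], symmetric] d\<phi>[OF gen_F2[OF i]]
    by (simp add: linear_diff[OF linear_mer_inv] linear_add[OF linear_mer_inv] mer_inv_Ad_\<phi>[OF gen_F2[OF i]])
      (simp add: mer_inv_def Ad_inv(2)[OF x_closed])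
  \<comment> \<open>The two expressions for the value of \<open>d\<close> at the meridian times
    \<open>w\<close>, which is also \<open>\<phi> w\<close> times the meridian, show that
    conjugation by the meridian changes \<open>d0\<close> by a coboundary only.\<close>
  have Nd: "N d0 = - cobd (mer_inv (d mer))"
    using Td[of 0] Td[of 1] by (simp add: N_def T_def d0_def cobd_def)
  have linN: "linear (N ^^ k)" for k by (rule linear_funpow[OF linear_N])
  have "d0 \<in> cobd ` sl4"
  proof (rule ccontr)
    assume nd: "d0 \<notin> cobd ` sl4"
    have "inj_on cobd sl4"
    proof (rule inj_onI)
      fix Y Y' assume Y: "Y \<in> sl4" "Y' \<in> sl4" "cobd Y = cobd Y'"
      then have "cobd (Y - Y') = 0" by (simp add: linear_diff[OF linear_cobd])
      then have "Ad (\<rho> ga) (Y - Y') = Y - Y'" "Ad (\<rho> gb) (Y - Y') = Y - Y'" by (simp_all add: cobd_def zero_prod_def)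
      then have "Y - Y' = 0" by (rule fiber_invariants_trivial[OF subspace_diff[OF subspace_sl4 Y(1,2)]])
      then show "Y = Y'" by simp
    qed
    then have "dim (cobd ` sl4) = 15"
      using dim_image_eq[OF linear_cobd, of sl4] subspace_sl4 by (simp add: dim_sl4 span_eq_iff[THEN iffD2])
    moreover have "d0 \<notin> span (cobd ` sl4)"
      using nd linear_subspace_image[OF linear_cobd subspace_sl4] by (simp add: span_eq_iff[THEN iffD2])
    ultimately have dim16: "dim (insert d0 (cobd ` sl4)) = 16" by (simp add: dim_insert)
    \<comment> \<open>One application lands in the coboundaries; the other seven exceed the
      nilpotency degree 5.\<close>
    have "(N ^^ 8) d0 = (N ^^ 7) (N d0)" using funpow_Suc_right[of 7 N] by simp
    also have "\<dots> = - cobd ((D ^^ 7) (mer_inv (d mer)))"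
      unfolding Nd by (simp only: linear_neg[OF linN] N_pow_cobd)
    finally have N8: "(N ^^ 8) d0 = 0" by (simp add: D_nilpotent linear_0[OF linear_cobd])
    have "ev d0 = Ad (\<rho> bd) v - v"
      unfolding ev_def v(2)[symmetric] by (rule cz[symmetric]) (simp add: boundary_word_def)
    then have d0W: "d0 \<in> W" by (rule in_W[OF d0V v(1)])
    have "insert d0 (cobd ` sl4) \<subseteq> {y \<in> W. (N ^^ 8) y = 0}"
      using N8 d0W cobd_W by (auto simp: N_pow_cobd D_nilpotent linear_0[OF linear_cobd])
    from dim_subset[OF this] have "dim {y \<in> W. (N ^^ 8) y = 0} \<ge> 16" unfolding dim16 .
    then have 9: "dim ((N ^^ 8) ` W) \<le> 9"
      using dim_kernel_image[OF linN subspace_W, of 8] dim_W by simp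
    have N8W: "(N ^^ 8) y \<in> W" if y: "y \<in> V" for y
    proof (rule in_W[where v = 0])
      have "(N ^^ k) y \<in> V" for k by (induction k) (simp_all add: y N_V)
      then show "(N ^^ 8) y \<in> V" .
      show "ev ((N ^^ 8) y) = Ad (\<rho> bd) 0 - 0"
        by (simp add: ev_N_pow D_nilpotent linear_0[OF linear_Ad[OF c_closed]])
    qed (rule subspace_0[OF subspace_sl4])
    have "(N ^^ 16) y = (N ^^ 8) ((N ^^ 8) y)" for y
      using funpow_add[of 8 8 N] by simp
    then have "(N ^^ 16) ` V \<subseteq> (N ^^ 8) ` W" using N8W by auto
    from order_trans[OF dim_subset[OF this] 9] have "dim ((N ^^ 16) ` V) \<le> 9" .
    then show False using dim_kernel_image[OF linN subspace_V, of 16] small dim_V by simp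
  qed
  then obtain v0 where v0: "v0 \<in> sl4" "d0 = cobd v0" by blast
  have dF2: "d (cls w) = Ad (\<rho> (cls w)) v0 - v0" if w: "w \<in> carrier F2" for w
  proof -
    have w2: "fst ` set w \<subseteq> {..<2}" using w by (simp add: in_free_group)
    have "d (cls w) = cz (\<lambda>i. Ad (\<rho> (cls (gen i))) v0 - v0) w"
      unfolding cz[OF w2]
    proof (rule cz_cong[OF _ w2])
      fix i :: nat assume "i < 2"
      then show "vals d0 i = Ad (\<rho> (cls (gen i))) v0 - v0"
        using less_2_cases[of i] by (auto simp: vals_def v0(2) cobd_def)
    qed
    then show ?thesis by (simp add: cz_coboundary[OF lt3_F2[OF w]])
  qed
  \<comment> \<open>The defect at the meridian after subtracting the coboundary of
    \<open>v0\<close>.\<close>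
  define y where "y = d mer - (Ad (\<rho> mer) v0 - v0)"
  have dm: "d mer = y + Ad (\<rho> mer) v0 - v0" by (simp add: y_def)
  have fixed: "Ad (\<rho> (cls (\<phi> w))) y = y" if w: "w \<in> carrier F2" for w
  proof -
    have lin: "linear (Ad (\<rho> (cls (\<phi> w))))" "linear (Ad (\<rho> mer))"
      using linear_Ad_cls[OF lt3_\<phi>[OF w]] linear_Ad[OF x_closed] by auto
    have "Ad (\<rho> (cls (\<phi> w) \<otimes>\<^bsub>\<Gamma>\<^esub> mer)) v0 = Ad (\<rho> (mer \<otimes>\<^bsub>\<Gamma>\<^esub> cls w)) v0" by (simp add: conj[OF w])
    then have c: "Ad (\<rho> (cls (\<phi> w))) (Ad (\<rho> mer) v0) = Ad (\<rho> mer) (Ad (\<rho> (cls w)) v0)"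
      by (simp only: Ad_mult cls_closed[OF lt3_\<phi>[OF w]] cls_closed[OF lt3_F2[OF w]] x_closed)
    have "Ad (\<rho> (cls (\<phi> w))) v0 - v0
        = d mer + Ad (\<rho> mer) (Ad (\<rho> (cls w)) v0 - v0) - Ad (\<rho> (cls (\<phi> w))) (d mer)"
      using d\<phi>[OF w] by (simp only: dF2[OF w] dF2[OF \<phi>_closed[OF w]])
    also have "\<dots> = y - v0 + Ad (\<rho> (cls (\<phi> w))) v0 - Ad (\<rho> (cls (\<phi> w))) y"
      unfolding dm by (simp add: linear_diff[OF lin(1)] linear_diff[OF lin(2)] linear_add[OF lin(1)] c)
    finally show ?thesis by simp
  qed
  have gens: "Ad (\<rho> (cls (gen i))) y = y" if i: "i < 2" for i
  proof -
    \<comment> \<open>Invariance is known under the images of \<phi>, and \<phi> is onto.\<close>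
    have "gen i \<in> \<phi> ` carrier F2" using \<phi>_bij gen_F2[OF i] by (simp add: bij_betw_def)
    then obtain w where w: "w \<in> carrier F2" "gen i = \<phi> w" by blast
    show ?thesis unfolding w(2) by (rule fixed[OF w(1)])
  qed
  have "y = 0"
  proof (rule fiber_invariants_trivial)
    show "y \<in> sl4" unfolding y_def
      by (intro subspace_diff[OF subspace_sl4] Z1_sl4[OF d] Ad_sl4 x_closed v0(1))
  qed (use gens[of 0] gens[of 1] in auto)
  have "d g = Ad (\<rho> g) v0 - v0" if g: "g \<in> carrier \<Gamma>" for g
  proof -
    obtain w where w: "lt3 w" "g = cls w" using cls_surj[OF g] .
    have "d (cls w) = cz (\<lambda>i. Ad (\<rho> (cls (gen i))) v0 - v0) w"
      unfolding Z1_cls[OF d w(1)]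
    proof (rule cz_cong[OF _ w(1)])
      fix i :: nat assume i: "i < 3"
      show "d (cls (gen i)) = Ad (\<rho> (cls (gen i))) v0 - v0"
      proof (cases "i = 2")
        case True
        then show ?thesis using \<open>y = 0\<close> dm by simp
      next
        case False
        then show ?thesis using i by (intro dF2 gen_F2) simp
      qed
    qed
    then show ?thesis by (simp add: w(2) cz_coboundary[OF w(1)])
  qed
  then show ?thesis by (rule that[OF v0(1)])
qed

end

section \<open>The twisted Alexander matrix\<close>

text \<open>One matrix entry of the homomorphism on the group ring. A single entry is only additive,
  so products of group elements enter through the sum over a middle index in
  \<open>h_mult\<close>.\<close>

definition ring_eval :: "(word \<Rightarrow> 'a::comm_ring_1) \<Rightarrow> free_group_ring \<Rightarrow> 'a" where
  "ring_eval h f = (\<Sum>w\<in>Poly_Mapping.keys f. of_int (Poly_Mapping.lookup f w) * h w)"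

lemma ring_eval_superset:
  assumes "finite A" "Poly_Mapping.keys f \<subseteq> A"
  shows "ring_eval h f = (\<Sum>w\<in>A. of_int (Poly_Mapping.lookup f w) * h w)"
  unfolding ring_eval_def by (rule sum.mono_neutral_left) (use assms in \<open>auto simp: in_keys_iff\<close>)

lemma ring_eval_add: "ring_eval h (f + g) = ring_eval h f + ring_eval h g"
proof -
  let ?A = "Poly_Mapping.keys f \<union> Poly_Mapping.keys g"
  have "Poly_Mapping.keys (f + g) \<subseteq> ?A" by (rule Poly_Mapping.keys_add)
  then show ?thesis
    by (simp add: ring_eval_superset[where A = ?A] lookup_add sum.distrib distrib_right)
qed

lemma ring_eval_zero [simp]: "ring_eval h 0 = 0"
  by (simp add: ring_eval_def)

lemma ring_eval_uminus: "ring_eval h (- f) = - ring_eval h f"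
  using ring_eval_add[of h f "- f"] by (simp add: eq_neg_iff_add_eq_0 add.commute)

lemma ring_eval_single: "ring_eval h (Poly_Mapping.single v c) = of_int c * h v"
  by (subst ring_eval_superset[where A = "{v}"]) auto

lemma ring_eval_sum: "ring_eval h (\<Sum>i\<in>I. f i) = (\<Sum>i\<in>I. ring_eval h (f i))"
  by (induction I rule: infinite_finite_induct) (simp_all add: ring_eval_add)

lemma ring_eval_left_mult: "ring_eval h (left_mult u f) = ring_eval (\<lambda>v. h (reduce (u @ v))) f"
  by (simp add: left_mult_def ring_eval_sum ring_eval_single) (simp add: ring_eval_def)

lemma ring_eval_cong: "(\<And>v. v \<in> Poly_Mapping.keys f \<Longrightarrow> h v = h' v) \<Longrightarrow> ring_eval h f = ring_eval h' f"
  unfolding ring_eval_def by (intro sum.cong) auto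

lemma ring_eval_linear: "ring_eval (\<lambda>v. \<Sum>r\<in>I. a r * h r v) f = (\<Sum>r\<in>I. a r * ring_eval (h r) f)"
  unfolding ring_eval_def sum_distrib_left
  by (subst sum.swap) (intro sum.cong refl, simp add: mult.left_commute)

lemma keys_fox:
  assumes "fst ` set w \<subseteq> {..<n}" shows "Poly_Mapping.keys (fox j w) \<subseteq> carrier (free_group n)"
  using assms
proof (induction w)
  case (Cons l w)
  obtain i s where l: "l = (i, s)" by force
  have i: "i < n" using Cons.prems l by simp
  have "Poly_Mapping.keys (fox_letter j l) \<subseteq> carrier (free_group n)"
    using i by (auto simp: l in_free_group reduced_Cons)
  moreover have "Poly_Mapping.keys (left_mult [l] (fox j w)) \<subseteq> carrier (free_group n)"
  proof -
    have "Poly_Mapping.keys (left_mult [l] (fox j w)) \<subseteq> (\<lambda>v. reduce ([l] @ v)) ` Poly_Mapping.keys (fox j w)"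
      unfolding left_mult_def by (rule order_trans[OF keys_sum]) auto
    also have "\<dots> \<subseteq> carrier (free_group n)"
    proof (rule image_subsetI)
      fix v assume "v \<in> Poly_Mapping.keys (fox j w)"
      moreover have "Poly_Mapping.keys (fox j w) \<subseteq> carrier (free_group n)"
        by (rule Cons.IH) (use Cons.prems in auto)
      ultimately have "v \<in> carrier (free_group n)" by blast
      then have "fst ` set v \<subseteq> {..<n}" by (simp add: in_free_group)
      then show "reduce ([l] @ v) \<in> carrier (free_group n)"
        by (intro reduce_in_free_group) (simp add: l i)
    qed
    finally show ?thesis .
  qed
  ultimately show ?case using Poly_Mapping.keys_add[of "fox_letter j l" "left_mult [l] (fox j w)"] by auto
qed simp

lemma const_fract_simps:
  "const_fract (x + y) = const_fract x + const_fract y" "const_fract (x * y) = const_fract x * const_fract y"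
  "const_fract (- x) = - const_fract x" "const_fract 0 = 0" "const_fract 1 = 1"
  "const_fract (x - y) = const_fract x - const_fract y"
  by (simp_all add: const_fract_def to_fract_add[symmetric] to_fract_mult[symmetric] to_fract_uminus[symmetric]
      to_fract_diff[symmetric] one_pCons[symmetric])

lemma const_fract_sum: "const_fract (\<Sum>i\<in>I. f i) = (\<Sum>i\<in>I. const_fract (f i))"
  by (induction I rule: infinite_finite_induct) (simp_all add: const_fract_simps)

lemma t_fract_nonzero: "t_fract \<noteq> 0"
  by (simp add: t_fract_def)

lemma comm_ring_hom_to_fract: "comm_ring_hom (to_fract :: 'a::idom \<Rightarrow> 'a fract)"
  by unfold_locales (auto simp: to_fract_add to_fract_mult)

lemma sl4_coord_expansion:
  assumes "linear f" "Y \<in> sl4"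
  shows "sl4_coord p (f Y) = (\<Sum>r<15. sl4_coord p (f (sl4_basis r)) * sl4_coord r Y)"
proof -
  have "sl4_coord p (f Y) = sl4_coord p (f (\<Sum>r<15. sl4_coord r Y *\<^sub>R sl4_basis r))"
    using sl4_expansion[OF assms(2)] by simp
  then show ?thesis
    by (simp add: linear_sum[OF assms(1)] linear_scale[OF assms(1)] linear_sum[OF linear_sl4_coord]
        linear_scale[OF linear_sl4_coord] mult.commute)
qed

context fibered_holonomy
begin

definition h :: "nat \<Rightarrow> nat \<Rightarrow> word \<Rightarrow> real poly fract" where
  "h p q w = t_fract powi \<alpha> (word_class 3 R w) * const_fract (Ad_mat (\<rho> (word_class 3 R w)) $$ (p, q))"

abbreviation "te \<equiv> twisted_eval 15 (word_class 3 R) (\<lambda>g. Ad_mat (\<rho> g)) \<alpha>"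

lemma te_index: "p < 15 \<Longrightarrow> q < 15 \<Longrightarrow> te f $$ (p, q) = ring_eval (h p q) f"
  by (simp add: twisted_eval_def ring_eval_def h_def)

lemma h_eq:
  assumes "p < 15" "q < 15" "w \<in> carrier F3"
  shows "h p q w = t_fract powi \<alpha> (cls w) * const_fract (sl4_coord p (Ad (\<rho> (cls w)) (sl4_basis q)))"
  using assms by (simp add: h_def cls_word Ad_mat_def)

lemma h_F2:
  assumes "p < 15" "q < 15" "w \<in> carrier F2"
  shows "h p q w = const_fract (sl4_coord p (Ad (\<rho> (cls w)) (sl4_basis q)))"
  using h_eq[OF assms(1,2) free_group_mono[OF assms(3)]] \<alpha>_F2[OF assms(3)] by simp

lemma h_mult:
  assumes pq: "p < 15" "q < 15" and u: "lt3 u" and v: "v \<in> carrier F3"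
  shows "h p q (reduce (u @ v)) = (\<Sum>r<15. h p r (reduce u) * h r q v)"
proof -
  have lv: "lt3 v" using v by (simp add: in_free_group)
  have cl: "reduce (u @ v) \<in> carrier F3" "reduce u \<in> carrier F3"
    using u lv reduce_in_free_group[of "u @ v" 3] reduce_in_free_group[of u 3] by (simp_all add: image_Un)
  have cc: "cls u \<in> carrier \<Gamma>" "cls v \<in> carrier \<Gamma>" using cls_closed u lv by auto
  have "sl4_coord p (Ad (\<rho> (cls u \<otimes>\<^bsub>\<Gamma>\<^esub> cls v)) (sl4_basis q))
      = (\<Sum>r<15. sl4_coord p (Ad (\<rho> (cls u)) (sl4_basis r)) * sl4_coord r (Ad (\<rho> (cls v)) (sl4_basis q)))"
    unfolding Ad_mult[OF cc]
    by (rule sl4_coord_expansion[OF linear_Ad[OF cc(1)] Ad_sl4[OF cc(2) sl4_basis_in_sl4[OF pq(2)]]])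
  then show ?thesis
    using pq cl v
    by (simp add: h_eq cls_reduce cls_append[OF u lv] \<alpha>_mult[OF cc] power_int_add t_fract_nonzero
        const_fract_sum const_fract_simps sum_distrib_left mult_ac)
qed

definition unit :: "nat \<Rightarrow> real^4^4 \<Rightarrow> nat \<Rightarrow> real^4^4" where
  "unit j Y i = (if i = j then Y else 0)"

text \<open>The Fox derivative and \<open>cz\<close> obey the same recursion: applied to basis
  vectors, the evaluated derivative by generator \<open>j\<close> is the cocycle supported on that
  generator. No power of t occurs, as \<alpha> vanishes on the fiber.\<close>

lemma fox_F2:
  assumes j: "j < 2" and q: "q < 15" and w: "fst ` set w \<subseteq> {..<2}" and p: "p < 15"
  shows "ring_eval (h p q) (fox j w) = const_fract (sl4_coord p (cz (unit j (sl4_basis q)) w))"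
  using w p
proof (induction w arbitrary: p)
  case Nil
  then show ?case using linear_0[OF linear_sl4_coord] by (simp add: const_fract_simps)
next
  case (Cons l w)
  let ?e = "unit j (sl4_basis q)"
  obtain i s where l: "l = (i, s)" by force
  have i: "i < 2" and w: "fst ` set w \<subseteq> {..<2}" using Cons.prems l by auto
  have w3: "lt3 w" using w by force
  have l3: "lt3 [l]" using i l by simp
  have lF: "[l] \<in> carrier F2" unfolding l by (rule gen_F2[OF i])
  have e: "?e i \<in> sl4" for i using sl4_basis_in_sl4[OF q] subspace_0[OF subspace_sl4] by (simp add: unit_def)
  have g: "gen_inv i \<in> carrier F2" by (rule gen_F2[OF i])
  have lin: "linear (Ad (\<rho> (cls (gen_inv i))))" by (rule linear_Ad_cls) (use i in simp)
  have 1: "ring_eval (h p q) (fox_letter j l)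
      = const_fract (sl4_coord p (if s then ?e i else - Ad (\<rho> (cls (gen_inv i))) (?e i)))"
  proof (cases "i = j")
    case True
    then have "h p q (gen_inv j) = const_fract (sl4_coord p (Ad (\<rho> (cls (gen_inv j))) (sl4_basis q)))"
      using h_F2[OF Cons.prems(2) q g] by simp
    then show ?thesis using True h_F2[OF Cons.prems(2) q Nil_F2]
      by (simp add: l unit_def ring_eval_single ring_eval_uminus cls_Nil Ad_one const_fract_simps
          linear_neg[OF linear_sl4_coord])
  next
    case False
    then show ?thesis
      by (simp add: l unit_def const_fract_simps linear_0[OF linear_sl4_coord] linear_0[OF lin])
  qed
  have "ring_eval (h p q) (left_mult [l] (fox j w)) = ring_eval (\<lambda>v. \<Sum>r<15. h p r [l] * h r q v) (fox j w)"
    unfolding ring_eval_left_mult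
  proof (rule ring_eval_cong)
    fix v assume "v \<in> Poly_Mapping.keys (fox j w)"
    then have "v \<in> carrier F3" using keys_fox[OF w3] by blast
    then show "h p q (reduce ([l] @ v)) = (\<Sum>r<15. h p r [l] * h r q v)"
      using h_mult[OF Cons.prems(2) q l3] by simp
  qed
  also have "\<dots> = (\<Sum>r<15. h p r [l] * ring_eval (h r q) (fox j w))" by (rule ring_eval_linear)
  also have "\<dots> = (\<Sum>r<15. const_fract (sl4_coord p (Ad (\<rho> (cls [l])) (sl4_basis r)) * sl4_coord r (cz ?e w)))"
    using h_F2[OF Cons.prems(2) _ lF] Cons.IH[OF w] by (intro sum.cong) (auto simp: const_fract_simps)
  also have "\<dots> = const_fract (sl4_coord p (Ad (\<rho> (cls [l])) (cz ?e w)))"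
    unfolding const_fract_sum[symmetric]
    by (subst sl4_coord_expansion[OF linear_Ad_cls[OF l3] cz_sl4[OF e w3]]) (rule refl)
  finally show ?case
    using 1 by (simp add: l ring_eval_add linear_add[OF linear_sl4_coord] const_fract_simps del: fox_letter.simps)
qed

lemma fox_inv_word: "fox j (inv_word w) = - left_mult (inv_word w) (fox j w)"
  using fox_append[of j "inv_word w" w] fox_reduce[of j "inv_word w @ w"]
  by (simp add: reduce_inv_word eq_neg_iff_add_eq_0)

text \<open>The product rule, with the derivative of an inverse rewritten as minus the inverse times
  the derivative. The prefix in front of the derivative of \<open>\<phi> (gen i)\<close> is then the
  whole relator, which becomes trivial in \<Gamma>.\<close>

lemma fox_relator:
  assumes j: "j < 2"
  shows "fox j (relator i)
    = (if i = j then Poly_Mapping.single (gen 2) 1 else 0) - left_mult (relator i) (fox j (\<phi> (gen i)))"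
proof -
  let ?w = "\<phi> (gen i)"
  have g: "fox j (gen 2) = 0" "fox j (gen_inv 2) = 0" using j by auto
  have gi: "left_mult (gen 2) (fox j (gen i)) = (if i = j then Poly_Mapping.single (gen 2) 1 else 0)"
    by (simp add: left_mult_single)
  have "fox j (relator i) = left_mult (gen 2) (fox j (gen i))
      + left_mult (gen 2) (left_mult (gen i) (left_mult (gen_inv 2) (fox j (inv_word ?w))))"
    unfolding relator_def fox_append g by (simp add: left_mult_add del: fox.simps)
  also have "left_mult (gen 2) (left_mult (gen i) (left_mult (gen_inv 2) (fox j (inv_word ?w))))
      = - left_mult (relator i) (fox j ?w)"
    unfolding fox_inv_word left_mult_uminus
    by (simp add: left_mult_left_mult left_mult_reduce reduce_append_right relator_def del: reduce_Cons append.simps)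
  finally show ?thesis unfolding gi by simp
qed

lemma relator_eval:
  assumes ij: "i < 2" "j < 2" and pq: "p < 15" "q < 15"
  shows "ring_eval (h p q) (fox j (reduce (relator i)))
    = (if i = j then t_fract * const_fract (sl4_coord p (Ad (\<rho> mer) (sl4_basis q))) else 0)
      - const_fract (sl4_coord p (cz (unit j (sl4_basis q)) (\<phi> (gen i))))"
proof -
  have m3: "gen 2 \<in> carrier F3" by (simp add: in_free_group reduced_Cons)
  have w2: "fst ` set (\<phi> (gen i)) \<subseteq> {..<2}" by (rule \<phi>_gen_letters[OF ij(1)])
  have w3: "lt3 (\<phi> (gen i))" by (rule lt3_\<phi>[OF gen_F2[OF ij(1)]])
  have r3: "lt3 (relator i)" by (rule relator_letters[OF ij(1)])
  have "ring_eval (h p q) (left_mult (relator i) (fox j (\<phi> (gen i)))) = ring_eval (h p q) (fox j (\<phi> (gen i)))"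
    unfolding ring_eval_left_mult
  proof (rule ring_eval_cong)
    fix v assume "v \<in> Poly_Mapping.keys (fox j (\<phi> (gen i)))"
    then have v: "v \<in> carrier F3" using keys_fox[OF w3] by blast
    then have v3: "lt3 v" by (simp add: in_free_group)
    have "reduce (relator i @ v) \<in> carrier F3" using r3 v3 by (intro reduce_in_free_group) auto
    moreover have "cls (reduce (relator i @ v)) = cls v"
      using cls_closed[OF v3] by (simp add: cls_reduce cls_append[OF r3 v3] cls_relator[OF ij(1)])
    ultimately show "h p q (reduce (relator i @ v)) = h p q v" using v pq by (simp add: h_eq)
  qed
  also have "\<dots> = const_fract (sl4_coord p (cz (unit j (sl4_basis q)) (\<phi> (gen i))))"
    by (rule fox_F2[OF ij(2) pq(2) w2 pq(1)])
  finally have 1: "ring_eval (h p q) (left_mult (relator i) (fox j (\<phi> (gen i)))) = \<dots>" .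
  have "h p q (gen 2) = t_fract * const_fract (sl4_coord p (Ad (\<rho> mer) (sl4_basis q)))"
    using h_eq[OF pq m3] by (simp add: \<alpha>_mer)
  then show ?thesis
    unfolding fox_reduce fox_relator[OF ij(2)]
    using ring_eval_add[of "h p q" _ "- left_mult (relator i) (fox j (\<phi> (gen i)))"]
    by (simp add: ring_eval_uminus 1 ring_eval_single)
qed

text \<open>The numbering follows the block structure of the Alexander matrix: the quotient by 15
  names the generator of the fiber, the remainder the basis vector of \<open>sl4\<close>.\<close>

definition bV :: "nat \<Rightarrow> (real^4^4) \<times> (real^4^4)" where
  "bV q = (if q div 15 = 0 then (sl4_basis (q mod 15), 0) else (0, sl4_basis (q mod 15)))"

definition coV :: "nat \<Rightarrow> (real^4^4) \<times> (real^4^4) \<Rightarrow> real" where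
  "coV p d = sl4_coord (p mod 15) (if p div 15 = 0 then fst d else snd d)"

lemma bV_V: "bV j \<in> V"
proof -
  define m where "m = j mod 15"
  have "sl4_basis m \<in> sl4" by (rule sl4_basis_in_sl4) (simp add: m_def)
  then show ?thesis
    unfolding bV_def V_def m_def[symmetric] using subspace_0[OF subspace_sl4] by simp
qed

lemma linear_coV: "linear (coV i)"
  by (rule linearI) (simp_all add: coV_def linear_add[OF linear_sl4_coord] linear_scale[OF linear_sl4_coord])

lemma sum_30: "(\<Sum>i<30. f i) = (\<Sum>i<15. f i) + (\<Sum>i<15. f (15 + i))" for f :: "nat \<Rightarrow> 'a::comm_monoid_add"
proof -
  have "(\<Sum>i<30. f i) = (\<Sum>i = 0..<15. f i) + (\<Sum>i = 15..<30. f i)"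
    by (simp add: atLeast0LessThan[symmetric] sum.atLeastLessThan_concat)
  also have "(\<Sum>i = 15..<30. f i) = (\<Sum>i = 0..<15. f (i + 15))"
    using sum.shift_bounds_nat_ivl[of f 0 15 15] by simp
  finally show ?thesis by (simp add: atLeast0LessThan add.commute)
qed

lemma V_expansion: assumes "y \<in> V" shows "y = (\<Sum>i<30. coV i y *\<^sub>R bV i)"
proof -
  obtain Y1 Y2 where y: "y = (Y1, Y2)" "Y1 \<in> sl4" "Y2 \<in> sl4" using assms by (auto simp: V_def)
  have p: "(\<Sum>i\<in>I. (f i, 0)) = (sum f I, 0)" "(\<Sum>i\<in>I. (0, f i)) = (0, sum f I)"
    for I :: "nat set" and f :: "nat \<Rightarrow> real^4^4"
    by (induction I rule: infinite_finite_induct) (simp_all add: zero_prod_def)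
  have "(\<Sum>i<15. coV i y *\<^sub>R bV i) = (\<Sum>i<15. (sl4_coord i Y1 *\<^sub>R sl4_basis i, 0))"
    by (intro sum.cong) (auto simp: coV_def bV_def y)
  moreover have "(\<Sum>i<15. coV (15 + i) y *\<^sub>R bV (15 + i)) = (\<Sum>i<15. (0, sl4_coord i Y2 *\<^sub>R sl4_basis i))"
    by (intro sum.cong) (auto simp: coV_def bV_def y)
  ultimately show ?thesis
    unfolding sum_30 p using sl4_expansion[OF y(2)] sl4_expansion[OF y(3)] by (simp add: y(1))
qed

text \<open>The Alexander matrix without the block column of the meridian, over polynomials: t times
  the action of the meridian on the diagonal blocks, minus the Fox Jacobian of \<phi>.\<close>

definition Q :: "real poly mat" where
  "Q = Matrix.mat 30 30 (\<lambda>(p, q).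
    (if p div 15 = q div 15 then [:0, sl4_coord (p mod 15) (Ad (\<rho> mer) (sl4_basis (q mod 15))):] else 0)
    - [:sl4_coord (p mod 15) (cz (unit (q div 15) (sl4_basis (q mod 15))) (\<phi> (gen (p div 15)))):])"

lemma twisted_alexander_matrix_eq:
  "delete_block_column 15 2 (twisted_alexander_matrix 3 R 15 (\<lambda>g. Ad_mat (\<rho> g)) \<alpha>) = map_mat to_fract Q"
proof (rule eq_matI)
  fix p q assume "p < dim_row (map_mat to_fract Q)" "q < dim_col (map_mat to_fract Q)"
  then have pq: "p < 30" "q < 30" by (simp_all add: Q_def)
  have pq': "p div 15 < 2" "q div 15 < 2" "p mod 15 < 15" "q mod 15 < 15" using pq by auto
  have R: "R ! (p div 15) = reduce (relator (p div 15))"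
    using less_2_cases[OF pq'(1)] by (auto simp: R_eq)
  have "delete_block_column 15 2 (twisted_alexander_matrix 3 R 15 (\<lambda>g. Ad_mat (\<rho> g)) \<alpha>) $$ (p, q)
      = te (fox (q div 15) (R ! (p div 15))) $$ (p mod 15, q mod 15)"
    using pq by (simp add: delete_block_column_def twisted_alexander_matrix_def R_eq)
  also have "\<dots> = ring_eval (h (p mod 15) (q mod 15)) (fox (q div 15) (reduce (relator (p div 15))))"
    unfolding R by (rule te_index[OF pq'(3,4)])
  also have "\<dots> = map_mat to_fract Q $$ (p, q)"
    unfolding relator_eval[OF pq'] using pq
    by (simp add: Q_def to_fract_diff t_fract_def const_fract_def flip: to_fract_mult)
  finally show "delete_block_column 15 2 (twisted_alexander_matrix 3 R 15 (\<lambda>g. Ad_mat (\<rho> g)) \<alpha>) $$ (p, q)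
      = map_mat to_fract Q $$ (p, q)" .
qed (simp_all add: delete_block_column_def twisted_alexander_matrix_def Q_def R_eq)

definition MN :: "real mat" where
  "MN = Matrix.mat 30 30 (\<lambda>(i, j). coV i (N (bV j)))"

definition mer2 :: "(real^4^4) \<times> (real^4^4) \<Rightarrow> (real^4^4) \<times> (real^4^4)" where
  "mer2 d = (Ad (\<rho> mer) (fst d), Ad (\<rho> mer) (snd d))"

definition MA :: "real mat" where
  "MA = Matrix.mat 30 30 (\<lambda>(i, j). coV i (mer2 (bV j)))"

lemma linear_mer2: "linear mer2"
  using linear_Ad[OF x_closed] by (intro linearI) (simp_all add: mer2_def linear_add linear_scale)

lemma mer2_T: "mer2 (T d) = (cz (vals d) (\<phi> (gen 0)), cz (vals d) (\<phi> (gen 1)))"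
  by (simp add: mer2_def T_def mer_inv_def Ad_inv(1)[OF x_closed])

lemma coV_expansion:
  assumes "linear f" "y \<in> V" shows "coV p (f y) = (\<Sum>r<30. coV p (f (bV r)) * coV r y)"
proof -
  have "coV p (f y) = coV p (f (\<Sum>r<30. coV r y *\<^sub>R bV r))" using V_expansion[OF assms(2)] by simp
  then show ?thesis
    by (simp add: linear_sum[OF assms(1)] linear_scale[OF assms(1)] linear_sum[OF linear_coV]
        linear_scale[OF linear_coV] mult.commute)
qed

lemma vals_bV: "q < 30 \<Longrightarrow> vals (bV q) = unit (q div 15) (sl4_basis (q mod 15))"
  by (auto simp: vals_def bV_def unit_def fun_eq_iff)

lemma const_poly_sum: "[:\<Sum>i\<in>I. f i:] = (\<Sum>i\<in>I. [:f i:])"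
proof (induction I rule: infinite_finite_induct)
  case (insert x F)
  then show ?case by (simp add: insert.IH[symmetric])
qed simp_all

text \<open>Undoing the action of the meridian on the Fox Jacobian gives the matrix of
  \<open>T\<close>, so \<open>Q\<close> is \<open>MA\<close> times t - T, and T = 1 + N.\<close>

lemma Q_factor:
  "Q = map_mat (\<lambda>a. [:a:]) MA * ([:- 1, 1:] \<cdot>\<^sub>m 1\<^sub>m 30 - map_mat (\<lambda>a. [:a:]) MN)" (is "Q = ?A * ?B")
proof (rule eq_matI)
  fix p q assume "p < dim_row (?A * ?B)" "q < dim_col (?A * ?B)"
  then have pq: "p < 30" "q < 30" by (simp_all add: MA_def MN_def)
  have "(?A * ?B) $$ (p, q) = (\<Sum>r<30. [:MA $$ (p, r):] * ((if r = q then [:- 1, 1:] else 0) - [:MN $$ (r, q):]))"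
  proof -
    have "(?A * ?B) $$ (p, q) = (\<Sum>r = 0..<30. ?A $$ (p, r) * ?B $$ (r, q))"
      using pq by (simp add: scalar_prod_def MA_def MN_def del: mult_pCons_left mult_pCons_right)
    also have "\<dots> = (\<Sum>r<30. [:MA $$ (p, r):] * ((if r = q then [:- 1, 1:] else 0) - [:MN $$ (r, q):]))"
      unfolding atLeast0LessThan
    proof (rule sum.cong[OF refl])
      fix r assume "r \<in> {..<30 :: nat}"
      then have r: "r < 30" by simp
      have A: "?A $$ (p, r) = [:MA $$ (p, r):]" using pq r by (simp add: MA_def)
      have B: "?B $$ (r, q) = (if r = q then [:- 1, 1:] else 0) - [:MN $$ (r, q):]"
        using pq r by (cases "r = q") (simp_all add: MN_def)
      show "?A $$ (p, r) * ?B $$ (r, q) = [:MA $$ (p, r):] * ((if r = q then [:- 1, 1:] else 0) - [:MN $$ (r, q):])"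
        unfolding A B by (rule refl)
    qed
    finally show ?thesis .
  qed
  also have "\<dots> = (\<Sum>r<30. if r = q then [:MA $$ (p, q):] * [:- 1, 1:] else 0) - (\<Sum>r<30. [:MA $$ (p, r) * MN $$ (r, q):])"
    unfolding sum_subtractf[symmetric] by (intro sum.cong) (auto simp: right_diff_distrib mult.commute)
  also have "(\<Sum>r<30. [:MA $$ (p, r) * MN $$ (r, q):]) = [:\<Sum>r<30. MA $$ (p, r) * MN $$ (r, q):]"
    by (rule const_poly_sum[symmetric])
  also have "(\<Sum>r<30. MA $$ (p, r) * MN $$ (r, q)) = coV p (mer2 (N (bV q)))"
    unfolding coV_expansion[OF linear_mer2 N_V[OF bV_V]] using pq by (intro sum.cong) (auto simp: MA_def MN_def)
  also have "\<dots> = coV p (mer2 (T (bV q))) - coV p (mer2 (bV q))"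
    by (simp add: N_def linear_diff[OF linear_mer2] linear_diff[OF linear_coV])
  also have "coV p (mer2 (T (bV q))) = sl4_coord (p mod 15) (cz (unit (q div 15) (sl4_basis (q mod 15))) (\<phi> (gen (p div 15))))"
  proof -
    have "p div 15 = 0 \<or> p div 15 = 1" using pq(1) by auto
    then show ?thesis unfolding mer2_T vals_bV[OF pq(2)] coV_def by auto
  qed
  finally have B: "(?A * ?B) $$ (p, q) = [:- coV p (mer2 (bV q)), coV p (mer2 (bV q)):]
      - [:sl4_coord (p mod 15) (cz (unit (q div 15) (sl4_basis (q mod 15))) (\<phi> (gen (p div 15)))) - coV p (mer2 (bV q)):]"
    using pq by (simp add: MA_def)
  have "coV p (mer2 (bV q)) = (if p div 15 = q div 15 then sl4_coord (p mod 15) (Ad (\<rho> mer) (sl4_basis (q mod 15))) else 0)"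
  proof -
    have "p div 15 = 0 \<or> p div 15 = 1" "q div 15 = 0 \<or> q div 15 = 1" using pq by auto
    then show ?thesis
      by (auto simp: coV_def mer2_def bV_def linear_0[OF linear_Ad[OF x_closed]] linear_0[OF linear_sl4_coord])
  qed
  then show "Q $$ (p, q) = (?A * ?B) $$ (p, q)" unfolding B using pq by (simp add: Q_def)
qed (simp_all add: Q_def MA_def MN_def)

lemma MN_carrier: "MN \<in> carrier_mat 30 30"
  by (simp add: MN_def)

lemma det_Q: "char_poly MN \<circ>\<^sub>p [:- 1, 1:] dvd det Q"
proof -
  let ?A = "map_mat (\<lambda>a. [:a:]) MA" and ?B = "[:- 1, 1:] \<cdot>\<^sub>m 1\<^sub>m 30 - map_mat (\<lambda>a. [:a:]) MN"
  have "?B = map_mat (\<lambda>p. p \<circ>\<^sub>p [:- 1, 1:]) (char_poly_matrix MN)"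
    unfolding char_poly_matrix_eq[OF MN_carrier]
    by (rule eq_matI) (auto simp: MN_def pcompose_pCons pcompose_diff)
  then have B: "det ?B = char_poly MN \<circ>\<^sub>p [:- 1, 1:]" by (simp only: det_map_pcompose char_poly_def)
  have "det Q = det ?A * det ?B"
    unfolding Q_factor by (rule det_mult[of _ 30]) (auto simp: MA_def MN_def intro!: minus_carrier_mat)
  then show ?thesis unfolding B by simp
qed

text \<open>Exponent 16 is the fourth iterated square, and the shift from s to t - 1 moves the zero
  from 0 to 1.\<close>

lemma power_dvd_det_Q:
  assumes "dim {y \<in> V. (N ^^ 16) y = 0} \<ge> 21" shows "[:- 1, 1:] ^ 21 dvd det Q"
proof -
  have "[:0, 1:] ^ 21 dvd char_poly MN"
    unfolding MN_def
  proof (rule power_dvd_char_poly_dim_kernel[OF subspace_V dim_V linear_N, where k = 4])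
    show "21 \<le> dim {y \<in> V. (N ^^ 2 ^ 4) y = 0}" using assms by simp
  qed (use N_V bV_V linear_coV V_expansion in auto)
  then have "[:- 1, 1:] ^ 21 dvd char_poly MN \<circ>\<^sub>p [:- 1, 1:]"
    using power_dvd_pcompose_linear[of 0 21 "char_poly MN" "- 1"] by simp
  then show ?thesis using det_Q dvd_trans by blast
qed

end

section \<open>Commuting elements, root multiplicities and restriction in first cohomology\<close>

text \<open>The traceless part of \<open>A\<close> commutes with \<open>A\<close>; when it vanishes,
  \<open>A\<close> is scalar and any element will do.\<close>

lemma commuting_sl4:
  fixes A :: "real^4^4" obtains Y where "Y \<in> sl4" "Y \<noteq> 0" "Y ** A = A ** Y"
proof (cases "A - (trace A / 4) *\<^sub>R id4 = 0")
  case True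
  then have A: "A = (trace A / 4) *\<^sub>R id4" by simp
  have "sl4_coord 1 (sl4_basis 1) = 1" by (subst sl4_coord_basis) simp_all
  then have "sl4_basis 1 \<noteq> 0" using linear_0[OF linear_sl4_coord] by force
  moreover have "sl4_basis 1 ** A = A ** sl4_basis 1"
    by (subst (1 2) A) (simp only: mult_smult_one smult_one_mult)
  ultimately show ?thesis using that sl4_basis_in_sl4[of 1] by simp
next
  case False
  let ?Y = "A - (trace A / 4) *\<^sub>R id4"
  have "?Y \<in> sl4" by (simp add: sl4_def trace_sub trace_scaleR trace_I)
  moreover have "?Y ** A = A ** ?Y"
    unfolding matmult.diff_left matmult.diff_right mult_smult_one smult_one_mult by (rule refl)
  ultimately show ?thesis using that False by blast
qed

text \<open>The ambiguity \<open>c t\<^sup>e\<close> has neither zero nor pole at 1, and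
  cross-multiplication shows that the multiplicity is the same for every representation as a
  quotient.\<close>

lemma root_multiplicity_unit_factor:
  fixes \<Delta> :: "'k::field poly fract"
  assumes \<Delta>: "\<Delta> = const_fract c * t_fract powi e * (to_fract a / to_fract b)"
    and c: "c \<noteq> 0" and b: "b \<noteq> 0" and root: "has_root_of_multiplicity \<Delta> 1 m"
  shows "a \<noteq> 0" "Polynomial.order 1 a = Polynomial.order 1 b + m"
proof -
  obtain p q where pq: "p \<noteq> 0" "q \<noteq> 0" "\<Delta> = to_fract p / to_fract q"
      "Polynomial.order 1 p = Polynomial.order 1 q + m"
    using root by (auto simp: has_root_of_multiplicity_def)
  have ord: "Polynomial.order (1 :: 'k) ([:0, 1:] ^ n) = 0" for n :: nat
    by (rule order_0I) simp
  have pow: "to_fract x ^ n = to_fract (x ^ n)" for x :: "'k poly" and n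
    by (induction n) (simp_all flip: to_fract_mult)
  obtain u v :: "'k poly" where uv: "t_fract powi e = to_fract u / to_fract v" "u \<noteq> 0" "v \<noteq> 0"
      "Polynomial.order 1 u = 0" "Polynomial.order 1 v = 0"
  proof (cases "e \<ge> 0")
    case True
    show ?thesis
      by (rule that[of "[:0, 1:] ^ nat e" 1])
        (use True in \<open>auto simp: power_int_def t_fract_def pow ord\<close>)
  next
    case False
    show ?thesis
      by (rule that[of 1 "[:0, 1:] ^ nat (- e)"])
        (use False in \<open>auto simp: power_int_def t_fract_def pow ord divide_inverse power_inverse\<close>)
  qed
  have "const_fract c * (to_fract u / to_fract v) * (to_fract a / to_fract b) = to_fract p / to_fract q"
    using \<Delta> pq(3) uv(1) by simp
  then have "to_fract [:c:] * to_fract u * to_fract a * to_fract q = to_fract p * to_fract v * to_fract b"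
    using uv(2,3) pq(2) b by (simp add: const_fract_def field_simps)
  then have eq: "[:c:] * u * a * q = p * v * b"
    by (simp only: to_fract_mult[symmetric] to_fract_eq_iff)
  have nz: "p * v * b \<noteq> 0" using pq uv b by simp
  then have nz': "[:c:] * u * a * q \<noteq> 0" unfolding eq .
  then show "a \<noteq> 0" by auto
  have oc: "Polynomial.order 1 [:c:] = 0" by (rule order_0I) (use c in simp)
  have "Polynomial.order 1 ([:c:] * u * a * q) = Polynomial.order 1 a + Polynomial.order 1 q"
    using nz' by (simp only: order_mult mult_eq_0_iff de_Morgan_disj simp_thms oc uv(4) add_0)
  moreover have "Polynomial.order 1 (p * v * b) = Polynomial.order 1 p + Polynomial.order 1 b"
    using nz by (simp only: order_mult mult_eq_0_iff de_Morgan_disj simp_thms uv(5) add_0_right)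
  ultimately show "Polynomial.order 1 a = Polynomial.order 1 b + m" using eq pq(4) by simp
qed

lemma cocycles1_diff:
  assumes "d \<in> cocycles1 G act V" "e \<in> cocycles1 G act V" "subspace V"
    and "\<And>g. g \<in> carrier G \<Longrightarrow> linear (act g)"
  shows "(\<lambda>g. d g - e g) \<in> cocycles1 G act V"
  using assms by (auto simp: cocycles1_def subspace_diff linear_diff)

lemma cohomologous1_iff:
  "(d, e) \<in> cohomologous1 G act V \<longleftrightarrow> d \<in> cocycles1 G act V \<and> e \<in> cocycles1 G act V \<and>
    (\<exists>v\<in>V. \<forall>g\<in>carrier G. d g - e g = act g v - v)"
proof -
  have "(\<lambda>g. d g - e g) \<in> coboundaries1 G act V \<longleftrightarrow> (\<exists>v\<in>V. \<forall>g\<in>carrier G. d g - e g = act g v - v)"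
    if "d \<in> cocycles1 G act V" "e \<in> cocycles1 G act V"
    using that by (auto simp: coboundaries1_def cocycles1_def fun_eq_iff)
  then show ?thesis by (auto simp: cohomologous1_def)
qed

lemma equiv_cohomologous1:
  assumes lin: "\<And>g. g \<in> carrier G \<Longrightarrow> linear (act g)" and V: "subspace V"
  shows "equiv (cocycles1 G act V) (cohomologous1 G act V)"
proof (rule equivI)
  show "cohomologous1 G act V \<subseteq> cocycles1 G act V \<times> cocycles1 G act V"
    by (auto simp: cohomologous1_def)
  show "refl_on (cocycles1 G act V) (cohomologous1 G act V)"
    by (rule refl_onI) (auto simp: cohomologous1_iff linear_0[OF lin] intro!: bexI[of _ 0] subspace_0[OF V])
  show "sym (cohomologous1 G act V)"
  proof (rule symI)
    fix d e assume "(d, e) \<in> cohomologous1 G act V"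
    then obtain v where v: "v \<in> V" "\<forall>g\<in>carrier G. d g - e g = act g v - v"
      and de: "d \<in> cocycles1 G act V" "e \<in> cocycles1 G act V" by (auto simp: cohomologous1_iff)
    have "e g - d g = act g (- v) - (- v)" if g: "g \<in> carrier G" for g
    proof -
      have "e g - d g = - (d g - e g)" by simp
      also have "\<dots> = - (act g v - v)" using v(2) g by simp
      finally show ?thesis using g by (simp add: linear_neg[OF lin])
    qed
    then show "(e, d) \<in> cohomologous1 G act V"
      using de subspace_neg[OF V v(1)] unfolding cohomologous1_iff by blast
  qed
  show "trans (cohomologous1 G act V)"
  proof (rule transI)
    fix d e f assume "(d, e) \<in> cohomologous1 G act V" "(e, f) \<in> cohomologous1 G act V"
    then obtain v w where v: "v \<in> V" "\<forall>g\<in>carrier G. d g - e g = act g v - v"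
      and w: "w \<in> V" "\<forall>g\<in>carrier G. e g - f g = act g w - w"
      and df: "d \<in> cocycles1 G act V" "f \<in> cocycles1 G act V" by (auto simp: cohomologous1_iff)
    have "d g - f g = act g (v + w) - (v + w)" if g: "g \<in> carrier G" for g
    proof -
      have "d g - f g = (d g - e g) + (e g - f g)" by simp
      also have "\<dots> = (act g v - v) + (act g w - w)" using v(2) w(2) g by simp
      finally show ?thesis using g by (simp add: linear_add[OF lin])
    qed
    then show "(d, f) \<in> cohomologous1 G act V"
      using df subspace_add[OF V v(1) w(1)] unfolding cohomologous1_iff by blast
  qed
qed

text \<open>The class-level statement reduces to cocycles: two classes with equal restriction have
  representatives whose difference is principal on \<open>H\<close>.\<close>

lemma inj_on_H1_restriction:
  fixes G :: "('g, 'x) monoid_scheme" and V :: "'v::real_vector set"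
  assumes lin: "\<And>g. g \<in> carrier G \<Longrightarrow> linear (act g)" and V: "subspace V"
    and H: "H \<subseteq> carrier G" "\<And>g h. g \<in> H \<Longrightarrow> h \<in> H \<Longrightarrow> g \<otimes>\<^bsub>G\<^esub> h \<in> H"
    and principal: "\<And>d v. d \<in> cocycles1 G act V \<Longrightarrow> v \<in> V \<Longrightarrow> (\<And>g. g \<in> H \<Longrightarrow> d g = act g v - v)
      \<Longrightarrow> \<exists>v\<in>V. \<forall>g\<in>carrier G. d g = act g v - v"
  shows "inj_on (H1_restriction G act V H) (H1 G act V)"
proof (rule inj_onI)
  let ?E = "cohomologous1 G act V" and ?EH = "cohomologous1 (G\<lparr>carrier := H\<rparr>) act V"
  define res :: "('g \<Rightarrow> 'v) \<Rightarrow> 'g \<Rightarrow> 'v" where "res = (\<lambda>d g. if g \<in> H then d g else 0)"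
  have E: "equiv (cocycles1 G act V) ?E" by (rule equiv_cohomologous1[OF lin V])
  have EH: "equiv (cocycles1 (G\<lparr>carrier := H\<rparr>) act V) ?EH"
    by (rule equiv_cohomologous1[OF _ V]) (use lin H in auto)
  fix c c' assume c: "c \<in> H1 G act V" "c' \<in> H1 G act V"
    and eq: "H1_restriction G act V H c = H1_restriction G act V H c'"
  obtain d where d: "d \<in> cocycles1 G act V" "c = ?E `` {d}"
    using c(1) unfolding H1_def by (rule quotientE)
  obtain d' where d': "d' \<in> cocycles1 G act V" "c' = ?E `` {d'}"
    using c(2) unfolding H1_def by (rule quotientE)
  have "res d \<in> cocycles1 (G\<lparr>carrier := H\<rparr>) act V" using d(1) H(2) subsetD[OF H(1)] by (auto simp: cocycles1_def res_def)
  then have "(res d, res d) \<in> ?EH" using EH by (auto simp: equiv_def refl_on_def)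
  moreover have "d \<in> c" unfolding d(2) by (rule equiv_class_self[OF E d(1)])
  \<comment> \<open>Equality of the two restricted classes yields a representative \<open>e\<close>
    of \<open>c'\<close> whose restriction is cohomologous to that of \<open>d\<close>.\<close>
  ultimately have "res d \<in> H1_restriction G act V H c'"
    unfolding eq[symmetric] unfolding H1_restriction_def res_def[symmetric] by blast
  then obtain e where e: "e \<in> c'" "(res e, res d) \<in> ?EH"
    unfolding H1_restriction_def res_def[symmetric] by blast
  have e': "(d', e) \<in> ?E" using e(1) by (simp add: d'(2))
  then have eZ: "e \<in> cocycles1 G act V" by (simp add: cohomologous1_iff)
  obtain v where v: "v \<in> V" "\<forall>g\<in>H. res e g - res d g = act g v - v"
    using e(2) by (auto simp: cohomologous1_iff res_def)
  have diff: "e g - d g = act g v - v" if "g \<in> H" for g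
    using bspec[OF v(2) that] that by (simp add: res_def)
  have "\<exists>v\<in>V. \<forall>g\<in>carrier G. e g - d g = act g v - v"
    by (rule principal[OF cocycles1_diff[OF eZ d(1) V lin] v(1) diff])
  then have "(e, d) \<in> ?E" using eZ d(1) by (simp add: cohomologous1_iff)
  with e' have "(d', d) \<in> ?E" using E by (meson equivE transE)
  then show "c = c'" unfolding d(2) d'(2) using equiv_class_eq[OF E] by blast
qed

section \<open>The denominator and the conclusion\<close>

context fibered_holonomy
begin

abbreviation "one_minus_gen k \<equiv> Poly_Mapping.single [] 1 - Poly_Mapping.single (gen k) (1::int)"

lemma te_gen:
  assumes k: "k < 3" and p: "p < 15" and q: "q < 15"
  shows "te (one_minus_gen k) $$ (p, q) = (if p = q then 1 else 0)
    - t_fract powi \<alpha> (cls (gen k)) * const_fract (sl4_coord p (Ad (\<rho> (cls (gen k))) (sl4_basis q)))"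
proof -
  have g: "gen k \<in> carrier F3" using k by (simp add: in_free_group reduced_Cons)
  have h1: "h p q [] = (if p = q then 1 else 0)"
    using h_F2[OF p q Nil_F2] by (simp add: cls_Nil Ad_one sl4_coord_basis p q const_fract_simps)
  have "te (one_minus_gen k) $$ (p, q) = ring_eval (h p q) (Poly_Mapping.single [] 1 + - Poly_Mapping.single (gen k) 1)"
    unfolding te_index[OF p q] by simp
  also have "\<dots> = h p q [] - h p q (gen k)"
    unfolding ring_eval_add ring_eval_uminus ring_eval_single by simp
  finally show ?thesis unfolding h1 h_eq[OF p q g] .
qed

lemma te_carrier: "te f \<in> carrier_mat 15 15"
  by (simp add: twisted_eval_def)

text \<open>The adjoint action of any element fixes a nonzero vector, by
  \<open>commuting_sl4\<close>, and for a fiber generator there is no factor t to spoil this. Only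
  the column of the meridian can therefore be deleted.\<close>

lemma det_te_fiber_gen:
  assumes k: "k < 2" shows "det (te (one_minus_gen k)) = 0"
proof -
  let ?g = "cls (gen k)" and ?M = "te (one_minus_gen k)"
  have g: "?g \<in> carrier \<Gamma>" by (rule cls_closed) (use k in simp)
  have k3: "k < 3" using k by simp
  have \<alpha>g: "\<alpha> ?g = 0" by (rule \<alpha>_F2[OF gen_F2[OF k]])
  obtain Y where Y: "Y \<in> sl4" "Y \<noteq> 0" "Y ** L ?g = L ?g ** Y" by (rule commuting_sl4)
  have fixed: "Ad (\<rho> ?g) Y = Y" using Y(3) Ad_fixed_iff[OF g] by simp
  define z where "z = Matrix.vec 15 (\<lambda>r. const_fract (sl4_coord r Y))"
  have z: "z \<in> carrier_vec 15" by (simp add: z_def)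
  have "?M *\<^sub>v z = 0\<^sub>v 15"
  proof (rule eq_vecI)
    fix p assume "p < dim_vec (0\<^sub>v 15 :: real poly fract Matrix.vec)"
    then have p: "p < 15" by simp
    have dim: "dim_row ?M = 15" "dim_col ?M = 15" using te_carrier by blast+
    have "vec_index (?M *\<^sub>v z) p = (\<Sum>r<15. ?M $$ (p, r) * const_fract (sl4_coord r Y))"
      using p dim by (simp add: scalar_prod_def z_def atLeast0LessThan)
    also have "\<dots> = (\<Sum>r<15. if p = r then const_fract (sl4_coord r Y) else 0)
        - (\<Sum>r<15. const_fract (sl4_coord p (Ad (\<rho> ?g) (sl4_basis r)) * sl4_coord r Y))"
      unfolding sum_subtractf[symmetric]
      by (intro sum.cong) (auto simp: te_gen[OF k3 p] \<alpha>g const_fract_simps left_diff_distrib)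
    also have "\<dots> = const_fract (sl4_coord p Y) - const_fract (sl4_coord p (Ad (\<rho> ?g) Y))"
      unfolding sl4_coord_expansion[OF linear_Ad[OF g] Y(1), of p] const_fract_sum using p by simp
    finally show "vec_index (?M *\<^sub>v z) p = vec_index (0\<^sub>v 15) p" using p by (simp add: fixed)
  qed (use te_carrier in auto)
  moreover have "z \<noteq> 0\<^sub>v 15"
  proof
    assume 0: "z = 0\<^sub>v 15"
    have "const_fract (sl4_coord r Y) = 0" if "r < 15" for r
      using that arg_cong[OF 0, of "\<lambda>v. vec_index v r"] by (simp add: z_def)
    then have "sl4_coord r Y = 0" if "r < 15" for r using that by (simp add: const_fract_def)
    then have "(\<Sum>m<15. sl4_coord m Y *\<^sub>R sl4_basis m) = 0" by simp
    then show False using sl4_expansion[OF Y(1)] Y(2) by simp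
  qed
  ultimately show ?thesis using det_0_iff_vec_prod_zero[OF te_carrier] z by blast
qed

definition QX :: "real poly mat" where
  "QX = Matrix.mat 15 15 (\<lambda>(p, q). (if p = q then 1 else 0) - [:0, sl4_coord p (Ad (\<rho> mer) (sl4_basis q)):])"

lemma te_mer: "te (one_minus_gen 2) = map_mat to_fract QX"
proof (rule eq_matI)
  fix p q assume "p < dim_row (map_mat to_fract QX)" "q < dim_col (map_mat to_fract QX)"
  then have pq: "p < 15" "q < 15" by (simp_all add: QX_def)
  have "te (one_minus_gen 2) $$ (p, q) = (if p = q then 1 else 0)
      - t_fract * const_fract (sl4_coord p (Ad (\<rho> mer) (sl4_basis q)))"
    using te_gen[OF _ pq, of 2] by (simp only: \<alpha>_mer power_int_1_right)
  also have "\<dots> = map_mat to_fract QX $$ (p, q)"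
    using pq by (simp add: QX_def to_fract_diff t_fract_def const_fract_def flip: to_fract_mult)
  finally show "te (one_minus_gen 2) $$ (p, q) = map_mat to_fract QX $$ (p, q)" .
qed (use te_carrier in \<open>auto simp: QX_def\<close>)

text \<open>Entries are linear in t. A bound on the degree bounds the order of the zero at 1, with
  no need to know the determinant.\<close>

lemma degree_det_QX: "degree (det QX) \<le> 15"
proof -
  have "degree (det QX) \<le> 1 * 15"
    by (rule degree_det_le) (auto simp: QX_def intro!: degree_diff_le)
  then show ?thesis by simp
qed

lemma dim_generalized_kernel_N:
  assumes \<Delta>: "is_twisted_alexander_polynomial 3 R 15 (\<lambda>g. Ad_mat (\<rho> g)) \<alpha> \<Delta>"
    and root: "has_root_of_multiplicity \<Delta> 1 5"
  shows "dim {y \<in> V. (N ^^ 16) y = 0} \<le> 20"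
proof (rule ccontr)
  obtain k c s where k: "k < 3" and d: "det (te (one_minus_gen k)) \<noteq> 0" and c: "c \<noteq> 0"
    and eq: "\<Delta> = const_fract c * t_fract powi (int 15 * s) *
      (det (delete_block_column 15 k (twisted_alexander_matrix 3 R 15 (\<lambda>g. Ad_mat (\<rho> g)) \<alpha>)) / det (te (one_minus_gen k)))"
    using \<Delta> unfolding is_twisted_alexander_polynomial_def Let_def by blast
  have k2: "k = 2" using k d det_te_fiber_gen[of k] by linarith
  note det_hom = comm_ring_hom.hom_det[OF comm_ring_hom_to_fract]
  have QX: "det QX \<noteq> 0" using d unfolding k2 te_mer det_hom by auto
  have "\<Delta> = const_fract c * t_fract powi (int 15 * s) * (to_fract (det Q) / to_fract (det QX))"
    using eq unfolding k2 te_mer twisted_alexander_matrix_eq det_hom .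
  note ord = root_multiplicity_unit_factor[OF this c QX root]
  \<comment> \<open>The degree bound 15 for the denominator plus the multiplicity 5.\<close>
  have "Polynomial.order 1 (det Q) \<le> 20" using ord(2) order_degree[OF QX, of 1] degree_det_QX by simp
  moreover assume "\<not> dim {y \<in> V. (N ^^ 16) y = 0} \<le> 20"
  then have "[:- 1, 1:] ^ 21 dvd det Q" by (intro power_dvd_det_Q) simp
  then have "21 \<le> Polynomial.order 1 (det Q)" using ord(1) by (simp add: order_divides)
  ultimately show False by simp
qed

end

theorem theorem3p3:
  fixes \<phi> :: "word \<Rightarrow> word"
    and \<rho> :: "word set \<Rightarrow> (real^4^4) set"
    and \<alpha> :: "word set \<Rightarrow> int"
    and \<Delta> :: "real poly fract"
  assumes "hyperbolic_monodromy \<phi>"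
    and "is_holonomy \<phi> \<rho>"
    and "is_fibration_hom \<phi> \<alpha>"
    and "is_twisted_alexander_polynomial 3 (bundle_relators \<phi>) 15 (\<lambda>g. Ad_mat (\<rho> g)) \<alpha> \<Delta>"
    and "has_root_of_multiplicity \<Delta> 1 5"
  shows "infinitesimally_projectively_rigid_rel_cusp \<phi> \<rho>"
proof -
  interpret fibered_holonomy \<phi> \<rho> \<alpha> by unfold_locales (fact assms)+
  let ?H = "peripheral_subgroup \<phi>"
  have "word_class 3 R (gen 2) = mer"
    by (rule cls_word) (simp add: in_free_group reduced_Cons)
  moreover have "word_class 3 R boundary_word = bd"
    by (rule cls_word, rule free_group_mono[OF boundary_F2]) simp
  ultimately have H_eq: "?H = generate \<Gamma> {mer, bd}" by (simp add: peripheral_subgroup_def)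
  have sub: "subgroup ?H \<Gamma>"
    unfolding H_eq by (rule \<Gamma>.generate_is_subgroup) (use c_closed x_closed in auto)
  have bd: "bd \<in> ?H" unfolding H_eq by (rule generate.incl) simp
  show ?thesis
    unfolding infinitesimally_projectively_rigid_rel_cusp_def
  proof (rule inj_on_H1_restriction)
    fix d v assume "d \<in> Z1" "v \<in> sl4" "\<And>g. g \<in> ?H \<Longrightarrow> d g = Ad (\<rho> g) v - v"
    then show "\<exists>v\<in>sl4. \<forall>g\<in>carrier \<Gamma>. d g = Ad (\<rho> g) v - v"
      using cocycle_coboundary[OF dim_generalized_kernel_N[OF assms(4,5)]] bd by metis
  qed (use linear_Ad subspace_sl4 subgroup.subset[OF sub] subgroup.m_closed[OF sub] in auto)
qed

end
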